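(* For each $k\in\mathbb{Z}$, there exist parameters $c>1$ and $p,q,r\ge0$ with $p+q+r=1$, $p+r>0$, $q+r>0$ such that $\rho^{(k)\,\mathrm{sym}}\in ID$ and $\rho^{(k)}\in ID^0$, and there exist (possibly different) such parameters for which $\mu^{(k)\,\mathrm{sym}}\in ID$ and $\mu^{(k)}\in ID^0$.
   Context: For $k\in\mathbb{Z}$ and parameters $c,p,q,r$ as in the claim, let $\{(N_t^{(k)},L_t^{(k)}),t\ge0\}$ be the bivariate compound Poisson process (pure jump, no drift) with $E[e^{i(z_1N_t^{(k)}+z_2L_t^{(k)})}]=\exp[t\int_{\mathbb{R}^2}(e^{i(z_1x_1+z_2x_2)}-1)\nu^{(k)}(dx)]$, where $\nu^{(k)}$ is concentrated on the points $(1,0)$, $(0,1)$, $(1,c^{-k})$ with masses $u,v,w\ge0$ respectively, and $p=u/(u+v+w)$, $q=v/(u+v+w)$, $r=w/(u+v+w)$. Let $T$ be the first jump time of $\{N_t^{(k)}\}$. Define $\rho^{(k)}$ as the distribution of $L_T^{(k)}$, and $\mu^{(k)}$ as the distribution of $\int_0^{\infty-}c^{-N^{(k)}_{s-}}\,dL_s^{(k)}$ (the almost sure limit of $\int_0^t$ as $t\to\infty$, which exists). These depend on $u,v,w$ only through $p,q,r$. The symmetrization $\sigma^{\mathrm{sym}}$ of a distribution $\sigma$ is the distribution with characteristic function $|\widehat\sigma(z)|^2$; $\rho^{(k)\,\mathrm{sym}},\mu^{(k)\,\mathrm{sym}}$ are the symmetrizations of $\rho^{(k)},\mu^{(k)}$.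 A distribution $\sigma$ on $\mathbb{R}$ is quasi-infinitely divisible if its characteristic function is $\widehat\sigma(z)=\exp[i\gamma z-az^2+\int_{\mathbb{R}}(e^{izx}-1-izx1_{[-1,1]}(x))\,\nu_\sigma(dx)]$, where $\gamma,a\in\mathbb{R}$ and $\nu_\sigma$ is a signed measure (a difference $\nu_\sigma^+-\nu_\sigma^-$ of mutually singular measures, possibly both of infinite mass near $0$) with total variation measure $|\nu_\sigma|$ satisfying $\nu_\sigma(\{0\})=0$ and $\int(x^2\wedge1)\,|\nu_\sigma|(dx)<\infty$. $ID$ is the class of infinitely divisible distributions on $\mathbb{R}$; $ID^0$ is the class of quasi-infinitely divisible distributions that are not infinitely divisible. *)

theory Defs
  imports "HOL-Probability.Probability"
begin

section \<open>Infinite divisibility, quasi-infinite divisibility, symmetrization\<close>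

definition conv_power :: "real measure \<Rightarrow> nat \<Rightarrow> real measure" where
  "conv_power \<tau> n = (convolution \<tau> ^^ n) (return borel 0)"

definition ID :: "real measure set" where
  "ID = {\<sigma>. real_distribution \<sigma> \<and>
     (\<forall>n>0. \<exists>\<tau>. real_distribution \<tau> \<and> \<sigma> = conv_power \<tau> n)}"

definition levy_kernel :: "real \<Rightarrow> real \<Rightarrow> complex" where
  "levy_kernel z x =
     iexp (z * x) - 1 - \<i> * complex_of_real (z * x * indicator {-1..1} x)"

definition levy_integrable :: "real measure \<Rightarrow> bool" where
  "levy_integrable \<nu> \<longleftrightarrow> sets \<nu> = sets borel \<and> emeasure \<nu> {0} = 0 \<and>
     integrable \<nu> (\<lambda>x. min (x\<^sup>2) 1)"

text \<open>The signed measure in the exponent may have infinite positive and negative mass near 0.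
  It is therefore given by its two mutually singular parts; its total variation is the sum
  of these, so that the integrability condition is imposed on each part.\<close>

definition quasi_ID :: "real measure set" where
  "quasi_ID = {\<sigma>. real_distribution \<sigma> \<and>
     (\<exists>(\<gamma>::real) (a::real) \<nu>p \<nu>m.
        levy_integrable \<nu>p \<and> levy_integrable \<nu>m \<and>
        (\<exists>A\<in>sets borel. emeasure \<nu>p (- A) = 0 \<and> emeasure \<nu>m A = 0) \<and>
        (\<forall>z. char \<sigma> z = exp (\<i> * complex_of_real (\<gamma> * z) - complex_of_real (a * z\<^sup>2) +
           ((CLINT x|\<nu>p. levy_kernel z x) - (CLINT x|\<nu>m. levy_kernel z x)))))}"

definition ID0 :: "real measure set" where
  "ID0 = quasi_ID - ID"

definition symmetrization :: "real measure \<Rightarrow> real measure" where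
  "symmetrization \<sigma> =
     (THE \<tau>. real_distribution \<tau> \<and> (\<forall>z. char \<tau> z = complex_of_real ((cmod (char \<sigma> z))\<^sup>2)))"

lemma symmetrization_eq:
  assumes "real_distribution \<sigma>"
  shows "symmetrization \<sigma> = distr (\<sigma> \<Otimes>\<^sub>M \<sigma>) borel (\<lambda>(x, y). x - y)"
proof -
  interpret S: real_distribution \<sigma> by fact
  interpret P: pair_prob_space \<sigma> \<sigma> ..
  let ?\<tau> = "distr (\<sigma> \<Otimes>\<^sub>M \<sigma>) borel (\<lambda>(x, y). x - y)"
  have *: "real_distribution ?\<tau>"
    by (intro P.real_distribution_distr) measurable
  have ch: "char ?\<tau> z = complex_of_real ((cmod (char \<sigma> z))\<^sup>2)" for z
  proof -
    have m: "(\<lambda>p. iexp (z * fst p) * iexp (- (z * snd p))) \<in> borel_measurable (\<sigma> \<Otimes>\<^sub>M \<sigma>)"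
      by measurable
    have int: "integrable (\<sigma> \<Otimes>\<^sub>M \<sigma>) (\<lambda>p. iexp (z * fst p) * iexp (- (z * snd p)))"
      by (rule P.integrable_const_bound[where B = 1, OF _ m]) (simp add: norm_mult)
    have "char ?\<tau> z = (CLINT p|\<sigma> \<Otimes>\<^sub>M \<sigma>. iexp (z * (fst p - snd p)))"
      unfolding char_def by (subst integral_distr) (auto simp: case_prod_beta)
    also have "\<dots> = (CLINT p|\<sigma> \<Otimes>\<^sub>M \<sigma>. iexp (z * fst p) * iexp (- (z * snd p)))"
      by (simp add: exp_add[symmetric] algebra_simps)
    also have "\<dots> = (CLINT x|\<sigma>. (CLINT y|\<sigma>. iexp (z * x) * iexp (- (z * y))))"
      using P.integral_fst'[OF int] by simp
    also have "\<dots> = char \<sigma> z * (CLINT y|\<sigma>. iexp (- (z * y)))"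
      unfolding char_def by simp
    also have "(CLINT y|\<sigma>. iexp (- (z * y))) = (CLINT y|\<sigma>. cnj (iexp (z * y)))"
      by (rule Bochner_Integration.integral_cong) (simp_all add: exp_cnj)
    also have "\<dots> = cnj (char \<sigma> z)"
      unfolding char_def by simp
    finally show ?thesis unfolding complex_norm_square .
  qed
  show ?thesis
    unfolding symmetrization_def
  proof (rule the_equality)
    show "real_distribution ?\<tau> \<and> (\<forall>z. char ?\<tau> z = complex_of_real ((cmod (char \<sigma> z))\<^sup>2))"
      using * ch by blast
  next
    fix \<tau>
    assume "real_distribution \<tau> \<and> (\<forall>z. char \<tau> z = complex_of_real ((cmod (char \<sigma> z))\<^sup>2))"
    then show "\<tau> = ?\<tau>"
      by (intro Levy_uniqueness * ext) (simp_all only: ch)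
  qed
qed


section \<open>Levy processes and compound Poisson processes\<close>

definition cadlag :: "(real \<Rightarrow> 'b::topological_space) \<Rightarrow> bool" where
  "cadlag f \<longleftrightarrow> (\<forall>t\<ge>0. (f \<longlongrightarrow> f t) (at_right t)) \<and> (\<forall>t>0. \<exists>l. (f \<longlongrightarrow> l) (at_left t))"

text \<open>Processes are families indexed by the reals of which only the indices \<open>t \<ge> 0\<close> matter.\<close>

definition levy_process :: "'a measure \<Rightarrow> (real \<Rightarrow> 'a \<Rightarrow> 'b::euclidean_space) \<Rightarrow> bool" where
  "levy_process M X \<longleftrightarrow> prob_space M \<and>
     (\<forall>t\<ge>0. X t \<in> borel_measurable M) \<and>
     (AE \<omega> in M. X 0 \<omega> = 0) \<and>
     (\<forall>(n::nat) t. 0 \<le> t 0 \<and> (\<forall>i<n. t i \<le> t (Suc i)) \<longrightarrow>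
        prob_space.indep_vars M (\<lambda>_. borel) (\<lambda>i \<omega>. X (t (Suc i)) \<omega> - X (t i) \<omega>) {..<n}) \<and>
     (\<forall>s\<ge>0. \<forall>t\<ge>0. distr M borel (\<lambda>\<omega>. X (s + t) \<omega> - X s \<omega>) = distr M borel (X t)) \<and>
     (\<forall>s\<ge>0. \<forall>\<epsilon>>0.
        ((\<lambda>t. measure M {\<omega> \<in> space M. norm (X t \<omega> - X s \<omega>) > \<epsilon>}) \<longlongrightarrow> 0) (at s within {0..})) \<and>
     (AE \<omega> in M. cadlag (\<lambda>t. X t \<omega>))"

text \<open>Pure jump and no drift: the characteristic exponent is the integral of
  \<open>exp (i z x) - 1\<close> against a finite measure \<open>\<nu>\<close> without mass at 0.\<close>

definition compound_poisson_process ::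
    "'a measure \<Rightarrow> (real \<Rightarrow> 'a \<Rightarrow> 'b::euclidean_space) \<Rightarrow> 'b measure \<Rightarrow> bool" where
  "compound_poisson_process M X \<nu> \<longleftrightarrow>
     finite_measure \<nu> \<and> sets \<nu> = sets borel \<and> emeasure \<nu> {0} = 0 \<and> levy_process M X \<and>
     (\<forall>t\<ge>0. \<forall>z. (CLINT \<omega>|M. iexp (z \<bullet> X t \<omega>)) =
        exp (complex_of_real t * (CLINT x|\<nu>. iexp (z \<bullet> x) - 1)))"


section \<open>The bivariate process with three kinds of jumps\<close>

definition jump_measure :: "int \<Rightarrow> real \<Rightarrow> real \<Rightarrow> real \<Rightarrow> real \<Rightarrow> (real \<times> real) measure" where
  "jump_measure k c u v w = measure_of UNIV (sets borel)
     (\<lambda>A. ennreal u * indicator A (1, 0) + ennreal v * indicator A (0, 1) +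
          ennreal w * indicator A (1, c powi (- k)))"

lemma sets_jump_measure [simp]: "sets (jump_measure k c u v w) = sets borel"
  unfolding jump_measure_def
  using sets.sets_measure_of_eq[of "borel :: (real \<times> real) measure"] by simp

lemma emeasure_jump_measure:
  assumes "A \<in> sets borel"
  shows "emeasure (jump_measure k c u v w) A =
     ennreal u * indicator A (1, 0) + ennreal v * indicator A (0, 1) +
     ennreal w * indicator A (1, c powi (- k))"
proof -
  let ?m = "\<lambda>A :: (real \<times> real) set. ennreal u * indicator A (1, 0) + ennreal v * indicator A (0, 1) +
     ennreal w * indicator A (1, c powi (- k))"
  have *: "(\<Sum>i. indicator (F i) x) = (indicator (\<Union>i. F i) x :: ennreal)"
    if "disjoint_family F" for F :: "nat \<Rightarrow> (real \<times> real) set" and x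
    using suminf_indicator[OF that] by simp
  have "countably_additive (sets borel) ?m"
    unfolding countably_additive_def
  proof (intro allI impI)
    fix F :: "nat \<Rightarrow> (real \<times> real) set"
    assume d: "disjoint_family F"
    show "(\<Sum>i. ?m (F i)) = ?m (\<Union> (range F))"
      unfolding *[OF d, symmetric] by (simp add: suminf_add[symmetric])
  qed
  moreover have "positive (sets borel) ?m"
    by (simp add: positive_def)
  moreover have "sigma_algebra UNIV (sets (borel :: (real \<times> real) measure))"
    using sets.sigma_algebra_axioms[of "borel :: (real \<times> real) measure"] by simp
  ultimately show ?thesis
    unfolding jump_measure_def using assms by (intro emeasure_measure_of_sigma)
qed

definition bivariate_process ::
    "int \<Rightarrow> real \<Rightarrow> real \<Rightarrow> real \<Rightarrow> real \<Rightarrow>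
     'a measure \<Rightarrow> (real \<Rightarrow> 'a \<Rightarrow> real) \<Rightarrow> (real \<Rightarrow> 'a \<Rightarrow> real) \<Rightarrow> bool" where
  "bivariate_process k c u v w M N L \<longleftrightarrow>
     compound_poisson_process M (\<lambda>t \<omega>. (N t \<omega>, L t \<omega>)) (jump_measure k c u v w)"

definition first_jump_time :: "(real \<Rightarrow> real) \<Rightarrow> real" where
  "first_jump_time f = Inf {t. 0 < t \<and> \<not> (f \<longlongrightarrow> f t) (at_left t)}"

text \<open>Almost all paths of \<open>L\<close> start at 0 and are nondecreasing and right-continuous, so that
  the integral with respect to \<open>L\<close> over \<open>{0<..t}\<close> is a pathwise Lebesgue-Stieltjes integral;
  \<open>max s 0\<close> extends the path constantly to negative times. \<open>N\<close> is evaluated at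
  its left limit.\<close>

definition stieltjes_integral ::
    "real \<Rightarrow> (real \<Rightarrow> real) \<Rightarrow> (real \<Rightarrow> real) \<Rightarrow> real \<Rightarrow> real" where
  "stieltjes_integral c f g t =
     (LINT s:{0<..t}|interval_measure (\<lambda>s. g (max s 0)). c powr (- Lim (at_left s) f))"

text \<open>The two functionals below are defined path by path and are well behaved only almost surely;
  \<open>completion M\<close> makes them random variables regardless of the exceptional null set.\<close>

definition rho :: "'a measure \<Rightarrow> (real \<Rightarrow> 'a \<Rightarrow> real) \<Rightarrow> (real \<Rightarrow> 'a \<Rightarrow> real) \<Rightarrow> real measure" where
  "rho M N L = distr (completion M) borel (\<lambda>\<omega>. L (first_jump_time (\<lambda>t. N t \<omega>)) \<omega>)"

definition mu :: "real \<Rightarrow> 'a measure \<Rightarrow> (real \<Rightarrow> 'a \<Rightarrow> real) \<Rightarrow> (real \<Rightarrow> 'a \<Rightarrow> real) \<Rightarrow> real measure" where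
  "mu c M N L = distr (completion M) borel
     (\<lambda>\<omega>. Lim at_top (stieltjes_integral c (\<lambda>t. N t \<omega>) (\<lambda>t. L t \<omega>)))"

definition admissible :: "real \<Rightarrow> real \<Rightarrow> real \<Rightarrow> real \<Rightarrow> bool" where
  "admissible c p q r \<longleftrightarrow>
     c > 1 \<and> p \<ge> 0 \<and> q \<ge> 0 \<and> r \<ge> 0 \<and> p + q + r = 1 \<and> p + r > 0 \<and> q + r > 0"

definition rates :: "real \<Rightarrow> real \<Rightarrow> real \<Rightarrow> real \<Rightarrow> real \<Rightarrow> real \<Rightarrow> bool" where
  "rates p q r u v w \<longleftrightarrow> u \<ge> 0 \<and> v \<ge> 0 \<and> w \<ge> 0 \<and>
     p = u / (u + v + w) \<and> q = v / (u + v + w) \<and> r = w / (u + v + w)"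

end

theory Submission
  imports Defs
begin

text \<open>Both functionals are almost surely equal to
  \<open>J = lim\<^bsub>t\<rightarrow>\<infinity>\<^esub> \<integral>\<^bsub>(0,t]\<^esub> \<theta> ^ N(s-) dL(s)\<close>, with \<open>\<theta> = 1 / c\<close> for \<open>\<mu>\<close> and
  \<open>\<theta> = 0\<close> (and \<open>0 ^ 0 = 1\<close>) for \<open>\<rho>\<close>. Dyadic Riemann sums of \<open>J\<close> are functions of i.i.d.
  increments; conditioning on the first increment and refining the grid gives
  \<open>\<phi>(z) = R(z) \<phi>(\<theta> z)\<close> with \<open>R(z) = (p + r e\<^sup>i\<^sup>\<alpha>\<^sup>z) / (1 - q e\<^sup>i\<^sup>z)\<close> and \<open>\<alpha> = c\<^sup>-\<^sup>k\<close>.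

  For \<open>p < r\<close> put \<open>s = p / r\<close>. Expanding the logarithm of \<open>R\<close> around \<open>e\<^sup>i\<^sup>\<alpha>\<^sup>z\<close> gives a quasi-Levy measure
  with mass \<open>q\<^sup>m / m\<close> at \<open>\<theta>\<^sup>n m\<close> and \<open>- (- s)\<^sup>m / m\<close> at \<open>- \<alpha> \<theta>\<^sup>n m\<close>. The negative masses (\<open>m\<close> even) lie on the
  negative axis, but after symmetrization they are absorbed by the positive masses as soon as the
  points \<open>\<alpha> \<theta>\<^sup>n m\<close>, \<open>m\<close> even, are among the points \<open>\<theta>\<^sup>n m\<close> and \<open>s\<close> is small; the choices of \<open>c\<close> below achieve this.

  That the law itself is not infinitely divisible needs no uniqueness of Levy triplets: \<open>R\<close> extends to the
  Laplace transform, where it has a simple zero in the open right half-plane, and the Laplace transform of a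
  law with a convolution square root has only zeros of even order there.\<close>

section \<open>Infinitely divisible laws as Poisson series\<close>

text \<open>The process lives on an arbitrary probability space and is given by the characteristic
  function and the independence of its increments; jump times and jump marks would have to be
  constructed. Grid increments are available at once: with mesh h, two jumps of N in one cell have
  probability of order h^2, and the part of E exp (i z L_h) on N_h = 0 is read off from the joint
  characteristic function by averaging over roots of unity.

  Allowing \<theta> = 0 throughout lets one argument serve both functionals. All points \<theta>^n m
  with n > 0 then collapse to 0, so atoms at 0 are discarded.

  R is the transform of a geometric number of unit jumps plus a last jump 0 or \<alpha>. Hence J is
  an independent sum of such a variable and \<theta> times a copy of J, and this identity in law
  carries the functional equation to the Laplace transform.

  Constants: q = 1/2 and s = 2^(-l) / l with l = 3^|k|. The positive mass at the point l m is q^(l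
  m) / (l m), and s^m \<le> q^(l m) / l for m \<ge> 1. Base 3 is odd, so the parity of m can be read
  off from the point m / 3^n; this separates positive from negative atoms.\<close>

lemma integral_pair_mult:
  fixes f :: "'a \<Rightarrow> complex" and g :: "'b \<Rightarrow> complex"
  assumes "prob_space M" "prob_space N"
  assumes [measurable]: "f \<in> borel_measurable M" "g \<in> borel_measurable N"
    and bf: "\<And>x. x \<in> space M \<Longrightarrow> norm (f x) \<le> 1" and bg: "\<And>y. y \<in> space N \<Longrightarrow> norm (g y) \<le> 1"
  shows "(\<integral>p. f (fst p) * g (snd p) \<partial>(M \<Otimes>\<^sub>M N)) = (\<integral>x. f x \<partial>M) * (\<integral>y. g y \<partial>N)"
proof -
  interpret M: prob_space M by fact
  interpret N: prob_space N by fact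
  interpret P: pair_prob_space M N ..
  have "integrable (M \<Otimes>\<^sub>M N) (\<lambda>p. f (fst p) * g (snd p))"
    by (rule P.integrable_const_bound[where B = 1])
      (auto simp: norm_mult space_pair_measure intro!: AE_I2 mult_le_one bf bg)
  from P.integral_fst'[OF this] show ?thesis by simp
qed

section \<open>Convolutions, roots and exponents of characteristic functions\<close>

lemma real_distribution_convolution:
  assumes "real_distribution M" "real_distribution N"
  shows "real_distribution (convolution M N)"
proof -
  interpret M: real_distribution M by fact
  interpret N: real_distribution N by fact
  interpret P: pair_prob_space M N ..
  show ?thesis unfolding convolution_def by (intro P.real_distribution_distr) measurable
qed

text \<open>The coefficient serves two purposes: \<open>c = 1\<close> is convolution, and
  \<open>c = \<theta>\<close> is the random recursion in which a law is reproduced by adding an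
  independent variable to its contraction.\<close>

lemma char_distr_lin:
  assumes "real_distribution M" "real_distribution N"
  shows "char (distr (M \<Otimes>\<^sub>M N) borel (\<lambda>p. fst p + c * snd p)) z = char M z * char N (c * z)"
proof -
  interpret M: real_distribution M by fact
  interpret N: real_distribution N by fact
  have "char (distr (M \<Otimes>\<^sub>M N) borel (\<lambda>p. fst p + c * snd p)) z =
    (CLINT p|M \<Otimes>\<^sub>M N. iexp (z * fst p) * iexp ((c * z) * snd p))"
    unfolding char_def
    by (subst integral_distr) (auto simp: distrib_left exp_add algebra_simps)
  also have "\<dots> = char M z * char N (c * z)"
    unfolding char_def
    by (rule integral_pair_mult) (auto intro: M.prob_space_axioms N.prob_space_axioms)
  finally show ?thesis .
qed

lemma char_convolution:
  assumes "real_distribution M" "real_distribution N"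
  shows "char (convolution M N) z = char M z * char N z"
  using char_distr_lin[OF assms, of 1 z] by (simp add: convolution_def case_prod_beta')

lemma real_distribution_return: "real_distribution (return borel (x::real))"
  by (simp add: real_distribution_def real_distribution_axioms_def prob_space_return)

lemma conv_power_Suc: "conv_power \<tau> (Suc n) = convolution \<tau> (conv_power \<tau> n)"
  by (simp add: conv_power_def)

lemma conv_power_char:
  assumes "real_distribution \<tau>"
  shows "real_distribution (conv_power \<tau> n) \<and> (\<forall>z. char (conv_power \<tau> n) z = char \<tau> z ^ n)"
proof (induction n)
  case 0
  show ?case by (simp add: conv_power_def real_distribution_return char_def integral_return)
next
  case (Suc n)
  then show ?case using assms
    by (simp add: conv_power_Suc real_distribution_convolution char_convolution)
qed

text \<open>\<open>f\<close> plays the role of a chosen logarithm of a characteristic function.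
  Fixing the logarithm makes all n-th roots explicit, and such exponents can be added and conjugated
  without discussing branches.\<close>

definition idexp :: "(real \<Rightarrow> complex) \<Rightarrow> bool" where
  "idexp f \<longleftrightarrow> (\<forall>n>0. \<exists>\<tau>. real_distribution \<tau> \<and> (\<forall>z. char \<tau> z = exp (f z / of_nat n)))"

lemma idexp_ID:
  assumes f: "idexp f" and \<sigma>: "real_distribution \<sigma>" "\<And>z. char \<sigma> z = exp (f z)"
  shows "\<sigma> \<in> ID"
  unfolding ID_def
proof (safe intro!: \<sigma>)
  fix n :: nat assume n: "n > 0"
  from f n obtain \<tau> where \<tau>: "real_distribution \<tau>" "\<And>z. char \<tau> z = exp (f z / of_nat n)"
    unfolding idexp_def by blast
  have "\<sigma> = conv_power \<tau> n"
    using conv_power_char[OF \<tau>(1), of n] n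
    by (intro Levy_uniqueness \<sigma> ext) (auto simp: \<sigma> \<tau>(2) exp_of_nat_mult[symmetric])
  with \<tau> show "\<exists>\<tau>. real_distribution \<tau> \<and> \<sigma> = conv_power \<tau> n" by blast
qed

lemma idexp_add:
  assumes "idexp f" "idexp g" shows "idexp (\<lambda>z. f z + g z)"
  unfolding idexp_def
proof safe
  fix n :: nat assume n: "n > 0"
  obtain \<tau> \<rho> where "real_distribution \<tau>" "\<forall>z. char \<tau> z = exp (f z / of_nat n)"
    "real_distribution \<rho>" "\<forall>z. char \<rho> z = exp (g z / of_nat n)"
    using assms n unfolding idexp_def by metis
  then show "\<exists>\<tau>. real_distribution \<tau> \<and> (\<forall>z. char \<tau> z = exp ((f z + g z) / of_nat n))"
    by (intro exI[of _ "convolution \<tau> \<rho>"])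
      (simp add: real_distribution_convolution char_convolution add_divide_distrib exp_add)
qed

text \<open>Conjugation corresponds to the reflection x to -x; adding the conjugate exponent is
  symmetrization.\<close>

lemma idexp_cnj:
  assumes "idexp f" shows "idexp (\<lambda>z. cnj (f z))"
  unfolding idexp_def
proof safe
  fix n :: nat assume n: "n > 0"
  obtain \<tau> where \<tau>: "real_distribution \<tau>" "\<forall>z. char \<tau> z = exp (f z / of_nat n)"
    using assms n unfolding idexp_def by metis
  interpret T: real_distribution \<tau> by fact
  have "char (distr \<tau> borel uminus) z = exp (cnj (f z) / of_nat n)" for z
  proof -
    have "char (distr \<tau> borel uminus) z = (CLINT x|\<tau>. cnj (iexp (z * x)))"
      unfolding char_def by (subst integral_distr) (auto simp: exp_cnj)
    also have "\<dots> = cnj (char \<tau> z)" unfolding char_def by simp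
    finally show ?thesis using \<tau>(2) by (simp add: exp_cnj)
  qed
  moreover have "real_distribution (distr \<tau> borel uminus)"
    by (intro T.real_distribution_distr) measurable
  ultimately show "\<exists>\<tau>. real_distribution \<tau> \<and> (\<forall>z. char \<tau> z = exp (cnj (f z) / of_nat n))" by blast
qed

section \<open>Poisson variables and random series built from them\<close>

text \<open>Mean 0 is the point mass at 0, so that atoms of weight 0 and the time 0 need no separate
  case.\<close>

definition pois :: "real \<Rightarrow> nat pmf" where
  "pois l = (if l > 0 then poisson_pmf l else return_pmf 0)"

lemma pmf_pois: "l \<ge> 0 \<Longrightarrow> pmf (pois l) k = l ^ k / fact k * exp (- l)"
  by (auto simp: pois_def indicator_def power_0_left)

lemma nat_pmf_expectation:
  fixes p :: "nat pmf"
  assumes f: "(\<lambda>k. pmf p k *\<^sub>R f k) sums (s :: 'b :: {banach, second_countable_topology})"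
    and s: "summable (\<lambda>k. pmf p k * norm (f k))"
  shows "integrable (measure_pmf p) f" "(\<integral>k. f k \<partial>measure_pmf p) = s"
proof -
  have i: "integrable (count_space UNIV) (\<lambda>k. pmf p k *\<^sub>R f k)"
    using s by (simp add: integrable_count_space_nat_iff)
  show "integrable (measure_pmf p) f"
    unfolding measure_pmf_eq_density using i by (subst integrable_density) auto
  have "(\<integral>k. f k \<partial>measure_pmf p) = (\<integral>k. pmf p k *\<^sub>R f k \<partial>count_space UNIV)"
    unfolding measure_pmf_eq_density by (subst integral_density) auto
  also have "\<dots> = s" using integral_count_space_nat[OF i] sums_unique[OF f] by simp
  finally show "(\<integral>k. f k \<partial>measure_pmf p) = s" .
qed

text \<open>The probability generating function. It is used with real \<open>w\<close> for
  expectations of \<theta>^N and with complex \<open>w\<close> for characteristic functions.\<close>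

lemma pois_power:
  fixes w :: "'b :: {banach, second_countable_topology, real_normed_field}"
  assumes l: "l \<ge> 0"
  shows "(\<integral>k. w ^ k \<partial>measure_pmf (pois l)) = exp (of_real l * (w - 1))"
proof (rule nat_pmf_expectation(2))
  have "(\<lambda>k. (of_real l * w) ^ k /\<^sub>R fact k * exp (of_real (- l))) sums (exp (of_real l * w) * exp (of_real (- l)))"
    by (intro sums_mult2 exp_converges)
  also have "(\<lambda>k. (of_real l * w) ^ k /\<^sub>R fact k * exp (of_real (- l))) = (\<lambda>k. pmf (pois l) k *\<^sub>R w ^ k)"
    using l by (auto simp: pmf_pois scaleR_conv_of_real power_mult_distrib field_simps exp_of_real[symmetric])
  also have "exp (of_real l * w) * exp (of_real (- l)) = exp (of_real l * (w - 1))"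
    by (simp add: exp_add[symmetric] algebra_simps)
  finally show "(\<lambda>k. pmf (pois l) k *\<^sub>R w ^ k) sums exp (of_real l * (w - 1))" .
  have "summable (\<lambda>k. (l * norm w) ^ k /\<^sub>R fact k * exp (- l))"
    by (intro summable_mult2 summable_exp_generic)
  then show "summable (\<lambda>k. pmf (pois l) k * norm (w ^ k))"
    using l by (simp add: pmf_pois norm_power power_mult_distrib field_simps)
qed

lemma pois_char:
  assumes "l \<ge> 0"
  shows "(CLINT k|measure_pmf (pois l). iexp (z * real k)) = exp (of_real l * (iexp z - 1))"
proof -
  have "iexp (z * real k) = iexp z ^ k" for k
    by (simp add: exp_of_nat_mult[symmetric] algebra_simps)
  then show ?thesis using pois_power[OF assms, of "iexp z"] by simp
qed

lemma pois_mean: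
  assumes l: "l \<ge> 0"
  shows "integrable (measure_pmf (pois l)) real" "(\<integral>k. real k \<partial>measure_pmf (pois l)) = l"
proof -
  have *: "pmf (pois l) (Suc k) * real (Suc k) = l * exp (- l) * (l ^ k /\<^sub>R fact k)" for k
    using l by (simp add: pmf_pois divide_simps del: of_nat_Suc)
  have "(\<lambda>k. l * exp (- l) * (l ^ k /\<^sub>R fact k)) sums (l * exp (- l) * exp l)"
    by (intro sums_mult exp_converges)
  then have "(\<lambda>k. pmf (pois l) (Suc k) * real (Suc k)) sums l"
    unfolding * by (simp add: mult.assoc exp_add[symmetric])
  then have **: "(\<lambda>k. pmf (pois l) k * real k) sums l"
    by (subst (asm) sums_Suc_iff) simp
  show "integrable (measure_pmf (pois l)) real" "(\<integral>k. real k \<partial>measure_pmf (pois l)) = l"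
    using nat_pmf_expectation[of "pois l" real l] ** by (auto simp: sums_iff)
qed

text \<open>By Tonelli the sum has finite expectation, hence is finite almost surely.\<close>

lemma integrable_suminf_nonneg:
  fixes f :: "nat \<Rightarrow> 'a \<Rightarrow> real"
  assumes int: "\<And>i. integrable M (f i)" and nn: "\<And>i x. 0 \<le> f i x"
    and s: "summable (\<lambda>i. \<integral>x. f i x \<partial>M)"
  shows "AE x in M. summable (\<lambda>i. f i x)"
proof -
  have "(\<integral>\<^sup>+x. (\<Sum>i. ennreal (f i x)) \<partial>M) = (\<Sum>i. \<integral>\<^sup>+x. ennreal (f i x) \<partial>M)"
    using int by (intro nn_integral_suminf) auto
  also have "\<dots> = (\<Sum>i. ennreal (\<integral>x. f i x \<partial>M))"
    using int nn by (simp add: nn_integral_eq_integral)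
  also have "\<dots> \<noteq> \<infinity>"
    using s nn by (simp add: ennreal_suminf_neq_top)
  finally have "AE x in M. (\<Sum>i. ennreal (f i x)) \<noteq> \<infinity>"
    using int by (intro nn_integral_noteq_infinite) auto
  then show ?thesis
    by eventually_elim (auto intro: summable_suminf_not_top nn)
qed

text \<open>Since |exp (i y) - 1| \<le> |y|, finiteness of the first absolute moment of the atoms
  gives an absolutely convergent exponent without a compensating term.\<close>

lemma norm_exponent_le: "norm (of_real l * (iexp (z * x) - 1)) \<le> \<bar>z\<bar> * norm (l * x)"
proof -
  have "norm (iexp (z * x) - 1) \<le> \<bar>z * x\<bar>"
    using iexp_approx1[of "z * x" 0] by simp
  from mult_left_mono[OF this abs_ge_zero[of l]] show ?thesis
    by (simp only: norm_mult norm_of_real real_norm_def abs_mult ac_simps)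
qed

text \<open>The law is that of the sum of \<open>x i\<close> times independent Poisson variables of
  mean \<open>l i\<close>. The sum of the expected absolute values is finite, so the series
  converges absolutely almost surely and the finite products of characteristic functions pass to the
  limit.\<close>

lemma poisson_series:
  fixes x l :: "nat \<Rightarrow> real"
  assumes l: "\<And>i. l i \<ge> 0" and s: "summable (\<lambda>i. l i * \<bar>x i\<bar>)"
  shows "\<exists>\<tau>. real_distribution \<tau> \<and> (\<forall>z. char \<tau> z = exp (\<Sum>i. of_real (l i) * (iexp (z * x i) - 1)))"
proof -
  define P where "P = PiM UNIV (\<lambda>i. measure_pmf (pois (l i)))"
  interpret PP: product_prob_space "\<lambda>i. measure_pmf (pois (l i))" "UNIV :: nat set"
    by unfold_locales
  interpret P: prob_space P unfolding P_def by (rule PP.prob_space_axioms)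
  have comp': "distr P (measure_pmf (pois (l i))) (\<lambda>\<omega>. \<omega> i) = measure_pmf (pois (l i))" for i
    unfolding P_def by (rule distr_PiM_component) (auto simp: prob_space_measure_pmf)
  have comp: "distr P (count_space UNIV) (\<lambda>\<omega>. \<omega> i) = measure_pmf (pois (l i))" for i
  proof -
    have "distr P (count_space UNIV) (\<lambda>\<omega>. \<omega> i) = distr P (measure_pmf (pois (l i))) (\<lambda>\<omega>. \<omega> i)"
      by (rule distr_cong) auto
    then show ?thesis by (simp add: comp')
  qed
  have mc[measurable]: "(\<lambda>\<omega>. \<omega> i) \<in> measurable P (count_space UNIV)" for i
    unfolding P_def
    using measurable_component_singleton[of i UNIV "\<lambda>i. measure_pmf (pois (l i))"] by simp
  define X where "X i \<omega> = x i * real (\<omega> i)" for i and \<omega> :: "nat \<Rightarrow> nat"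
  have Xm[measurable]: "X i \<in> borel_measurable P" for i
    unfolding X_def by measurable
  \<comment> \<open>The coordinates of an infinite product space are independent because their joint
    law is the product measure itself.\<close>
  have iv: "P.indep_vars (\<lambda>_. borel) X I" for I
  proof -
    have "P.indep_vars (\<lambda>i. measure_pmf (pois (l i))) (\<lambda>i \<omega>. \<omega> i) UNIV"
    proof (subst P.indep_vars_iff_distr_eq_PiM')
      show "P.random_variable (measure_pmf (pois (l i))) (\<lambda>\<omega>. \<omega> i)" for i
        using mc by simp
      have "(\<Pi>\<^sub>M i\<in>UNIV. distr P (measure_pmf (pois (l i))) (\<lambda>\<omega>. \<omega> i)) = P"
        unfolding comp' by (simp add: P_def)
      then show "distr P (\<Pi>\<^sub>M i\<in>UNIV. measure_pmf (pois (l i))) (\<lambda>x. \<lambda>i\<in>UNIV. x i) =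
        (\<Pi>\<^sub>M i\<in>UNIV. distr P (measure_pmf (pois (l i))) (\<lambda>\<omega>. \<omega> i))"
        unfolding restrict_UNIV P_def[symmetric] by (simp only: distr_id)
    qed simp
    from P.indep_vars_compose2[OF this, of "\<lambda>i k. x i * real k" "\<lambda>_. borel"]
    have "P.indep_vars (\<lambda>_. borel) X UNIV" unfolding X_def by simp
    then show ?thesis by (rule P.indep_vars_subset) auto
  qed
  have chX: "char (distr P borel (X i)) z = exp (of_real (l i) * (iexp (z * x i) - 1))" for i z
  proof -
    have "char (distr P borel (X i)) z = (CLINT \<omega>|P. iexp ((z * x i) * real (\<omega> i)))"
      unfolding char_def by (subst integral_distr) (auto simp: X_def ac_simps)
    also have "\<dots> = (CLINT k|distr P (count_space UNIV) (\<lambda>\<omega>. \<omega> i). iexp ((z * x i) * real k))"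
      by (subst integral_distr) auto
    also have "\<dots> = exp (of_real (l i) * (iexp (z * x i) - 1))"
      unfolding comp by (rule pois_char[OF l])
    finally show ?thesis .
  qed
  have meanX: "integrable P (\<lambda>\<omega>. \<bar>X i \<omega>\<bar>)" "(\<integral>\<omega>. \<bar>X i \<omega>\<bar> \<partial>P) = l i * \<bar>x i\<bar>" for i
  proof -
    have "integrable (distr P (count_space UNIV) (\<lambda>\<omega>. \<omega> i)) (\<lambda>k. \<bar>x i\<bar> * real k)"
      unfolding comp by (intro integrable_mult_right pois_mean l)
    then show "integrable P (\<lambda>\<omega>. \<bar>X i \<omega>\<bar>)"
      by (subst (asm) integrable_distr_eq) (auto simp: X_def abs_mult)
    have "(\<integral>\<omega>. \<bar>X i \<omega>\<bar> \<partial>P) = (\<integral>k. \<bar>x i\<bar> * real k \<partial>distr P (count_space UNIV) (\<lambda>\<omega>. \<omega> i))"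
      by (subst integral_distr) (auto simp: X_def abs_mult)
    also have "\<dots> = l i * \<bar>x i\<bar>" unfolding comp using pois_mean[OF l] by simp
    finally show "(\<integral>\<omega>. \<bar>X i \<omega>\<bar> \<partial>P) = l i * \<bar>x i\<bar>" .
  qed
  have AEs: "AE \<omega> in P. summable (\<lambda>i. \<bar>X i \<omega>\<bar>)"
    by (rule integrable_suminf_nonneg) (auto simp: meanX s)
  define S where "S \<omega> = (\<Sum>i. X i \<omega>)" for \<omega>
  have Sm[measurable]: "S \<in> borel_measurable P"
    unfolding S_def by measurable
  have "char (distr P borel S) z = exp (\<Sum>i. of_real (l i) * (iexp (z * x i) - 1))" for z
  proof -
    have "(\<lambda>n. CLINT \<omega>|P. iexp (z * (\<Sum>i<n. X i \<omega>))) \<longlonglongrightarrow> (CLINT \<omega>|P. iexp (z * S \<omega>))"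
    proof (rule integral_dominated_convergence[where w = "\<lambda>_. 1"])
      show "AE \<omega> in P. (\<lambda>n. iexp (z * (\<Sum>i<n. X i \<omega>))) \<longlonglongrightarrow> iexp (z * S \<omega>)"
        using AEs
      proof eventually_elim
        case (elim \<omega>)
        then have "(\<lambda>n. \<Sum>i<n. X i \<omega>) \<longlonglongrightarrow> S \<omega>"
          unfolding S_def by (rule summable_LIMSEQ[OF summable_rabs_cancel])
        then show ?case by (intro tendsto_intros)
      qed
    qed auto
    moreover have "(CLINT \<omega>|P. iexp (z * (\<Sum>i<n. X i \<omega>))) = exp (\<Sum>i<n. of_real (l i) * (iexp (z * x i) - 1))" for n
    proof -
      have "char (distr P borel (\<lambda>\<omega>. \<Sum>i<n. X i \<omega>)) z = (CLINT \<omega>|P. iexp (z * (\<Sum>i<n. X i \<omega>)))"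
        unfolding char_def by (rule integral_distr) measurable
      then have "(CLINT \<omega>|P. iexp (z * (\<Sum>i<n. X i \<omega>))) = char (distr P borel (\<lambda>\<omega>. \<Sum>i<n. X i \<omega>)) z"
        by (rule sym)
      also have "\<dots> = (\<Prod>i<n. char (distr P borel (X i)) z)"
        by (rule P.char_distr_sum[OF iv])
      finally show ?thesis unfolding chX by (simp only: exp_sum finite_lessThan)
    qed
    moreover have "(\<lambda>n. exp (\<Sum>i<n. of_real (l i) * (iexp (z * x i) - 1))) \<longlonglongrightarrow>
      exp (\<Sum>i. of_real (l i) * (iexp (z * x i) - 1))"
    proof (intro tendsto_exp summable_LIMSEQ)
      have "norm (of_real (l i) * (iexp (z * x i) - 1)) \<le> \<bar>z\<bar> * (l i * \<bar>x i\<bar>)" for i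
        using norm_exponent_le[of "l i" z "x i"] l[of i] by (simp add: abs_mult)
      then show "summable (\<lambda>i. of_real (l i) * (iexp (z * x i) - 1))"
        by (intro summable_comparison_test'[OF summable_mult[OF s]])
    qed
    ultimately have "(CLINT \<omega>|P. iexp (z * S \<omega>)) = exp (\<Sum>i. of_real (l i) * (iexp (z * x i) - 1))"
      by (simp add: LIMSEQ_unique)
    then show ?thesis unfolding char_def by (subst integral_distr) auto
  qed
  moreover have "real_distribution (distr P borel S)"
    by (rule P.real_distribution_distr) simp
  ultimately show ?thesis by blast
qed

text \<open>The uncompensated Levy-Khintchine exponent of atoms of mass \<open>l i\<close> at
  \<open>x i\<close>; the masses may be signed. Writing the sum as an integral over a counting
  measure makes rearrangement, reindexing and Fubini available.\<close>

definition exponent :: "('i \<Rightarrow> real) \<Rightarrow> ('i \<Rightarrow> real) \<Rightarrow> real \<Rightarrow> complex" where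
  "exponent l x z = (\<integral>i. of_real (l i) * (iexp (z * x i) - 1) \<partial>count_space UNIV)"

lemma integrable_exponent:
  assumes "integrable (count_space UNIV) (\<lambda>i. l i * x i)"
  shows "integrable (count_space UNIV) (\<lambda>i. of_real (l i) * (iexp (z * x i) - 1))"
  by (rule Bochner_Integration.integrable_bound[OF integrable_mult_right[OF integrable_norm[OF assms], of "\<bar>z\<bar>"]])
    (use norm_exponent_le in \<open>auto simp: abs_mult\<close>)

text \<open>The n-th root is the Poisson series with all masses divided by n;
  \<open>prod_decode\<close> enumerates the double family.\<close>

lemma idexp_exponent:
  fixes l x :: "nat \<times> nat \<Rightarrow> real"
  assumes l: "\<And>i. l i \<ge> 0" and s: "integrable (count_space UNIV) (\<lambda>i. l i * x i)"
  shows "idexp (exponent l x)"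
  unfolding idexp_def
proof safe
  fix n :: nat assume n: "n > 0"
  have bij: "bij_betw prod_decode UNIV UNIV" by (rule bij_prod_decode)
  have tr: "integrable (count_space UNIV) (\<lambda>k. f (prod_decode k)) \<longleftrightarrow> integrable (count_space UNIV) f"
    "(\<integral>k. f (prod_decode k) \<partial>count_space UNIV) = (\<integral>i. f i \<partial>count_space UNIV)"
    for f :: "nat \<times> nat \<Rightarrow> 'b :: {banach, second_countable_topology}"
    using integrable_bij_count_space[OF bij, of f] integral_bij_count_space[OF bij, of f] by auto
  have "summable (\<lambda>k. norm (l (prod_decode k) * x (prod_decode k)))"
    using s tr(1)[of "\<lambda>i. l i * x i"] by (simp only: integrable_count_space_nat_iff)
  then have "summable (\<lambda>k. l (prod_decode k) / n * \<bar>x (prod_decode k)\<bar>)"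
    using summable_mult2[of _ "1 / n"] l by (fastforce simp: abs_mult)
  from poisson_series[OF _ this] l obtain \<tau> where \<tau>: "real_distribution \<tau>"
    "\<And>z. char \<tau> z = exp (\<Sum>k. of_real (l (prod_decode k) / n) * (iexp (z * x (prod_decode k)) - 1))"
    by (auto simp: divide_nonneg_nonneg)
  have "(\<Sum>k. of_real (l (prod_decode k) / n) * (iexp (z * x (prod_decode k)) - 1)) = exponent l x z / of_nat n" for z
  proof -
    let ?f = "\<lambda>i. of_real (l i) * (iexp (z * x i) - 1) / of_nat n"
    have "integrable (count_space UNIV) (\<lambda>k. ?f (prod_decode k))"
      unfolding tr(1)[of ?f] by (intro integrable_divide impI integrable_exponent s)
    from integral_count_space_nat[OF this] have "(\<Sum>k. ?f (prod_decode k)) = (\<integral>i. ?f i \<partial>count_space UNIV)"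
      unfolding tr(2)[of ?f] by simp
    then show ?thesis by (simp add: exponent_def)
  qed
  with \<tau> show "\<exists>\<tau>. real_distribution \<tau> \<and> (\<forall>z. char \<tau> z = exp (exponent l x z / of_nat n))"
    by auto
qed

section \<open>Discrete quasi-Levy measures and the fixed point equation\<close>

text \<open>Masses of indices sharing a location add up. Indices located at 0 are dropped, as a Levy
  measure must not charge 0; for \<theta> = 0 almost all indices are of this kind.\<close>

definition atomic :: "('i \<Rightarrow> real) \<Rightarrow> ('i \<Rightarrow> real) \<Rightarrow> real measure" where
  "atomic l x = distr (density (count_space UNIV) (\<lambda>i. ennreal (if x i = 0 then 0 else l i))) borel x"

lemma sets_atomic [simp, measurable_cong]: "sets (atomic l x) = sets borel"
  by (simp add: atomic_def)

lemma emeasure_atomic_eq_0: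
  assumes [measurable]: "A \<in> sets borel" and "\<And>i. x i \<in> A \<Longrightarrow> x i = 0 \<or> l i = 0"
  shows "emeasure (atomic l x) A = 0"
proof -
  have "ennreal (if x i = 0 then 0 else l i) * indicator (x -` A) i = 0" for i
    using assms(2)[of i] by (auto simp: indicator_def)
  then have "(\<integral>\<^sup>+i. ennreal (if x i = 0 then 0 else l i) * indicator (x -` A) i \<partial>count_space UNIV) = 0"
    by (simp only: nn_integral_const mult_zero_left)
  then show ?thesis
    unfolding atomic_def by (subst emeasure_distr) (auto simp: emeasure_density)
qed

text \<open>The condition \<open>f 0 = 0\<close> makes the dropped atoms at 0 invisible to the
  sum.\<close>

lemma
  fixes f :: "real \<Rightarrow> 'b :: {banach, second_countable_topology}"
  assumes l: "\<And>i. l i \<ge> 0" and [measurable]: "f \<in> borel_measurable borel" and "f 0 = 0"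
  shows integral_atomic: "(\<integral>y. f y \<partial>atomic l x) = (\<integral>i. l i *\<^sub>R f (x i) \<partial>count_space UNIV)"
    and integrable_atomic: "integrable (atomic l x) f \<longleftrightarrow> integrable (count_space UNIV) (\<lambda>i. l i *\<^sub>R f (x i))"
proof -
  have *: "(if x i = 0 then 0 else l i) *\<^sub>R f (x i) = l i *\<^sub>R f (x i)" for i
    using assms(3) by simp
  have "(\<integral>y. f y \<partial>atomic l x) = (\<integral>i. (if x i = 0 then 0 else l i) *\<^sub>R f (x i) \<partial>count_space UNIV)"
    unfolding atomic_def using l by (subst integral_distr) (auto simp: integral_density)
  then show "(\<integral>y. f y \<partial>atomic l x) = (\<integral>i. l i *\<^sub>R f (x i) \<partial>count_space UNIV)"
    unfolding * .
  have "integrable (atomic l x) f \<longleftrightarrow> integrable (count_space UNIV) (\<lambda>i. (if x i = 0 then 0 else l i) *\<^sub>R f (x i))"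
    unfolding atomic_def using l by (subst integrable_distr_eq) (auto simp: integrable_density)
  then show "integrable (atomic l x) f \<longleftrightarrow> integrable (count_space UNIV) (\<lambda>i. l i *\<^sub>R f (x i))"
    unfolding * .
qed

lemma levy_integrable_atomic:
  assumes l: "\<And>i. l i \<ge> 0" and s: "integrable (count_space UNIV) (\<lambda>i. l i * x i)"
  shows "levy_integrable (atomic l x)"
  unfolding levy_integrable_def
proof (intro conjI)
  show "emeasure (atomic l x) {0} = 0" by (rule emeasure_atomic_eq_0) auto
  have "integrable (count_space UNIV) (\<lambda>i. l i *\<^sub>R min ((x i)\<^sup>2) 1)"
  proof (rule Bochner_Integration.integrable_bound[OF s])
    have "min (y\<^sup>2) 1 \<le> \<bar>y\<bar>" for y :: real
    proof (cases "\<bar>y\<bar> \<le> 1")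
      case True
      then have "\<bar>y\<bar> * \<bar>y\<bar> \<le> \<bar>y\<bar>" by (intro mult_left_le) auto
      then show ?thesis by (simp add: power2_eq_square)
    qed simp
    then show "AE i in count_space UNIV. norm (l i *\<^sub>R min ((x i)\<^sup>2) 1) \<le> norm (l i * x i)"
      using l by (auto simp: abs_mult intro!: mult_left_mono)
  qed auto
  then show "integrable (atomic l x) (\<lambda>x. min (x\<^sup>2) 1)"
    using l by (subst integrable_atomic) auto
qed simp

text \<open>With a finite first moment the compensator can be integrated separately, and it is
  linear in \<open>z\<close>; it therefore only shifts the drift.\<close>

lemma integral_levy_kernel_atomic:
  assumes l: "\<And>i. l i \<ge> 0" and s: "integrable (count_space UNIV) (\<lambda>i. l i * x i)"
  shows "(CLINT y|atomic l x. levy_kernel z y) = exponent l x z -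
    \<i> * of_real (z * (\<integral>i. l i * x i * indicator {-1..1} (x i) \<partial>count_space UNIV))"
proof -
  have i1: "integrable (count_space UNIV) (\<lambda>i. l i * x i * indicator {-1..1} (x i))"
    by (rule Bochner_Integration.integrable_bound[OF s]) (auto simp: indicator_def)
  have "(CLINT y|atomic l x. levy_kernel z y) = (CLINT i|count_space UNIV. l i *\<^sub>R levy_kernel z (x i))"
    by (rule integral_atomic[OF l]) (auto simp: levy_kernel_def)
  also have "\<dots> = (CLINT i|count_space UNIV. of_real (l i) * (iexp (z * x i) - 1) -
     \<i> * of_real z * of_real (l i * x i * indicator {-1..1} (x i)))"
    by (rule Bochner_Integration.integral_cong) (auto simp: levy_kernel_def scaleR_conv_of_real algebra_simps)
  also have "\<dots> = exponent l x z - \<i> * of_real z * (CLINT i|count_space UNIV. of_real (l i * x i * indicator {-1..1} (x i)))"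
    unfolding exponent_def
    by (subst Bochner_Integration.integral_diff[OF integrable_exponent[OF s]])
      (intro integrable_mult_right integrable_of_real i1, subst integral_mult_right_zero, simp)
  finally show ?thesis unfolding integral_complex_of_real by (simp only: of_real_mult mult.assoc)
qed

text \<open>The primed family is the negative part. The countable set \<open>B\<close> of its
  locations separates the two parts, because \<open>sing\<close> keeps every nonzero positive atom
  away from it; the compensators of both parts are absorbed into the drift \<open>g\<close>.\<close>

lemma quasi_ID_atomic:
  fixes l x :: "'i :: countable \<Rightarrow> real" and l' x' :: "'j :: countable \<Rightarrow> real"
  assumes "real_distribution \<sigma>"
    and l: "\<And>i. l i \<ge> 0" "integrable (count_space UNIV) (\<lambda>i. l i * x i)"
    and l': "\<And>i. l' i \<ge> 0" "integrable (count_space UNIV) (\<lambda>i. l' i * x' i)"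
    and sing: "\<And>i j. l i \<noteq> 0 \<Longrightarrow> l' j \<noteq> 0 \<Longrightarrow> x i \<noteq> 0 \<Longrightarrow> x i \<noteq> x' j"
    and ch: "\<And>z. char \<sigma> z = exp (\<i> * of_real (b * z) + (exponent l x z - exponent l' x' z))"
  shows "\<sigma> \<in> quasi_ID"
proof -
  let ?I = "\<lambda>l x. \<integral>i. l i * x i * indicator {-1..1} (x i) \<partial>count_space UNIV"
  define B where "B = x' ` {j. l' j \<noteq> 0}"
  define g where "g = b + ?I l x - ?I l' x'"
  have B: "B \<in> sets borel" unfolding B_def
    by (rule sets.countable) auto
  have "emeasure (atomic l x) (- (- B)) = 0"
    using B sing by (intro emeasure_atomic_eq_0) (auto simp: B_def)
  moreover have "emeasure (atomic l' x') (- B) = 0"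
    using B by (intro emeasure_atomic_eq_0) (auto simp: B_def)
  moreover have "char \<sigma> z = exp (\<i> * complex_of_real (g * z) - complex_of_real (0 * z\<^sup>2) +
           ((CLINT x|atomic l x. levy_kernel z x) - (CLINT x|atomic l' x'. levy_kernel z x)))" for z
    unfolding ch integral_levy_kernel_atomic[OF l] integral_levy_kernel_atomic[OF l'] g_def
    by (simp add: algebra_simps)
  ultimately show ?thesis
    unfolding quasi_ID_def
    using assms(1) levy_integrable_atomic[OF l] levy_integrable_atomic[OF l'] B
    by (intro CollectI conjI exI[of _ g] exI[of _ 0] exI[of _ "atomic l x"] exI[of _ "atomic l' x'"]
        bexI[of _ "- B"]) auto
qed

section \<open>Sums as integrals over counting measures: Fubini, reindexing, disjoint unions\<close>

lemma countable_pair_integral: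
  fixes f :: "'i :: countable \<times> 'j :: countable \<Rightarrow> 'b :: {banach, second_countable_topology}"
  assumes "integrable (count_space UNIV) f"
  shows "integrable (count_space UNIV) (\<lambda>n. \<integral>m. f (n, m) \<partial>count_space UNIV)"
    "(\<integral>n. \<integral>m. f (n, m) \<partial>count_space UNIV \<partial>count_space UNIV) = (\<integral>i. f i \<partial>count_space UNIV)"
proof -
  have eq: "count_space UNIV \<Otimes>\<^sub>M count_space UNIV = (count_space UNIV :: ('i \<times> 'j) measure)"
    by (subst pair_measure_countable) auto
  interpret pair_sigma_finite "count_space UNIV :: 'i measure" "count_space UNIV :: 'j measure"
    by (intro pair_sigma_finite.intro sigma_finite_measure_count_space)
  show "integrable (count_space UNIV) (\<lambda>n. \<integral>m. f (n, m) \<partial>count_space UNIV)"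
    "(\<integral>n. \<integral>m. f (n, m) \<partial>count_space UNIV \<partial>count_space UNIV) = (\<integral>i. f i \<partial>count_space UNIV)"
    using integrable_fst'[of f] integral_fst'[of f] assms unfolding eq by auto
qed

lemma integrable_count_space_mult:
  fixes f g :: "nat \<Rightarrow> real"
  assumes "summable f" "summable g" "\<And>n. f n \<ge> 0" "\<And>n. g n \<ge> 0"
  shows "integrable (count_space UNIV) (\<lambda>(n, m). f n * g m)"
proof (rule integrableI_bounded)
  have "(\<integral>\<^sup>+i. ennreal (norm (case i of (n, m) \<Rightarrow> f n * g m)) \<partial>count_space UNIV) =
    (\<integral>\<^sup>+n. \<integral>\<^sup>+m. ennreal (f n) * ennreal (g m) \<partial>count_space UNIV \<partial>count_space UNIV)"
    using assms(3,4) by (subst nn_integral_fst_count_space[symmetric]) (simp add: ennreal_mult)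
  also have "\<dots> = (\<Sum>n. ennreal (f n)) * (\<Sum>n. ennreal (g n))"
    by (simp add: nn_integral_cmult nn_integral_multc nn_integral_count_space_nat)
  also have "\<dots> < \<infinity>"
    using assms by (simp add: suminf_ennreal2 ennreal_mult[symmetric] suminf_nonneg)
  finally show "(\<integral>\<^sup>+i. ennreal (norm (case i of (n, m) \<Rightarrow> f n * g m)) \<partial>count_space UNIV) < \<infinity>" .
qed simp

lemma integral_count_space_subset:
  fixes f :: "'i \<Rightarrow> 'b :: {banach, second_countable_topology}"
  shows "(\<integral>i. f i \<partial>count_space A) = (\<integral>i. indicator A i *\<^sub>R f i \<partial>count_space UNIV)"
    "integrable (count_space A) f \<longleftrightarrow> integrable (count_space UNIV) (\<lambda>i. indicator A i *\<^sub>R f i)"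
  using integral_restrict_space[of A "count_space UNIV" f] integrable_restrict_space[of A "count_space UNIV" f]
  by (simp_all add: restrict_count_space)

lemma integral_count_space_inj:
  fixes f :: "'i \<Rightarrow> 'b :: {banach, second_countable_topology}"
  assumes "inj_on h A" and z: "\<And>j. j \<notin> h ` A \<Longrightarrow> f j = 0"
  shows "(\<integral>i. indicator A i *\<^sub>R f (h i) \<partial>count_space UNIV) = (\<integral>j. f j \<partial>count_space UNIV)"
    "integrable (count_space UNIV) (\<lambda>i. indicator A i *\<^sub>R f (h i)) \<longleftrightarrow> integrable (count_space UNIV) f"
proof -
  have "bij_betw h A (h ` A)" using assms(1) by (rule inj_on_imp_bij_betw)
  note * = integral_bij_count_space[OF this, of f] integrable_bij_count_space[OF this, of f]
  have e: "indicator (h ` A) j *\<^sub>R f j = f j" for j using z[of j] by (auto simp: indicator_def)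
  show "(\<integral>i. indicator A i *\<^sub>R f (h i) \<partial>count_space UNIV) = (\<integral>j. f j \<partial>count_space UNIV)"
    "integrable (count_space UNIV) (\<lambda>i. indicator A i *\<^sub>R f (h i)) \<longleftrightarrow> integrable (count_space UNIV) f"
    using * unfolding integral_count_space_subset[where A = A] integral_count_space_subset[where A = "h ` A"] e
    by auto
qed

text \<open>The tag \<open>True\<close> or \<open>False\<close> forms the disjoint union of two
  families of atoms, so that a positive part made of two families is again one family.\<close>

lemma integral_count_space_bool_times:
  fixes f :: "bool \<times> 'j :: countable \<Rightarrow> 'b :: {banach, second_countable_topology}"
  assumes t: "integrable (count_space UNIV) (\<lambda>j. f (True, j))" and f: "integrable (count_space UNIV) (\<lambda>j. f (False, j))"
  shows "integrable (count_space UNIV) f"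
    "(\<integral>i. f i \<partial>count_space UNIV) = (\<integral>j. f (True, j) \<partial>count_space UNIV) + (\<integral>j. f (False, j) \<partial>count_space UNIV)"
proof -
  have *: "inj_on (Pair b) (UNIV :: 'j set)" for b :: bool by (auto simp: inj_on_def)
  define g where "g b i = indicator {i. fst i = b} i *\<^sub>R f i" for b and i :: "bool \<times> 'j"
  have g: "integrable (count_space UNIV) (g b)" "(\<integral>i. g b i \<partial>count_space UNIV) = (\<integral>j. f (b, j) \<partial>count_space UNIV)" for b
    using integral_count_space_inj[OF *, of b "g b"] t f
    by (cases b; force simp: g_def image_iff)+
  have "f = (\<lambda>i. g True i + g False i)" by (auto simp: g_def indicator_def)
  then show "integrable (count_space UNIV) f"
    "(\<integral>i. f i \<partial>count_space UNIV) = (\<integral>j. f (True, j) \<partial>count_space UNIV) + (\<integral>j. f (False, j) \<partial>count_space UNIV)"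
    using g by (metis Bochner_Integration.integrable_add, metis Bochner_Integration.integral_add)
qed

lemma exponent_bool_times:
  fixes l x :: "bool \<times> 'j :: countable \<Rightarrow> real"
  assumes "integrable (count_space UNIV) (\<lambda>j. l (True, j) * x (True, j))"
    and "integrable (count_space UNIV) (\<lambda>j. l (False, j) * x (False, j))"
  shows "exponent l x z = exponent (\<lambda>j. l (True, j)) (\<lambda>j. x (True, j)) z +
    exponent (\<lambda>j. l (False, j)) (\<lambda>j. x (False, j)) z"
  unfolding exponent_def
  by (rule integral_count_space_bool_times(2)) (intro integrable_exponent assms)+

lemma exponent_diff:
  assumes "integrable (count_space UNIV) (\<lambda>j. l j * x j)" "integrable (count_space UNIV) (\<lambda>j. l' j * x j)"
  shows "exponent (\<lambda>j. l j - l' j) x z = exponent l x z - exponent l' x z"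
  using Bochner_Integration.integral_diff[OF integrable_exponent[OF assms(1), of z] integrable_exponent[OF assms(2), of z]]
  by (simp add: exponent_def algebra_simps)

lemma exponent_scale: "exponent l (\<lambda>j. c * x j) z = exponent l x (c * z)"
  by (simp add: exponent_def ac_simps)

lemma cnj_exponent: "cnj (exponent l x z) = exponent l x (- z)"
proof -
  have "cnj (exponent l x z) = (CLINT i|count_space UNIV. cnj (of_real (l i) * (iexp (z * x i) - 1)))"
    unfolding exponent_def by (simp del: complex_cnj_mult complex_cnj_diff)
  then show ?thesis by (simp add: exp_cnj exponent_def)
qed

section \<open>The logarithm of R and the iterated fixed point equation\<close>

text \<open>The expansion of log ((1 - t) / (1 - t exp (i y))). It is applied with
  \<open>t = q\<close> to the denominator of R and with \<open>t = - s\<close> to the numerator. The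
  term for \<open>m = 0\<close> is 0 by division by zero.\<close>

lemma exp_log_series:
  fixes t y :: real
  assumes t: "\<bar>t\<bar> < 1"
  shows "(\<lambda>m. of_real (t ^ m / real m) * (iexp (y * real m) - 1)) sums (Ln (1 - of_real t) - Ln (1 - of_real t * iexp y))"
proof -
  have *: "(\<lambda>m. a ^ m / of_nat m) sums (- Ln (1 - a))" if "cmod a < 1" for a
    using sums_minus[OF Ln_series'[of "- a"]] that by simp
  have "(\<lambda>m. (of_real t * iexp y) ^ m / of_nat m - of_real t ^ m / of_nat m) sums
     (- Ln (1 - of_real t * iexp y) - - Ln (1 - of_real t))"
    by (intro sums_diff *) (use t in \<open>auto simp: norm_mult\<close>)
  also have "(\<lambda>m. (of_real t * iexp y) ^ m / of_nat m - of_real t ^ m / of_nat m) =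
    (\<lambda>m. of_real (t ^ m / real m) * (iexp (y * real m) - 1))"
  proof
    fix m
    have "iexp y ^ m = iexp (y * real m)"
      by (simp add: exp_of_nat_mult[symmetric] algebra_simps)
    then show "(of_real t * iexp y) ^ m / of_nat m - of_real t ^ m / of_nat m =
      of_real (t ^ m / real m) * (iexp (y * real m) - 1)"
      by (simp add: power_mult_distrib algebra_simps diff_divide_distrib)
  qed
  finally show ?thesis by simp
qed

lemma exponent_uminus_scale: "exponent l (\<lambda>j. - (c * x j)) z = exponent l x (- (c * z))"
  by (simp add: exponent_def ac_simps)

lemma one_minus_iexp_nonzero:
  assumes "\<bar>t\<bar> < 1" shows "1 - of_real t * iexp y \<noteq> 0"
proof
  assume "1 - of_real t * iexp y = 0"
  then have "of_real t * iexp y = 1" by simp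
  then have "norm (of_real t * iexp y) = 1" by simp
  then show False using assms by (simp add: norm_mult)
qed

text \<open>The weight of \<open>(n, 0)\<close> is \<open>t ^ 0 / 0 = 0\<close>, so that the second index effectively starts at 1.\<close>

definition wt :: "real \<Rightarrow> nat \<times> nat \<Rightarrow> real" where
  "wt t i = t ^ snd i / real (snd i)"

definition loc :: "real \<Rightarrow> nat \<times> nat \<Rightarrow> real" where
  "loc \<theta> i = \<theta> ^ fst i * real (snd i)"

context
  fixes \<theta> :: real assumes th: "0 \<le> \<theta>" "\<theta> < 1"
begin

text \<open>The factor m of the location cancels the 1 / m of the weight, which leaves a product of
  two geometric series.\<close>

lemma integrable_wt:
  assumes "\<bar>t\<bar> < 1"
  shows "integrable (count_space UNIV) (\<lambda>i. wt t i * loc \<theta> i)"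
proof (rule Bochner_Integration.integrable_bound)
  show "integrable (count_space UNIV) (\<lambda>(n, m). \<theta> ^ n * \<bar>t\<bar> ^ m)"
    by (rule integrable_count_space_mult) (use assms th in \<open>auto intro!: summable_geometric\<close>)
  show "AE i in count_space UNIV. norm (wt t i * loc \<theta> i) \<le> norm (case i of (n, m) \<Rightarrow> \<theta> ^ n * \<bar>t\<bar> ^ m)"
    using th by (auto simp: wt_def loc_def abs_mult power_abs)
qed simp

text \<open>For fixed n the sum over m is a difference of logarithms, whose exponential is the n-th
  factor. Since only exponentials of sums occur, the branch of the logarithm does not affect the
  infinite product.\<close>

lemma exponent_wt_tendsto:
  assumes t: "\<bar>t\<bar> < 1"
  shows "(\<lambda>N. \<Prod>n<N. (1 - of_real t) / (1 - of_real t * iexp (\<theta> ^ n * z))) \<longlonglongrightarrow> exp (exponent (wt t) (loc \<theta>) z)"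
proof -
  let ?f = "\<lambda>i. of_real (wt t i) * (iexp (z * loc \<theta> i) - 1)"
  have int: "integrable (count_space UNIV) ?f"
    by (rule integrable_exponent[OF integrable_wt[OF t]])
  have inner: "exp (\<integral>m. ?f (n, m) \<partial>count_space UNIV) = (1 - of_real t) / (1 - of_real t * iexp (\<theta> ^ n * z))" for n
  proof -
    have "summable (\<lambda>m. norm (?f (n, m)))"
    proof (rule summable_comparison_test')
      show "summable (\<lambda>m. \<bar>z\<bar> * \<bar>t\<bar> ^ m)" using t by (intro summable_mult summable_geometric) auto
      fix m
      have "\<theta> ^ n \<le> 1" using th by (intro power_le_one) auto
      then have "norm (wt t (n, m) * loc \<theta> (n, m)) \<le> \<bar>t\<bar> ^ m"
        using th by (auto simp: wt_def loc_def abs_mult power_abs mult_left_le)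
      with norm_exponent_le[of "wt t (n, m)" z "loc \<theta> (n, m)"]
      show "norm (norm (?f (n, m))) \<le> \<bar>z\<bar> * \<bar>t\<bar> ^ m"
        by (simp only: real_norm_def abs_norm_cancel) (erule order_trans, rule mult_left_mono, auto)
    qed
    then have "integrable (count_space UNIV) (\<lambda>m. ?f (n, m))"
      by (simp only: integrable_count_space_nat_iff)
    from sums_integral_count_space_nat[OF this]
    have "(\<lambda>m. ?f (n, m)) sums (\<integral>m. ?f (n, m) \<partial>count_space UNIV)" .
    moreover have "(\<lambda>m. ?f (n, m)) sums (Ln (1 - of_real t) - Ln (1 - of_real t * iexp (\<theta> ^ n * z)))"
      using exp_log_series[OF t, of "\<theta> ^ n * z"] by (simp add: wt_def loc_def ac_simps)
    ultimately have "(\<integral>m. ?f (n, m) \<partial>count_space UNIV) = Ln (1 - of_real t) - Ln (1 - of_real t * iexp (\<theta> ^ n * z))"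
      by (rule sums_unique2)
    moreover have "exp (Ln (1 - of_real t)) = (1 - of_real t :: complex)"
      using one_minus_iexp_nonzero[OF t, of 0] by (intro exp_Ln) auto
    moreover have "exp (Ln (1 - of_real t * iexp (\<theta> ^ n * z))) = 1 - of_real t * iexp (\<theta> ^ n * z)"
      using one_minus_iexp_nonzero[OF t, of "\<theta> ^ n * z"] by (intro exp_Ln) auto
    ultimately show ?thesis by (simp only: exp_diff)
  qed
  have "(\<lambda>N. \<Sum>n<N. \<integral>m. ?f (n, m) \<partial>count_space UNIV) \<longlonglongrightarrow> exponent (wt t) (loc \<theta>) z"
    using sums_integral_count_space_nat[OF countable_pair_integral(1)[OF int]] countable_pair_integral(2)[OF int]
    by (simp add: sums_def exponent_def)
  from tendsto_exp[OF this] show ?thesis by (simp only: exp_sum[OF finite_lessThan] inner)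
qed

context
  fixes q s \<alpha> :: real and \<phi> :: "real \<Rightarrow> complex"
  assumes q: "0 < q" "q < 1" and s: "0 < s" "s < 1"
    and \<phi>0: "\<phi> 0 = 1" "isCont \<phi> 0"
    and fixeq: "\<And>z. \<phi> z = iexp (\<alpha> * z) * ((1 - of_real q) / (1 - of_real q * iexp z)) *
       ((1 + of_real s * iexp (- \<alpha> * z)) / (1 + of_real s)) * \<phi> (\<theta> * z)"
begin

text \<open>Iterating \<open>fixeq\<close> produces N factors and \<phi> (\<theta>^N z), which tends
  to \<phi> 0 = 1. The prefactors exp (i \<alpha> \<theta>^n z) add up to the drift \<alpha> / (1 -
  \<theta>).\<close>

lemma fixpoint_exponent:
  "\<phi> z = exp (\<i> * of_real (\<alpha> / (1 - \<theta>) * z) + (exponent (wt q) (loc \<theta>) z - exponent (wt (- s)) (\<lambda>i. - \<alpha> * loc \<theta> i) z))"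
proof -
  define A where "A n = (1 - of_real q) / (1 - of_real q * iexp (\<theta> ^ n * z))" for n
  \<comment> \<open>\<open>B n\<close> is the reciprocal of the last factor of \<open>fixeq\<close>,
    in the shape of \<open>exponent_wt_tendsto\<close> with \<open>t = - s\<close>; hence the
    product of the \<open>B n\<close> appears in the denominator.\<close>
  define B where "B n = (1 - of_real (- s)) / (1 - of_real (- s) * iexp (\<theta> ^ n * (- \<alpha> * z)))" for n
  have *: "\<phi> z = iexp (\<alpha> * z * (\<Sum>n<N. \<theta> ^ n)) * (\<Prod>n<N. A n) / (\<Prod>n<N. B n) * \<phi> (\<theta> ^ N * z)" for N
  proof (induction N)
    case (Suc N)
    have "\<phi> (\<theta> ^ N * z) = iexp (\<alpha> * z * \<theta> ^ N) * A N / B N * \<phi> (\<theta> ^ Suc N * z)"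
      using fixeq[of "\<theta> ^ N * z"] by (simp add: A_def B_def ac_simps)
    moreover have "iexp (\<alpha> * z * (\<Sum>n<Suc N. \<theta> ^ n)) = iexp (\<alpha> * z * (\<Sum>n<N. \<theta> ^ n)) * iexp (\<alpha> * z * \<theta> ^ N)"
      by (simp add: exp_add distrib_left)
    ultimately show ?case
      by (subst Suc) simp
  qed simp
  have "(\<lambda>N. iexp (\<alpha> * z * (\<Sum>n<N. \<theta> ^ n)) * (\<Prod>n<N. A n) / (\<Prod>n<N. B n) * \<phi> (\<theta> ^ N * z)) \<longlonglongrightarrow>
     iexp (\<alpha> * z * (1 / (1 - \<theta>))) * exp (exponent (wt q) (loc \<theta>) z) / exp (exponent (wt (- s)) (loc \<theta>) (- \<alpha> * z)) * \<phi> 0"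
  unfolding A_def B_def
  proof (intro tendsto_mult tendsto_divide exponent_wt_tendsto)
    have "(\<lambda>n. \<theta> ^ n) sums (1 / (1 - \<theta>))" using th by (intro geometric_sums) auto
    then have "(\<lambda>N. \<Sum>n<N. \<theta> ^ n) \<longlonglongrightarrow> 1 / (1 - \<theta>)" by (simp add: sums_def)
    then show "(\<lambda>N. iexp (\<alpha> * z * (\<Sum>n<N. \<theta> ^ n))) \<longlonglongrightarrow> iexp (\<alpha> * z * (1 / (1 - \<theta>)))"
      by (intro tendsto_intros)
    have "(\<lambda>N. \<theta> ^ N * z) \<longlonglongrightarrow> 0 * z" using th by (intro tendsto_intros LIMSEQ_power_zero) auto
    then show "(\<lambda>N. \<phi> (\<theta> ^ N * z)) \<longlonglongrightarrow> \<phi> 0"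
      using isCont_tendsto_compose[OF \<phi>0(2)] by simp
  qed (use q s in auto)
  from LIMSEQ_unique[OF this[folded *] tendsto_const]
  have "\<phi> z = iexp (\<alpha> * z * (1 / (1 - \<theta>))) * exp (exponent (wt q) (loc \<theta>) z) / exp (exponent (wt (- s)) (loc \<theta>) (- \<alpha> * z)) * \<phi> 0"
    by simp
  then show ?thesis
    by (simp add: exponent_uminus_scale \<phi>0(1) exp_add exp_diff)
qed

text \<open>The exponent of \<open>wt (- s)\<close> enters with a minus sign, so odd m give positive
  and even m give negative masses, all at points of the negative half-line. The geometric atoms are
  separated from the negative ones by sign, the odd atoms by the parity condition
  \<open>par\<close>.\<close>

lemma fixpoint_quasi_ID:
  assumes "real_distribution \<sigma>" "\<And>z. char \<sigma> z = \<phi> z" and \<alpha>: "\<alpha> > 0"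
    and par: "\<And>n m n' m'. m > 0 \<Longrightarrow> \<theta> ^ n * real m \<noteq> 0 \<Longrightarrow> \<theta> ^ n * real m = \<theta> ^ n' * real m' \<Longrightarrow> even m = even m'"
  shows "\<sigma> \<in> quasi_ID"
proof -
  define e where "e i = (if even (snd i) then wt s i else 0)" for i
  define od where "od i = (if odd (snd i) then wt s i else 0)" for i
  define l where "l bi = (if fst bi then wt q (snd bi) else od (snd bi))" for bi
  define x where "x bi = (if fst bi then loc \<theta> (snd bi) else - \<alpha> * loc \<theta> (snd bi))" for bi
  have ints: "integrable (count_space UNIV) (\<lambda>i. wt s i * loc \<theta> i)"
    using s by (intro integrable_wt) auto
  have ie: "integrable (count_space UNIV) (\<lambda>i. e i * (- \<alpha> * loc \<theta> i))"
    and io: "integrable (count_space UNIV) (\<lambda>i. od i * (- \<alpha> * loc \<theta> i))"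
    by (rule Bochner_Integration.integrable_bound[OF integrable_mult_right[OF ints, of \<alpha>]];
        simp add: e_def od_def abs_mult)+
  have wt0: "wt t i \<ge> 0" if "t \<ge> 0" for t i using that by (simp add: wt_def)
  have sg: "wt (- s) i = e i - od i" for i
    by (simp add: e_def od_def wt_def)
  have ex: "exponent l x z = exponent (wt q) (loc \<theta>) z + exponent od (\<lambda>i. - \<alpha> * loc \<theta> i) z" for z
    using exponent_bool_times[of l x z] integrable_wt[of q] io q by (simp add: l_def x_def)
  show ?thesis
  proof (rule quasi_ID_atomic[where l = l and x = x and l' = e and x' = "\<lambda>i. - \<alpha> * loc \<theta> i" and b = "\<alpha> / (1 - \<theta>)"])
    show "integrable (count_space UNIV) (\<lambda>i. l i * x i)"
      by (rule integral_count_space_bool_times(1)) (use io integrable_wt[of q] q in \<open>auto simp: l_def x_def\<close>)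
    show "x i \<noteq> - \<alpha> * loc \<theta> j" if "l i \<noteq> 0" "e j \<noteq> 0" "x i \<noteq> 0" for i j
    proof (cases "fst i")
      case True
      then have "x i > 0" using that(3) th by (auto simp: x_def loc_def zero_less_mult_iff)
      moreover have "- \<alpha> * loc \<theta> j \<le> 0" using \<alpha> th by (simp add: loc_def)
      ultimately show ?thesis by simp
    next
      case False
      obtain n m where i: "snd i = (n, m)" by force
      obtain n' m' where j: "j = (n', m')" by force
      have "odd m" using that(1) False i by (auto simp: l_def od_def split: if_splits)
      moreover have "even m'" using that(2) j by (auto simp: e_def split: if_splits)
      moreover have "loc \<theta> (n, m) \<noteq> 0" using that(3) False i by (auto simp: x_def)
      moreover have "\<theta> ^ n * real m = \<theta> ^ n' * real m'" if "x i = - \<alpha> * loc \<theta> j"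
        using that False i j \<alpha> by (simp add: x_def loc_def)
      ultimately show ?thesis using par[of m n n' m'] odd_pos[of m] unfolding loc_def fst_conv snd_conv by metis
    qed
    show "char \<sigma> z = exp (\<i> * of_real (\<alpha> / (1 - \<theta>) * z) + (exponent l x z - exponent e (\<lambda>i. - \<alpha> * loc \<theta> i) z))" for z
    proof -
      have "exponent (wt (- s)) (\<lambda>i. - \<alpha> * loc \<theta> i) z = exponent e (\<lambda>i. - \<alpha> * loc \<theta> i) z - exponent od (\<lambda>i. - \<alpha> * loc \<theta> i) z"
        unfolding sg[abs_def] by (rule exponent_diff[OF ie io])
      then show ?thesis unfolding assms(2) by (subst fixpoint_exponent) (simp add: ex diff_diff_eq2)
    qed
  qed (use assms(1) ie wt0 q s in \<open>auto simp: l_def e_def od_def\<close>)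
qed

text \<open>The modulus of \<phi> is unchanged when the atoms on the negative half-line are
  reflected. The even atoms, of mass - s^m / m, then meet the geometric atoms: \<open>h\<close>
  assigns to each an index of the same location with at least the same weight, and the difference is
  nonnegative.\<close>

lemma fixpoint_symmetrization_ID:
  fixes h :: "nat \<times> nat \<Rightarrow> nat \<times> nat"
  assumes ch: "\<And>z. char \<sigma> z = \<phi> z"
    and inj: "inj_on h {i. even (snd i)}"
    and loc: "\<And>i. even (snd i) \<Longrightarrow> loc \<theta> (h i) = \<alpha> * loc \<theta> i"
    and le: "\<And>i. even (snd i) \<Longrightarrow> wt s i \<le> wt q (h i)"
  shows "symmetrization \<sigma> \<in> ID"
proof -
  define E :: "(nat \<times> nat) set" where "E = {i. even (snd i)}"
  define od where "od i = (if odd (snd i) then wt s i else 0)" for i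
  define e where "e i = (if even (snd i) then wt s i else 0)" for i
  \<comment> \<open>The even masses transported by \<open>h\<close>; \<open>d \<le> wt q\<close> is
    the absorption.\<close>
  define d where "d j = (if j \<in> h ` E then wt s (the_inv_into E h j) else 0)" for j
  have inj': "inj_on h E" using inj by (simp add: E_def)
  have dh: "d (h i) = wt s i" if "i \<in> E" for i
    using that by (simp add: d_def the_inv_into_f_f[OF inj'])
  have wt0: "wt t i \<ge> 0" if "t \<ge> 0" for t i using that by (simp add: wt_def)
  have ints: "integrable (count_space UNIV) (\<lambda>i. wt s i * loc \<theta> i)"
    using s by (intro integrable_wt) auto
  have intq: "integrable (count_space UNIV) (\<lambda>i. wt q i * loc \<theta> i)"
    using q by (intro integrable_wt) auto
  have ie: "integrable (count_space UNIV) (\<lambda>i. e i * (\<alpha> * loc \<theta> i))"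
    and io: "integrable (count_space UNIV) (\<lambda>i. od i * (\<alpha> * loc \<theta> i))"
    by (rule Bochner_Integration.integrable_bound[OF integrable_mult_right[OF ints, of \<alpha>]];
        simp add: e_def od_def abs_mult)+
  have dq: "0 \<le> d j" "d j \<le> wt q j" for j
    using dh le wt0[of s] wt0[of q j] q s by (auto simp: d_def E_def)
  have id: "integrable (count_space UNIV) (\<lambda>i. d i * loc \<theta> i)"
    by (rule Bochner_Integration.integrable_bound[OF intq])
      (use dq wt0[of q] q in \<open>auto simp: abs_mult intro!: mult_right_mono\<close>)
  have ed: "exponent e (\<lambda>i. \<alpha> * loc \<theta> i) z = exponent d (loc \<theta>) z" for z
  proof -
    have "exponent e (\<lambda>i. \<alpha> * loc \<theta> i) z =
      (\<integral>i. indicator E i *\<^sub>R (of_real (d (h i)) * (iexp (z * loc \<theta> (h i)) - 1)) \<partial>count_space UNIV)"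
      unfolding exponent_def
      by (rule Bochner_Integration.integral_cong) (auto simp: indicator_def dh e_def loc, auto simp: E_def)
    also have "\<dots> = exponent d (loc \<theta>) z"
      unfolding exponent_def by (rule integral_count_space_inj(1)[OF inj']) (simp add: d_def)
    finally show ?thesis .
  qed
  \<comment> \<open>\<open>g\<close> is the logarithm of \<phi> without its drift and with the atoms
    on the negative half-line reflected. Neither change affects the real part, so
    \<open>g z + cnj (g z)\<close> is the logarithm of the squared modulus.\<close>
  define g where "g z = exponent (\<lambda>j. wt q j - d j) (loc \<theta>) z + exponent od (\<lambda>i. \<alpha> * loc \<theta> i) z" for z
  have sg: "wt (- s) i = e i - od i" for i
    by (simp add: e_def od_def wt_def)
  have g: "g z = exponent (wt q) (loc \<theta>) z - exponent (wt (- s)) (\<lambda>i. \<alpha> * loc \<theta> i) z" for z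
    unfolding g_def sg[abs_def] exponent_diff[OF intq id] exponent_diff[OF ie io] ed by simp
  have "idexp g" unfolding g_def
  proof (intro idexp_add idexp_exponent)
    show "integrable (count_space UNIV) (\<lambda>i. (wt q i - d i) * loc \<theta> i)"
      using Bochner_Integration.integrable_diff[OF intq id] by (simp add: left_diff_distrib)
  qed (use dq wt0 s io in \<open>auto simp: od_def\<close>)
  then have id: "idexp (\<lambda>z. g z + cnj (g z))" by (intro idexp_add idexp_cnj)
  have sq: "exp (g z + cnj (g z)) = of_real ((cmod (char \<sigma> z))\<^sup>2)" for z
  proof -
    let ?a = "exponent (wt q) (loc \<theta>) z" and ?b = "exponent (wt (- s)) (loc \<theta>) (\<alpha> * z)"
    have "\<phi> z = exp (\<i> * of_real (\<alpha> / (1 - \<theta>) * z) + (?a - cnj ?b))"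
      by (subst fixpoint_exponent) (simp add: exponent_uminus_scale cnj_exponent del: of_real_mult)
    then have "\<phi> z * cnj (\<phi> z) = exp (\<i> * of_real (\<alpha> / (1 - \<theta>) * z) + (?a - cnj ?b)) *
       exp (cnj (\<i> * of_real (\<alpha> / (1 - \<theta>) * z) + (?a - cnj ?b)))"
      by (simp only: exp_cnj)
    also have "\<dots> = exp (g z + cnj (g z))"
      unfolding exp_add[symmetric] g exponent_scale by (simp add: algebra_simps)
    finally show ?thesis by (simp only: ch complex_norm_square)
  qed
  obtain \<tau> where \<tau>: "real_distribution \<tau>" "\<And>z. char \<tau> z = exp (g z + cnj (g z))"
    using id[unfolded idexp_def, rule_format, of 1] by auto
  have "symmetrization \<sigma> = \<tau>"
    unfolding symmetrization_def
  proof (rule the_equality)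
    show "real_distribution \<tau> \<and> (\<forall>z. char \<tau> z = of_real ((cmod (char \<sigma> z))\<^sup>2))"
      using \<tau> sq by simp
    show "\<tau>' = \<tau>" if "real_distribution \<tau>' \<and> (\<forall>z. char \<tau>' z = of_real ((cmod (char \<sigma> z))\<^sup>2))" for \<tau>'
      using that \<tau> by (intro Levy_uniqueness ext) (simp_all only: sq)
  qed
  then show ?thesis using idexp_ID[OF id \<tau>] by simp
qed

end
end

section \<open>Laplace transforms and zeros\<close>

text \<open>Cutting off at 0 bounds the integrand by 1 for \<open>0 \<le> Re t\<close> whatever the
  law. For laws on the half-line this is the usual Laplace transform.\<close>

definition lap :: "real measure \<Rightarrow> complex \<Rightarrow> complex" where
  "lap M t = (CLINT y|M. exp (- (t * of_real (max 0 y))))"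

lemma lap_distr_lin:
  assumes "real_distribution M" "real_distribution N" and nn: "AE y in M. 0 \<le> y" "AE y in N. 0 \<le> y"
    and c: "0 \<le> c" and t: "0 \<le> Re t"
  shows "lap (distr (M \<Otimes>\<^sub>M N) borel (\<lambda>p. fst p + c * snd p)) t = lap M t * lap N (of_real c * t)"
    "AE y in distr (M \<Otimes>\<^sub>M N) borel (\<lambda>p. fst p + c * snd p). 0 \<le> y"
proof -
  interpret M: real_distribution M by fact
  interpret N: real_distribution N by fact
  interpret P: pair_prob_space M N ..
  have ae: "AE p in M \<Otimes>\<^sub>M N. 0 \<le> fst p \<and> 0 \<le> snd p"
  proof (rule P.AE_pair_measure)
    show "{p \<in> space (M \<Otimes>\<^sub>M N). 0 \<le> fst p \<and> 0 \<le> snd p} \<in> sets (M \<Otimes>\<^sub>M N)" by measurable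
  qed (use nn in auto)
  show "AE y in distr (M \<Otimes>\<^sub>M N) borel (\<lambda>p. fst p + c * snd p). 0 \<le> y"
    by (subst AE_distr_iff) (use ae c in auto)
  have "lap (distr (M \<Otimes>\<^sub>M N) borel (\<lambda>p. fst p + c * snd p)) t =
    (CLINT p|M \<Otimes>\<^sub>M N. exp (- (t * of_real (max 0 (fst p + c * snd p)))))"
    unfolding lap_def by (subst integral_distr) auto
  also have "\<dots> = (CLINT p|M \<Otimes>\<^sub>M N. exp (- (t * of_real (max 0 (fst p)))) * exp (- ((of_real c * t) * of_real (max 0 (snd p)))))"
    by (rule integral_cong_AE)
      (use ae c in \<open>auto simp: exp_add[symmetric] algebra_simps max_absorb2\<close>)
  also have "\<dots> = lap M t * lap N (of_real c * t)"
    unfolding lap_def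
    by (rule integral_pair_mult) (use t c in \<open>auto intro: M.prob_space_axioms N.prob_space_axioms\<close>)
  finally show "lap (distr (M \<Otimes>\<^sub>M N) borel (\<lambda>p. fst p + c * snd p)) t = lap M t * lap N (of_real c * t)" .
qed

lemma lap_tendsto:
  assumes "real_distribution M" and t: "\<And>n. 0 \<le> Re (t n)" "t \<longlonglongrightarrow> a"
  shows "(\<lambda>n. lap M (t n)) \<longlonglongrightarrow> lap M a"
proof -
  interpret M: real_distribution M by fact
  show ?thesis unfolding lap_def
  proof (rule integral_dominated_convergence[where w = "\<lambda>_. 1"])
    show "AE y in M. (\<lambda>n. exp (- (t n * of_real (max 0 y)))) \<longlonglongrightarrow> exp (- (a * of_real (max 0 y)))"
      using t(2) by (intro AE_I2 tendsto_intros)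
  qed (use t(1) in auto)
qed

lemma lap_0: "real_distribution M \<Longrightarrow> lap M 0 = 1"
  by (simp add: lap_def real_distribution_def prob_space.prob_space)

text \<open>The derivative of exp (- a y) in a has modulus y exp (- Re a y) \<le> 1 / Re a, because
  x exp (- x) \<le> 1. This Lipschitz bound to the right of a zero is the quantitative substitute
  for the order of a zero of a holomorphic function.\<close>

lemma lap_diff_le:
  assumes "real_distribution M" and a: "0 < Re a" and e: "0 \<le> \<epsilon>"
  shows "norm (lap M (a + of_real \<epsilon>) - lap M a) \<le> \<epsilon> / Re a"
proof -
  interpret M: real_distribution M by fact
  have int: "integrable M (\<lambda>y. exp (- (t * of_real (max 0 y))))" if "0 \<le> Re t" for t :: complex
    by (rule M.integrable_const_bound[where B = 1]) (use that in auto)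
  have le: "norm (exp (- ((a + of_real \<epsilon>) * of_real y)) - exp (- (a * of_real y))) \<le> \<epsilon> / Re a"
    if y: "0 \<le> y" for y :: real
  proof -
    have "exp (- ((a + of_real \<epsilon>) * of_real y)) - exp (- (a * of_real y)) =
      exp (- (a * of_real y)) * of_real (exp (- (\<epsilon> * y)) - 1)"
      by (simp add: algebra_simps exp_of_real[symmetric] exp_diff exp_minus divide_inverse)
    also have "norm \<dots> = exp (- (Re a * y)) * (1 - exp (- (\<epsilon> * y)))"
      using y e by (simp add: norm_mult del: of_real_diff)
    also have "\<dots> \<le> exp (- (Re a * y)) * (\<epsilon> * y)"
      using exp_ge_add_one_self[of "- (\<epsilon> * y)"] by (intro mult_left_mono) auto
    also have "\<dots> = \<epsilon> / Re a * ((Re a * y) * exp (- (Re a * y)))"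
      using a by (simp add: field_simps)
    also have "\<dots> \<le> \<epsilon> / Re a * 1"
    proof (intro mult_left_mono)
      have "Re a * y \<le> exp (Re a * y)" using exp_ge_add_one_self[of "Re a * y"] by linarith
      then show "(Re a * y) * exp (- (Re a * y)) \<le> 1" by (simp add: exp_minus field_simps)
    qed (use a e in auto)
    finally show ?thesis by simp
  qed
  have "lap M (a + of_real \<epsilon>) - lap M a =
    (CLINT y|M. exp (- ((a + of_real \<epsilon>) * of_real (max 0 y))) - exp (- (a * of_real (max 0 y))))"
    unfolding lap_def
    by (rule Bochner_Integration.integral_diff[symmetric]) (use a e in \<open>auto intro!: int\<close>)
  also have "norm \<dots> \<le> (\<integral>y. \<epsilon> / Re a \<partial>M)"
    by (rule Bochner_Integration.integral_norm_bound_integral)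
      (use a e in \<open>auto intro!: int Bochner_Integration.integrable_diff le\<close>)
  finally show ?thesis using M.prob_space by simp
qed

section \<open>The law with transform R\<close>

text \<open>The number of jumps (0, 1) before the first jump of N; each jump of the pair is of this
  kind with probability q.\<close>

definition geom :: "real \<Rightarrow> real measure" where
  "geom q = distr (measure_pmf (geometric_pmf (1 - q))) borel real"

text \<open>The jump of L at the first jump of N: with s = u / w it is \<alpha> with probability 1 /
  (1 + s) = w / (u + w) and 0 otherwise.\<close>

definition bern :: "real \<Rightarrow> real \<Rightarrow> real measure" where
  "bern s \<alpha> = distr (measure_pmf (bernoulli_pmf (1 / (1 + s)))) borel (\<lambda>b. \<alpha> * of_bool b)"

lemma real_distribution_geom: "real_distribution (geom q)"
  unfolding geom_def by (rule prob_space.real_distribution_distr) (auto simp: prob_space_measure_pmf)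

lemma real_distribution_bern: "real_distribution (bern s \<alpha>)"
  unfolding bern_def by (rule prob_space.real_distribution_distr) (auto simp: prob_space_measure_pmf)

lemma geometric_pmf_power:
  assumes q: "0 < q" "q < 1" and w: "cmod w \<le> 1"
  shows "(\<integral>k. w ^ k \<partial>measure_pmf (geometric_pmf (1 - q))) = (1 - of_real q) / (1 - of_real q * w)"
proof (rule nat_pmf_expectation(2))
  have "norm (of_real q * w) < 1" using q w by (simp add: norm_mult) (metis less_eq_real_def mult_left_le order_le_less_trans)
  then have *: "(\<lambda>k. (1 - of_real q) * (of_real q * w) ^ k) sums ((1 - of_real q) * (1 / (1 - of_real q * w)))"
    and s: "summable (\<lambda>k. (1 - q) * norm (of_real q * w) ^ k)"
    by (intro sums_mult geometric_sums summable_mult summable_geometric; simp)+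
  have p: "pmf (geometric_pmf (1 - q)) k = (1 - q) * q ^ k" for k
    using q by (subst pmf_geometric) auto
  show "(\<lambda>k. pmf (geometric_pmf (1 - q)) k *\<^sub>R w ^ k) sums ((1 - of_real q) / (1 - of_real q * w))"
    using * by (simp add: p scaleR_conv_of_real power_mult_distrib ac_simps)
  show "summable (\<lambda>k. pmf (geometric_pmf (1 - q)) k * norm (w ^ k))"
    using s q by (simp add: p norm_mult norm_power power_mult_distrib ac_simps)
qed

lemma
  assumes q: "0 < q" "q < 1"
  shows char_geom: "char (geom q) z = (1 - of_real q) / (1 - of_real q * iexp z)"
    and lap_geom: "0 \<le> Re t \<Longrightarrow> lap (geom q) t = (1 - of_real q) / (1 - of_real q * exp (- t))"
proof -
  have e: "iexp (z * real k) = iexp z ^ k" "exp (- (t * of_nat k)) = exp (- t) ^ k" for k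
    by (simp_all add: exp_of_nat_mult[symmetric] ac_simps)
  have "char (geom q) z = (\<integral>k. iexp z ^ k \<partial>measure_pmf (geometric_pmf (1 - q)))"
    unfolding char_def geom_def
    by (subst integral_distr) (simp_all only: e, auto)
  then show "char (geom q) z = (1 - of_real q) / (1 - of_real q * iexp z)"
    using geometric_pmf_power[OF q, of "iexp z"] by simp
  assume t: "0 \<le> Re t"
  have "lap (geom q) t = (\<integral>k. exp (- t) ^ k \<partial>measure_pmf (geometric_pmf (1 - q)))"
    unfolding lap_def geom_def
    by (subst integral_distr) (auto simp: e)
  then show "lap (geom q) t = (1 - of_real q) / (1 - of_real q * exp (- t))"
    using geometric_pmf_power[OF q, of "exp (- t)"] t by simp
qed

lemma
  assumes s: "0 < s"
  shows char_bern: "char (bern s \<alpha>) z = (of_real s + iexp (\<alpha> * z)) / (1 + of_real s)"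
    and lap_bern: "0 \<le> \<alpha> \<Longrightarrow> lap (bern s \<alpha>) t = (of_real s + exp (- (of_real \<alpha> * t))) / (1 + of_real s)"
proof -
  have *: "(\<integral>b. f b \<partial>measure_pmf (bernoulli_pmf (1 / (1 + s)))) = (of_real s * f False + f True) / (1 + of_real s)"
    for f :: "bool \<Rightarrow> complex"
  proof -
    have "(\<integral>b. f b \<partial>measure_pmf (bernoulli_pmf (1 / (1 + s)))) = (1 / (1 + s)) *\<^sub>R f True + (1 - 1 / (1 + s)) *\<^sub>R f False"
      using s by (subst integral_measure_pmf[of UNIV]) (auto simp: UNIV_bool)
    also have "1 - 1 / (1 + s) = s / (1 + s)" using s by (simp add: field_simps)
    finally show ?thesis by (simp add: scaleR_conv_of_real add_divide_distrib)
  qed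
  show "char (bern s \<alpha>) z = (of_real s + iexp (\<alpha> * z)) / (1 + of_real s)"
    unfolding char_def bern_def by (subst integral_distr) (auto simp: * ac_simps)
  show "lap (bern s \<alpha>) t = (of_real s + exp (- (of_real \<alpha> * t))) / (1 + of_real s)" if "0 \<le> \<alpha>"
    unfolding lap_def bern_def using that by (subst integral_distr) (auto simp: * ac_simps)
qed

text \<open>If two independent copies of a variable are both negative with positive probability,
  their sum is negative with positive probability.\<close>

lemma convolution_nonneg_imp:
  assumes "real_distribution \<tau>" and nn: "AE y in convolution \<tau> \<tau>. 0 \<le> y"
  shows "AE y in \<tau>. 0 \<le> y"
proof -
  interpret T: real_distribution \<tau> by fact
  interpret P: pair_prob_space \<tau> \<tau> ..
  have "AE p in \<tau> \<Otimes>\<^sub>M \<tau>. 0 \<le> fst p + snd p"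
    using nn unfolding convolution_def by (subst (asm) AE_distr_iff) (auto simp: case_prod_beta)
  then have "AE p in \<tau> \<Otimes>\<^sub>M \<tau>. \<not> (p \<in> {..<0} \<times> {..<0})"
    by eventually_elim auto
  then have "emeasure (\<tau> \<Otimes>\<^sub>M \<tau>) ({..<0} \<times> {..<0}) = 0"
    by (subst (asm) AE_iff_measurable[OF _ refl]) (auto simp: space_pair_measure)
  then have "emeasure \<tau> {..<0} = 0"
    by (subst (asm) T.emeasure_pair_measure_Times) auto
  then show ?thesis
    by (subst AE_iff_measurable[OF _ refl]) (auto simp: not_le lessThan_def)
qed

text \<open>The Laplace transform of \<open>\<sigma>\<close> has a simple zero where \<open>exp (- \<alpha> t) = - s\<close>.
  A convolution square root of \<open>\<sigma>\<close> would also live on the half-line, so that this zero would be at least double.\<close>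

lemma fixpoint_not_ID:
  assumes th: "0 \<le> \<theta>" "\<theta> < 1" and q: "0 < q" "q < 1" and s: "0 < s" "s < 1" and \<alpha>: "0 < \<alpha>"
    and \<sigma>: "real_distribution \<sigma>" "AE y in \<sigma>. 0 \<le> y"
    and ch: "\<And>z. char \<sigma> z = iexp (\<alpha> * z) * ((1 - of_real q) / (1 - of_real q * iexp z)) *
       ((1 + of_real s * iexp (- \<alpha> * z)) / (1 + of_real s)) * char \<sigma> (\<theta> * z)"
  shows "\<sigma> \<notin> ID"
proof
  assume "\<sigma> \<in> ID"
  then obtain \<tau> where \<tau>: "real_distribution \<tau>" and "\<sigma> = conv_power \<tau> 2"
    unfolding ID_def by (auto dest!: spec[of _ 2])
  \<comment> \<open>\<open>conv_power\<close> ends with a point mass at 0, so the identification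
    goes through characteristic functions.\<close>
  have \<sigma>\<tau>: "\<sigma> = convolution \<tau> \<tau>"
  proof (rule Levy_uniqueness[OF \<sigma>(1) real_distribution_convolution[OF \<tau> \<tau>]])
    show "char \<sigma> = char (convolution \<tau> \<tau>)"
      using conv_power_char[OF \<tau>, of 2] \<open>\<sigma> = conv_power \<tau> 2\<close>
      by (auto simp: char_convolution[OF \<tau> \<tau>] power2_eq_square)
  qed
  have \<tau>0: "AE y in \<tau>. 0 \<le> y" by (rule convolution_nonneg_imp[OF \<tau>]) (use \<sigma>(2) in \<open>simp only: \<sigma>\<tau>[symmetric]\<close>)
  have sq: "lap \<sigma> t = (lap \<tau> t)\<^sup>2" if "0 \<le> Re t" for t
    using lap_distr_lin(1)[OF \<tau> \<tau> \<tau>0 \<tau>0, of 1 t] that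
    by (simp add: \<sigma>\<tau> convolution_def case_prod_beta' power2_eq_square)
  define R where "R t = ((1 - of_real q) / (1 - of_real q * exp (- t))) * ((of_real s + exp (- (of_real \<alpha> * t))) / (1 + of_real s))"
    for t :: complex
  define \<rho> where "\<rho> = distr (geom q \<Otimes>\<^sub>M bern s \<alpha>) borel (\<lambda>p. fst p + 1 * snd p)"
  note rg = real_distribution_geom[of q] and rb = real_distribution_bern[of s \<alpha>]
  have g0: "AE y in geom q. 0 \<le> y" and b0: "AE y in bern s \<alpha>. 0 \<le> y"
    unfolding geom_def bern_def using \<alpha> by (subst AE_distr_iff; simp)+
  have \<rho>: "real_distribution \<rho>"
    using real_distribution_convolution[OF rg rb] by (simp add: \<rho>_def convolution_def case_prod_beta')
  have \<rho>0: "AE y in \<rho>. 0 \<le> y"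
    unfolding \<rho>_def by (rule lap_distr_lin(2)[OF rg rb g0 b0, of 1 0]) auto
  have lap\<rho>: "lap \<rho> t = R t" if "0 \<le> Re t" for t
    unfolding \<rho>_def using lap_distr_lin(1)[OF rg rb g0 b0, of 1 t] that \<alpha>
    by (simp add: lap_geom[OF q] lap_bern[OF s(1)] R_def)
  have ch\<rho>: "char \<rho> z = ((1 - of_real q) / (1 - of_real q * iexp z)) * ((of_real s + iexp (\<alpha> * z)) / (1 + of_real s))" for z
    unfolding \<rho>_def using char_distr_lin[OF rg rb, of 1 z]
    by (simp add: char_geom[OF q] char_bern[OF s(1)])
  interpret \<rho>: real_distribution \<rho> by fact
  interpret S: real_distribution \<sigma> by fact
  interpret P: pair_prob_space \<rho> \<sigma> ..
  \<comment> \<open>Turning the functional equation into an identity of laws yields the same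
    equation for the Laplace transform, without analytic continuation.\<close>
  have \<sigma>\<rho>: "\<sigma> = distr (\<rho> \<Otimes>\<^sub>M \<sigma>) borel (\<lambda>p. fst p + \<theta> * snd p)"
  proof (rule Levy_uniqueness[OF \<sigma>(1)])
    show "real_distribution (distr (\<rho> \<Otimes>\<^sub>M \<sigma>) borel (\<lambda>p. fst p + \<theta> * snd p))"
      by (rule P.real_distribution_distr) measurable
    have "iexp (\<alpha> * z) * (1 + of_real s * iexp (- \<alpha> * z)) = of_real s + iexp (\<alpha> * z)" for z
      by (simp add: algebra_simps exp_minus)
    then have e: "iexp (\<alpha> * z) * a * ((1 + of_real s * iexp (- \<alpha> * z)) / b) * c = a * ((of_real s + iexp (\<alpha> * z)) / b) * c"
      for z a b c by (metis (no_types, lifting) mult.assoc mult.commute times_divide_eq_right)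
    show "char \<sigma> = char (distr (\<rho> \<Otimes>\<^sub>M \<sigma>) borel (\<lambda>p. fst p + \<theta> * snd p))"
      by (rule ext, subst char_distr_lin[OF \<rho> \<sigma>(1)], subst ch, subst ch\<rho>) (rule e)
  qed
  have lap\<sigma>: "lap \<sigma> t = R t * lap \<sigma> (of_real \<theta> * t)" if "0 \<le> Re t" for t
    using lap_distr_lin(1)[OF \<rho> \<sigma>(1) \<rho>0 \<sigma>(2) th(1) that] lap\<rho>[OF that] \<sigma>\<rho> by metis
  \<comment> \<open>The solution of exp (- \<alpha> t) = - s with imaginary part pi / \<alpha>;
    \<open>s < 1\<close> puts it in the open right half-plane.\<close>
  define t0 where "t0 = Complex (ln (1 / s) / \<alpha>) (pi / \<alpha>)"
  have ret0: "Re t0 > 0" using s \<alpha> by (simp add: t0_def)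
  have et0: "exp (- (of_real \<alpha> * t0)) = - of_real s"
  proof -
    have "of_real \<alpha> * t0 = of_real (ln (1 / s)) + \<i> * of_real pi"
      using \<alpha> by (simp add: t0_def complex_eq_iff)
    moreover have "exp (- (of_real (ln (1 / s)) :: complex)) = of_real s"
      using s by (simp add: exp_of_real[symmetric] ln_div exp_minus[symmetric] del: exp_of_real flip: of_real_minus)
        (simp add: exp_of_real)
    ultimately show ?thesis by (simp add: exp_diff exp_minus)
  qed
  have "lap \<sigma> t0 = 0" using lap\<sigma>[of t0] ret0 by (simp add: R_def et0)
  then have lt0: "lap \<tau> t0 = 0" using sq[of t0] ret0 by simp
  have nz: "lap \<sigma> (of_real \<theta> * t0) \<noteq> 0"
  proof -
    \<comment> \<open>The modulus of exp (- \<alpha> \<theta>^n t0) is s to the power \<theta>^n,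
      which exceeds s because \<theta>^n < 1.\<close>
    have R: "R (of_real (\<theta> ^ n) * t0) \<noteq> 0" if "n \<ge> 1" for n
    proof -
      have "\<theta> ^ n < 1" using th that by (simp add: power_less_one_iff)
      then have "norm (exp (- (of_real \<alpha> * (of_real (\<theta> ^ n) * t0)))) > s"
      proof -
        have "- (\<theta> ^ n * ln (1 / s)) > - ln (1 / s)" using \<open>\<theta> ^ n < 1\<close> s by simp
        then have "exp (- (\<theta> ^ n * ln (1 / s))) > exp (- ln (1 / s))" by (simp only: exp_less_mono)
        moreover have "exp (- ln (1 / s)) = s" using s by (simp add: exp_minus)
        moreover have "norm (exp (- (of_real \<alpha> * (of_real (\<theta> ^ n) * t0)))) = exp (- (\<theta> ^ n * ln (1 / s)))"
        proof -
          have "\<alpha> * (\<theta> ^ n * Re t0) = \<theta> ^ n * ln (1 / s)" using \<alpha> by (simp add: t0_def)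
          then show ?thesis by (simp only: norm_exp_eq_Re) simp
        qed
        ultimately show ?thesis by metis
      qed
      moreover have "norm (exp (- (of_real \<alpha> * (of_real (\<theta> ^ n) * t0)))) = s"
        if "of_real s + exp (- (of_real \<alpha> * (of_real (\<theta> ^ n) * t0))) = 0"
        using that s by (metis add_eq_0_iff norm_minus_cancel norm_of_real abs_of_pos)
      moreover have "norm (of_real q * exp (- (of_real (\<theta> ^ n) * t0))) < 1"
      proof -
        have "norm (exp (- (of_real (\<theta> ^ n) * t0))) \<le> 1" using ret0 th by simp
        then show ?thesis using q
          by (simp add: norm_mult del: norm_exp_eq_Re) (metis less_eq_real_def mult_left_le order_le_less_trans)
      qed
      ultimately have "of_real s + exp (- (of_real \<alpha> * (of_real (\<theta> ^ n) * t0))) \<noteq> 0"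
        and "1 - of_real q * exp (- (of_real (\<theta> ^ n) * t0)) \<noteq> 0"
        by (metis less_irrefl, metis eq_iff_diff_eq_0 less_irrefl norm_one)
      moreover have "(1 - of_real q :: complex) \<noteq> 0" "(1 + of_real s :: complex) \<noteq> 0"
        using q s by (auto simp: complex_eq_iff)
      ultimately show ?thesis unfolding R_def by simp
    qed
    have "(\<lambda>n. lap \<sigma> (of_real (\<theta> ^ n) * t0)) \<longlonglongrightarrow> lap \<sigma> (of_real 0 * t0)"
    proof (rule lap_tendsto[OF \<sigma>(1)])
      show "0 \<le> Re (of_real (\<theta> ^ n) * t0)" for n using ret0 th by simp
      show "(\<lambda>n. of_real (\<theta> ^ n) * t0) \<longlonglongrightarrow> of_real 0 * t0"
        using th by (intro tendsto_mult tendsto_of_real tendsto_const LIMSEQ_power_zero) auto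
    qed
    then have "(\<lambda>n. lap \<sigma> (of_real (\<theta> ^ n) * t0)) \<longlonglongrightarrow> 1" by (simp add: lap_0[OF \<sigma>(1)])
    then have "eventually (\<lambda>n. lap \<sigma> (of_real (\<theta> ^ n) * t0) \<noteq> 0) sequentially"
      by (rule tendsto_imp_eventually_ne) simp
    then obtain N where N: "\<And>n. n \<ge> N \<Longrightarrow> lap \<sigma> (of_real (\<theta> ^ n) * t0) \<noteq> 0"
      by (auto simp: eventually_sequentially)
    \<comment> \<open>Near 0 the transform is close to 1. The functional equation carries
      nonvanishing outwards, from the exponent \<open>Suc N\<close> down to 1.\<close>
    have "lap \<sigma> (of_real (\<theta> ^ (Suc N - k)) * t0) \<noteq> 0" if "k \<le> N" for k
      using that
    proof (induction k)
      case (Suc k)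
      have "of_real \<theta> * (of_real (\<theta> ^ (Suc N - Suc k)) * t0) = of_real (\<theta> ^ (Suc N - k)) * t0"
        using Suc.prems by (simp add: Suc_diff_le)
      moreover have "0 \<le> Re (of_real (\<theta> ^ (Suc N - Suc k)) * t0)" using ret0 th by simp
      moreover have "R (of_real (\<theta> ^ (Suc N - Suc k)) * t0) \<noteq> 0" using Suc.prems by (intro R) auto
      moreover have "lap \<sigma> (of_real (\<theta> ^ (Suc N - k)) * t0) \<noteq> 0" using Suc by simp
      ultimately show ?case
        using lap\<sigma>[of "of_real (\<theta> ^ (Suc N - Suc k)) * t0"] by (metis mult_eq_0_iff)
    qed (use N[of "Suc N"] in auto)
    from this[of N] show ?thesis by simp
  qed
  \<comment> \<open>The first factor bounds the geometric part of R from below, its denominator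
    having modulus at most 2; the second collects the constants of the linear lower bound for the
    Bernoulli part.\<close>
  define C where "C = (1 - q) / 2 * (s / (1 + s))"
  have C: "C > 0" using q s by (simp add: C_def)
  \<comment> \<open>At distance \<epsilon> to the right of the zero, the squared transform of \<tau>
    is of order \<epsilon>^2 while R is at least of order \<epsilon>. After division by \<epsilon>
    the limit \<epsilon> to 0 contradicts \<open>nz\<close>.\<close>
  have key: "C * (\<alpha> / (1 + \<alpha> * \<epsilon>)) * norm (lap \<sigma> (of_real \<theta> * (t0 + of_real \<epsilon>))) \<le> \<epsilon> / (Re t0)\<^sup>2" if e: "0 < \<epsilon>" for \<epsilon>
  proof -
    let ?t = "t0 + of_real \<epsilon>"
    have re: "0 \<le> Re ?t" using ret0 e by simp
    have "norm (lap \<tau> ?t) \<le> \<epsilon> / Re t0" using lap_diff_le[OF \<tau> ret0, of \<epsilon>] e lt0 by simp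
    then have "norm (lap \<sigma> ?t) \<le> (\<epsilon> / Re t0)\<^sup>2"
      unfolding sq[OF re] norm_power by (intro power_mono) auto
    then have up: "norm (R ?t) * norm (lap \<sigma> (of_real \<theta> * ?t)) \<le> \<epsilon> * (\<epsilon> / (Re t0)\<^sup>2)"
      unfolding lap\<sigma>[OF re] norm_mult by (simp add: power2_eq_square)
    have "C * (\<alpha> * \<epsilon> / (1 + \<alpha> * \<epsilon>)) \<le> norm (R ?t)"
    proof -
      have "exp (- (of_real \<alpha> * ?t)) = - of_real s * of_real (exp (- (\<alpha> * \<epsilon>)))"
      proof -
        have "- (of_real \<alpha> * ?t) = - (of_real \<alpha> * t0) + of_real (- (\<alpha> * \<epsilon>))" by (simp add: algebra_simps)
        then show ?thesis by (simp only: exp_add et0 exp_of_real)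
      qed
      then have "of_real s + exp (- (of_real \<alpha> * ?t)) = of_real (s * (1 - exp (- (\<alpha> * \<epsilon>))))"
        by (simp add: algebra_simps)
      then have 1: "norm ((of_real s + exp (- (of_real \<alpha> * ?t))) / (1 + of_real s)) = s * (1 - exp (- (\<alpha> * \<epsilon>))) / (1 + s)"
        using s \<alpha> e by (simp add: norm_divide norm_mult del: of_real_mult of_real_diff)
          (metis add_pos_pos less_numeral_extra(1) norm_of_real of_real_1 of_real_add abs_of_pos)
      have "norm (1 - of_real q * exp (- ?t)) \<le> norm (1 :: complex) + norm (of_real q * exp (- ?t))"
        by (rule norm_triangle_ineq4)
      also have "norm (of_real q * exp (- ?t)) \<le> 1"
        using q re by (simp add: norm_mult mult_le_one)
      finally have "norm (1 - of_real q * exp (- ?t)) \<le> 2" by simp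
      moreover have "norm (1 - of_real q * exp (- ?t)) > 0"
      proof -
        have "norm (of_real q * exp (- ?t)) < 1"
          using q re by (simp add: norm_mult) (metis exp_le_one_iff less_eq_real_def mult_left_le neg_le_0_iff_le order_le_less_trans plus_complex.sel(1) Re_complex_of_real minus_add_distrib uminus_complex.sel(1) add.commute diff_conv_add_uminus)
        then show ?thesis by auto
      qed
      ultimately have 2: "norm ((1 - of_real q) / (1 - of_real q * exp (- ?t))) \<ge> (1 - q) / 2"
      proof -
        have "norm (1 - of_real q :: complex) = 1 - q" using q by (metis abs_of_pos diff_gt_0_iff_gt norm_of_real of_real_1 of_real_diff)
        then show ?thesis using q \<open>norm (1 - of_real q * exp (- ?t)) \<le> 2\<close> \<open>norm (1 - of_real q * exp (- ?t)) > 0\<close>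
          by (simp only: norm_divide) (intro divide_left_mono, auto)
      qed
      have "1 + \<alpha> * \<epsilon> \<le> exp (\<alpha> * \<epsilon>)" by simp
      then have "exp (- (\<alpha> * \<epsilon>)) \<le> 1 / (1 + \<alpha> * \<epsilon>)"
        using \<alpha> e by (simp add: exp_minus inverse_eq_divide frac_le add_pos_pos)
      moreover have "1 + \<alpha> * \<epsilon> > 0" using \<alpha> e by (simp add: add_pos_pos)
      then have "\<alpha> * \<epsilon> / (1 + \<alpha> * \<epsilon>) = 1 - 1 / (1 + \<alpha> * \<epsilon>)"
        by (simp add: field_simps)
      ultimately have 3: "\<alpha> * \<epsilon> / (1 + \<alpha> * \<epsilon>) \<le> 1 - exp (- (\<alpha> * \<epsilon>))"
        by linarith
      have "C * (\<alpha> * \<epsilon> / (1 + \<alpha> * \<epsilon>)) \<le> C * (1 - exp (- (\<alpha> * \<epsilon>)))"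
        using 3 C by (intro mult_left_mono) auto
      also have "\<dots> = (1 - q) / 2 * (s * (1 - exp (- (\<alpha> * \<epsilon>))) / (1 + s))" by (simp add: C_def)
      also have "\<dots> \<le> norm (R ?t)"
        unfolding R_def norm_mult 1 using 2 s \<alpha> e by (intro mult_right_mono) auto
      finally show ?thesis .
    qed
    then have "C * (\<alpha> * \<epsilon> / (1 + \<alpha> * \<epsilon>)) * norm (lap \<sigma> (of_real \<theta> * ?t)) \<le> \<epsilon> * (\<epsilon> / (Re t0)\<^sup>2)"
      using up by (meson mult_right_mono norm_ge_zero order_trans)
    then have "\<epsilon> * (C * (\<alpha> / (1 + \<alpha> * \<epsilon>)) * norm (lap \<sigma> (of_real \<theta> * ?t))) \<le> \<epsilon> * (\<epsilon> / (Re t0)\<^sup>2)"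
      by (simp add: ac_simps)
    then show ?thesis using e by (simp only: mult_le_cancel_left_pos)
  qed
  let ?e = "\<lambda>n. inverse (real (Suc n))"
  have e0: "?e \<longlonglongrightarrow> 0" by (rule LIMSEQ_inverse_real_of_nat)
  have "C * (\<alpha> / (1 + \<alpha> * 0)) * norm (lap \<sigma> (of_real \<theta> * (t0 + of_real 0))) \<le> 0 / (Re t0)\<^sup>2"
  proof (rule tendsto_le[OF sequentially_bot])
    show "(\<lambda>n. ?e n / (Re t0)\<^sup>2) \<longlonglongrightarrow> 0 / (Re t0)\<^sup>2"
      using e0 ret0 by (intro tendsto_divide tendsto_const) auto
    show "(\<lambda>n. C * (\<alpha> / (1 + \<alpha> * ?e n)) * norm (lap \<sigma> (of_real \<theta> * (t0 + of_real (?e n))))) \<longlonglongrightarrow>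
      C * (\<alpha> / (1 + \<alpha> * 0)) * norm (lap \<sigma> (of_real \<theta> * (t0 + of_real 0)))"
    proof (intro tendsto_mult tendsto_norm lap_tendsto[OF \<sigma>(1)] tendsto_const tendsto_divide tendsto_add tendsto_of_real e0)
      show "0 \<le> Re (of_real \<theta> * (t0 + of_real (?e n)))" for n using ret0 th by simp
    qed simp
    show "\<forall>\<^sub>F n in sequentially. C * (\<alpha> / (1 + \<alpha> * ?e n)) * norm (lap \<sigma> (of_real \<theta> * (t0 + of_real (?e n)))) \<le> ?e n / (Re t0)\<^sup>2"
      by (intro always_eventually allI key) simp
  qed
  then have "C * \<alpha> * norm (lap \<sigma> (of_real \<theta> * t0)) \<le> 0" by simp
  then show False using C \<alpha> nz by (simp add: mult_le_0_iff)
qed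

section \<open>Path integrals of step functions\<close>

text \<open>A natural power in place of \<open>powr\<close>: for \<theta> = 0 it is 1 at 0 and 0 at
  positive naturals, which stops the integral at the first jump of N.\<close>

definition wgt :: "real \<Rightarrow> real \<Rightarrow> real" where
  "wgt \<theta> x = \<theta> ^ nat \<lfloor>x\<rfloor>"

lemma wgt_nat [simp]: "wgt \<theta> (real n) = \<theta> ^ n"
  by (simp add: wgt_def)

lemma wgt_bounds: "0 \<le> \<theta> \<Longrightarrow> \<theta> \<le> 1 \<Longrightarrow> 0 \<le> wgt \<theta> x \<and> wgt \<theta> x \<le> 1"
  by (simp add: wgt_def power_le_one)

lemma measurable_wgt [measurable]: "wgt \<theta> \<in> borel_measurable borel"
  unfolding wgt_def by measurable

text \<open>The deterministic properties shared by almost all pairs of paths of N and L; everything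
  pathwise is proved from them.\<close>

definition nice_path :: "(real \<Rightarrow> real) \<Rightarrow> (real \<Rightarrow> real) \<Rightarrow> bool" where
  "nice_path f g \<longleftrightarrow> f 0 = 0 \<and> g 0 = 0 \<and> (\<forall>t\<ge>0. f t \<in> \<nat>) \<and>
     (\<forall>s t. 0 \<le> s \<longrightarrow> s \<le> t \<longrightarrow> f s \<le> f t \<and> g s \<le> g t) \<and>
     (\<forall>t\<ge>0. (f \<longlongrightarrow> f t) (at_right t) \<and> (g \<longlongrightarrow> g t) (at_right t)) \<and>
     (\<forall>t>0. \<exists>l. (f \<longlongrightarrow> l) (at_left t))"

definition path_integral :: "real \<Rightarrow> (real \<Rightarrow> real) \<Rightarrow> (real \<Rightarrow> real) \<Rightarrow> real \<Rightarrow> real" where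
  "path_integral \<theta> f g t =
     (LINT s:{0<..t}|interval_measure (\<lambda>s. g (max s 0)). wgt \<theta> (Lim (at_left s) f))"

definition riemann_sum :: "real \<Rightarrow> (real \<Rightarrow> real) \<Rightarrow> (real \<Rightarrow> real) \<Rightarrow> real \<Rightarrow> nat \<Rightarrow> real" where
  "riemann_sum \<theta> f g h K = (\<Sum>k<K. wgt \<theta> (f (real k * h)) * (g (real (Suc k) * h) - g (real k * h)))"

context
  fixes f g :: "real \<Rightarrow> real"
  assumes nice: "nice_path f g"
begin

lemma path_Nats: "0 \<le> t \<Longrightarrow> \<exists>n. f t = real n"
  using nice by (fastforce simp: nice_path_def Nats_def)

lemma path_mono: "0 \<le> s \<Longrightarrow> s \<le> t \<Longrightarrow> f s \<le> f t" "0 \<le> s \<Longrightarrow> s \<le> t \<Longrightarrow> g s \<le> g t"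
  using nice by (auto simp: nice_path_def)

lemma path_0: "f 0 = 0" "g 0 = 0"
  using nice by (auto simp: nice_path_def)

text \<open>An integer-valued function that stays within 1/2 of its left limit is constant
  there.\<close>

lemma left_limit_const:
  assumes s: "0 < s"
  shows "\<exists>n b. 0 \<le> b \<and> b < s \<and> (\<forall>x. b < x \<longrightarrow> x < s \<longrightarrow> f x = real n) \<and> Lim (at_left s) f = real n"
proof -
  obtain l where l: "(f \<longlongrightarrow> l) (at_left s)" using nice s by (auto simp: nice_path_def)
  then have "eventually (\<lambda>x. dist (f x) l < 1 / 2) (at_left s)" by (rule tendstoD) simp
  then obtain b' where b': "b' < s" "\<And>x. b' < x \<Longrightarrow> x < s \<Longrightarrow> dist (f x) l < 1 / 2"
    by (auto simp: eventually_at_left_field)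
  define b where "b = max 0 b'"
  have b: "0 \<le> b" "b < s" using b' s by (auto simp: b_def)
  define x0 where "x0 = (b + s) / 2"
  have x0: "b < x0" "x0 < s" using b by (auto simp: x0_def)
  obtain n where n: "f x0 = real n" using path_Nats[of x0] x0 b by auto
  have c: "f x = real n" if "b < x" "x < s" for x
  proof -
    have "0 \<le> x" using that b by linarith
    then obtain m where m: "f x = real m" using path_Nats by blast
    have "dist (f x) l < 1 / 2" "dist (f x0) l < 1 / 2" using b' that x0 by (auto simp: b_def)
    then have "\<bar>real m - real n\<bar> < 1" unfolding m n dist_real_def by linarith
    then have "m = n" by linarith
    then show ?thesis using m by simp
  qed
  have "eventually (\<lambda>x. f x = real n) (at_left s)"
    using b(2) c by (auto simp: eventually_at_left_field)
  then have "(f \<longlongrightarrow> real n) (at_left s)" by (rule tendsto_eventually)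
  then have "Lim (at_left s) f = real n" by (rule tendsto_Lim[rotated]) simp
  with b c show ?thesis by blast
qed

lemma stieltjes_integral_eq_path_integral:
  assumes "c > 0"
  shows "stieltjes_integral c f g t = path_integral (1 / c) f g t"
  unfolding stieltjes_integral_def path_integral_def
proof (rule set_lebesgue_integral_cong)
  show "\<forall>s. s \<in> {0<..t} \<longrightarrow> c powr - Lim (at_left s) f = wgt (1 / c) (Lim (at_left s) f)"
  proof safe
    fix s :: real assume "s \<in> {0<..t}"
    then obtain n where "Lim (at_left s) f = real n" using left_limit_const[of s] by auto
    then show "c powr - Lim (at_left s) f = wgt (1 / c) (Lim (at_left s) f)"
      using assms by (simp add: powr_minus powr_realpow power_one_over inverse_eq_divide)
  qed
qed simp

abbreviation (input) "G \<equiv> \<lambda>s. g (max s 0)"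
abbreviation (input) "\<mu>g \<equiv> interval_measure G"

lemma G_mono: "x \<le> y \<Longrightarrow> G x \<le> G y"
  by (rule path_mono) auto

lemma G_right_cont: "continuous (at_right a) G"
proof (cases "a \<ge> 0")
  case True
  have "(g \<longlongrightarrow> g a) (at_right a)" using nice True by (auto simp: nice_path_def)
  moreover have "eventually (\<lambda>x. g x = G x) (at_right a)"
    using True by (auto simp: eventually_at_right_field intro!: exI[of _ "a + 1"])
  ultimately have "(G \<longlongrightarrow> g a) (at_right a)" by (rule Lim_transform_eventually)
  then show ?thesis using True by (simp add: continuous_within max_absorb1)
next
  case False
  have "eventually (\<lambda>x. G x = g 0) (at_right a)"
    using False by (auto simp: eventually_at_right_field intro!: exI[of _ 0])
  then have "(G \<longlongrightarrow> g 0) (at_right a)" by (rule tendsto_eventually)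
  then show ?thesis using False by (simp add: continuous_within max_absorb2)
qed

lemma measure_G: "0 \<le> a \<Longrightarrow> a \<le> b \<Longrightarrow> measure \<mu>g {a<..b} = g b - g a"
  "0 \<le> a \<Longrightarrow> a \<le> b \<Longrightarrow> emeasure \<mu>g {a<..b} < \<infinity>"
  using measure_interval_measure_Ioc[of a b G] emeasure_interval_measure_Ioc[of a b G] G_mono G_right_cont
  by auto

lemma integrable_indicator_G: "0 \<le> a \<Longrightarrow> integrable \<mu>g (indicator {a<..b} :: real \<Rightarrow> real)"
proof (cases "a \<le> b")
  case True
  assume "0 \<le> a" 
  then show ?thesis using measure_G(2)[of a b] True by (subst integrable_indicator_iff) auto
qed simp

section \<open>Dyadic Riemann sums and their limits\<close>

definition step_fun :: "real \<Rightarrow> real \<Rightarrow> nat \<Rightarrow> real \<Rightarrow> real" where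
  "step_fun \<theta> h K s = (\<Sum>k<K. wgt \<theta> (f (real k * h)) * indicator {real k * h<..real (Suc k) * h} s)"

lemma integral_step_fun:
  assumes h: "0 < h"
  shows "(\<integral>s. step_fun \<theta> h K s \<partial>\<mu>g) = riemann_sum \<theta> f g h K"
proof -
  have "(\<integral>s. step_fun \<theta> h K s \<partial>\<mu>g) = (\<Sum>k<K. wgt \<theta> (f (real k * h)) * measure \<mu>g {real k * h<..real (Suc k) * h})"
    unfolding step_fun_def using h
    by (subst Bochner_Integration.integral_sum)
      (auto intro!: integrable_mult_right integrable_indicator_G simp del: of_nat_Suc)
  also have "\<dots> = riemann_sum \<theta> f g h K"
    unfolding riemann_sum_def using h by (intro sum.cong refl arg_cong2[where f = "(*)"] measure_G(1)) auto
  finally show ?thesis .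
qed

lemma step_fun_eq:
  assumes h: "0 < h" and s: "0 < s" "s \<le> real K * h"
  obtains k where "step_fun \<theta> h K s = wgt \<theta> (f (real k * h))" "real k * h < s" "s \<le> real k * h + h"
proof -
  \<comment> \<open>The cells are open on the left, so the cell of \<open>s\<close> comes from the
    ceiling; its left endpoint lies strictly before \<open>s\<close>, and in the limit it sees the
    left limit of f.\<close>
  define k where "k = nat (\<lceil>s / h\<rceil> - 1)"
  have "\<lceil>s / h\<rceil> \<ge> 1" using s h by (simp add: less_ceiling_iff one_le_ceiling)
  then have rk: "real k = real_of_int \<lceil>s / h\<rceil> - 1" by (simp add: k_def)
  have k: "real k < s / h" "s / h \<le> real k + 1"
    unfolding rk by linarith+
  have iff: "s \<in> {real j * h<..real (Suc j) * h} \<longleftrightarrow> j = k" for j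
  proof -
    have "s \<in> {real j * h<..real (Suc j) * h} \<longleftrightarrow> real j < s / h \<and> s / h \<le> real j + 1"
      using h by (auto simp: field_simps)
    also have "\<dots> \<longleftrightarrow> j = k" using k by auto
    finally show ?thesis .
  qed
  have "s / h \<le> real K" using s h by (simp add: field_simps)
  with k have "k < K" by linarith
  then have "step_fun \<theta> h K s = wgt \<theta> (f (real k * h))"
    unfolding step_fun_def indicator_def[abs_def] iff by (simp add: if_distrib cong: if_cong)
  moreover have "real k * h < s" "s \<le> real k * h + h" using k h by (auto simp: field_simps)
  ultimately show ?thesis using that by blast
qed

lemma step_fun_eq_0:
  assumes h: "0 < h" and s: "s \<le> 0 \<or> real K * h < s"
  shows "step_fun \<theta> h K s = 0"
  unfolding step_fun_def
proof (intro sum.neutral ballI)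
  fix k assume "k \<in> {..<K}"
  then have "real (Suc k) * h \<le> real K * h" "0 \<le> real k * h" using h by (auto simp: mult_right_mono simp del: of_nat_Suc)
  then have "s \<notin> {real k * h<..real (Suc k) * h}" using s by auto
  then show "wgt \<theta> (f (real k * h)) * indicator {real k * h<..real (Suc k) * h} s = 0" by simp
qed

context
  fixes \<theta> :: real assumes th: "0 \<le> \<theta>" "\<theta> \<le> 1"
begin

lemma step_fun_tendsto:
  "(\<lambda>m. step_fun \<theta> (1 / 2 ^ m) (t * 2 ^ m) s) \<longlonglongrightarrow> indicator {0<..real t} s * wgt \<theta> (Lim (at_left s) f)"
proof (cases "s \<in> {0<..real t}")
  case True
  then obtain n b where nb: "0 \<le> b" "b < s" "\<And>x. b < x \<Longrightarrow> x < s \<Longrightarrow> f x = real n" "Lim (at_left s) f = real n"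
    using left_limit_const[of s] by auto
  have "(\<lambda>m. (1 / 2) ^ m :: real) \<longlonglongrightarrow> 0" by (rule LIMSEQ_power_zero) simp
  then have "eventually (\<lambda>m. (1 / 2) ^ m < s - b) sequentially"
    using nb by (intro order_tendstoD) auto
  then have "eventually (\<lambda>m. step_fun \<theta> (1 / 2 ^ m) (t * 2 ^ m) s = wgt \<theta> (real n)) sequentially"
  proof eventually_elim
    case (elim m)
    obtain k where k: "step_fun \<theta> (1 / 2 ^ m) (t * 2 ^ m) s = wgt \<theta> (f (real k * (1 / 2 ^ m)))"
      "real k * (1 / 2 ^ m) < s" "s \<le> real k * (1 / 2 ^ m) + 1 / 2 ^ m"
      by (rule step_fun_eq[of "1 / 2 ^ m" s "t * 2 ^ m"]) (use True in auto)
    have "b < real k * (1 / 2 ^ m)" using k(3) elim by (simp add: power_one_over)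
    then show ?case using k nb(3) by simp
  qed
  then show ?thesis using True nb(4) by (simp add: tendsto_eventually)
next
  case False
  then have "step_fun \<theta> (1 / 2 ^ m) (t * 2 ^ m) s = 0" for m
    by (intro step_fun_eq_0) auto
  then show ?thesis using False by simp
qed

lemma step_fun_le: "norm (step_fun \<theta> (1 / 2 ^ m) (t * 2 ^ m) s) \<le> indicator {0<..real t} s"
proof (cases "s \<in> {0<..real t}")
  case True
  obtain k where "step_fun \<theta> (1 / 2 ^ m) (t * 2 ^ m) s = wgt \<theta> (f (real k * (1 / 2 ^ m)))"
    by (rule step_fun_eq[of "1 / 2 ^ m" s "t * 2 ^ m"]) (use True in auto)
  then show ?thesis using True wgt_bounds[OF th] by simp
next
  case False
  then have "step_fun \<theta> (1 / 2 ^ m) (t * 2 ^ m) s = 0"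
    by (intro step_fun_eq_0) auto
  then show ?thesis by simp
qed

lemma measurable_step_fun: "step_fun \<theta> h K \<in> borel_measurable \<mu>g"
  unfolding step_fun_def by measurable

text \<open>Measurability of the left-limit integrand is inherited from the step functions that
  converge to it.\<close>

lemma measurable_weight_nat: "(\<lambda>s. indicator {0<..real t} s * wgt \<theta> (Lim (at_left s) f)) \<in> borel_measurable \<mu>g"
  by (rule borel_measurable_LIMSEQ_real[OF step_fun_tendsto measurable_step_fun])

lemma riemann_sum_tendsto:
  "(\<lambda>m. riemann_sum \<theta> f g (1 / 2 ^ m) (t * 2 ^ m)) \<longlonglongrightarrow> path_integral \<theta> f g (real t)"
proof -
  have "(\<lambda>m. \<integral>s. step_fun \<theta> (1 / 2 ^ m) (t * 2 ^ m) s \<partial>\<mu>g) \<longlonglongrightarrow>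
    (\<integral>s. indicator {0<..real t} s * wgt \<theta> (Lim (at_left s) f) \<partial>\<mu>g)"
    by (rule integral_dominated_convergence[where w = "indicator {0<..real t}"])
      (auto intro!: step_fun_tendsto measurable_weight_nat measurable_step_fun step_fun_le[simplified] integrable_indicator_G)
  then show ?thesis
    by (simp add: integral_step_fun path_integral_def set_lebesgue_integral_def)
qed

lemma integrable_weight: "integrable \<mu>g (\<lambda>s. indicator {0<..t} s *\<^sub>R wgt \<theta> (Lim (at_left s) f))"
proof (rule Bochner_Integration.integrable_bound)
  show "integrable \<mu>g (indicator {0<..t} :: real \<Rightarrow> real)" by (rule integrable_indicator_G) simp
  obtain n where n: "t \<le> real n" using real_arch_simple by blast
  have "(\<lambda>s. indicator {0<..t} s * (indicator {0<..real n} s * wgt \<theta> (Lim (at_left s) f))) \<in> borel_measurable \<mu>g"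
    using measurable_weight_nat[of n] by measurable
  also have "(\<lambda>s. indicator {0<..t} s * (indicator {0<..real n} s * wgt \<theta> (Lim (at_left s) f))) =
    (\<lambda>s. indicator {0<..t} s *\<^sub>R wgt \<theta> (Lim (at_left s) f))"
    using n by (auto simp: indicator_def)
  finally show "(\<lambda>s. indicator {0<..t} s *\<^sub>R wgt \<theta> (Lim (at_left s) f)) \<in> borel_measurable \<mu>g" .
qed (use wgt_bounds[OF th] in \<open>auto simp: indicator_def\<close>)

lemma path_integral_mono: "t \<le> t' \<Longrightarrow> path_integral \<theta> f g t \<le> path_integral \<theta> f g t'"
  unfolding path_integral_def set_lebesgue_integral_def
  by (rule integral_mono[OF integrable_weight integrable_weight])
    (use wgt_bounds[OF th] in \<open>auto simp: indicator_def\<close>)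

lemma path_integral_nonneg: "0 \<le> path_integral \<theta> f g t"
  unfolding path_integral_def set_lebesgue_integral_def
  by (rule Bochner_Integration.integral_nonneg) (use wgt_bounds[OF th] in auto)

text \<open>Monotonicity squeezes real times between consecutive integers, so the limit along the
  integers suffices.\<close>

lemma Lim_path_integral:
  assumes "(\<lambda>n. path_integral \<theta> f g (real n)) \<longlonglongrightarrow> L"
  shows "Lim at_top (path_integral \<theta> f g) = L"
proof -
  have "(path_integral \<theta> f g \<longlongrightarrow> L) at_top"
  proof (rule tendsto_sandwich)
    show "((\<lambda>t. path_integral \<theta> f g (real (nat \<lfloor>t\<rfloor>))) \<longlongrightarrow> L) at_top"
      by (rule filterlim_compose[OF assms filterlim_compose[OF filterlim_nat_sequentially filterlim_floor_sequentially]])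
    show "((\<lambda>t. path_integral \<theta> f g (real (nat \<lfloor>t\<rfloor> + 1))) \<longlongrightarrow> L) at_top"
      by (rule filterlim_compose[OF LIMSEQ_ignore_initial_segment[OF assms, of 1] filterlim_compose[OF filterlim_nat_sequentially filterlim_floor_sequentially]])
    show "\<forall>\<^sub>F t in at_top. path_integral \<theta> f g (real (nat \<lfloor>t\<rfloor>)) \<le> path_integral \<theta> f g t"
      using eventually_ge_at_top[of 0] by eventually_elim (auto intro!: path_integral_mono)
    show "\<forall>\<^sub>F t in at_top. path_integral \<theta> f g t \<le> path_integral \<theta> f g (real (nat \<lfloor>t\<rfloor> + 1))"
      by (intro always_eventually allI path_integral_mono) linarith
  qed
  then show ?thesis by (rule tendsto_Lim[rotated]) simp
qed

end

text \<open>With weight 0^N(s-) only times up to and including the first jump time T count: the left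
  limit at T is still 0, so a jump of g at T is included and the integral is g T.\<close>

lemma Lim_path_integral_0:
  assumes "0 \<le> t1" "f t1 \<noteq> 0"
  shows "Lim at_top (path_integral 0 f g) = g (first_jump_time f)"
proof -
  define A where "A = {t. 0 \<le> t \<and> f t \<noteq> 0}"
  define T where "T = Inf A"
  have A: "A \<noteq> {}" "bdd_below A" using assms by (auto simp: A_def)
  have T0: "0 \<le> T" unfolding T_def using A by (intro cInf_greatest) (auto simp: A_def)
  have below: "f t = 0" if "0 \<le> t" "t < T" for t
    using that cInf_lower[OF _ A(2), of t] by (auto simp: T_def A_def)
  \<comment> \<open>The infimum is attained: otherwise right-continuity and integer values would
    keep f at 0 beyond T.\<close>
  have fT: "f T \<noteq> 0"
  proof
    assume "f T = 0"
    then have "(f \<longlongrightarrow> 0) (at_right T)" using nice T0 by (auto simp: nice_path_def)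
    then have "eventually (\<lambda>x. dist (f x) 0 < 1) (at_right T)" by (rule tendstoD) simp
    then obtain b where b: "b > T" "\<And>x. T < x \<Longrightarrow> x < b \<Longrightarrow> dist (f x) 0 < 1"
      by (auto simp: eventually_at_right_field)
    obtain x where x: "x \<in> A" "x < b" using cInf_less_iff[OF A, of b] b(1) by (auto simp: T_def)
    have "T \<le> x" unfolding T_def using x A by (intro cInf_lower)
    moreover have "x \<noteq> T" using x \<open>f T = 0\<close> by (auto simp: A_def)
    ultimately have "dist (f x) 0 < 1" using b x by auto
    moreover obtain n where "f x = real n" using path_Nats[of x] x by (auto simp: A_def)
    ultimately show False using x by (auto simp: A_def)
  qed
  then have Tpos: "0 < T" using T0 path_0 by (cases "T = 0") auto
  have above: "f t \<ge> 1" if "T \<le> t" for t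
  proof -
    obtain n where "f T = real n" using path_Nats[of T] T0 by auto
    then show ?thesis using fT path_mono(1)[of T t] T0 that by simp
  qed
  have fj: "first_jump_time f = T"
    unfolding first_jump_time_def
  proof (rule cInf_eq_minimum)
    have "eventually (\<lambda>x. f x = 0) (at_left T)"
      using Tpos below by (auto simp: eventually_at_left_field intro!: exI[of _ 0])
    then have "(f \<longlongrightarrow> 0) (at_left T)" by (rule tendsto_eventually)
    then have "\<not> (f \<longlongrightarrow> f T) (at_left T)"
      using fT tendsto_unique[of "at_left T" f 0 "f T"] by auto
    then show "T \<in> {t. 0 < t \<and> \<not> (f \<longlongrightarrow> f t) (at_left t)}" using Tpos by simp
    fix t assume t: "t \<in> {t. 0 < t \<and> \<not> (f \<longlongrightarrow> f t) (at_left t)}"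
    show "T \<le> t"
    proof (rule ccontr)
      assume "\<not> T \<le> t"
      then have "eventually (\<lambda>x. f x = f t) (at_left t)"
        using t below by (auto simp: eventually_at_left_field intro!: exI[of _ 0])
      then show False using t by (auto intro: tendsto_eventually)
    qed
  qed
  have left: "indicator {0<..t} s *\<^sub>R wgt 0 (Lim (at_left s) f) = indicator {0<..T} s" if "T \<le> t" for s t
  proof (cases "0 < s")
    case True
    obtain n b where nb: "0 \<le> b" "b < s" "\<And>x. b < x \<Longrightarrow> x < s \<Longrightarrow> f x = real n" "Lim (at_left s) f = real n"
      using left_limit_const[OF True] by auto
    \<comment> \<open>A sample point in the interval to the left of \<open>s\<close> where f is
      constant, chosen beyond T if \<open>s\<close> is.\<close>
    define x where "x = (max b (if T < s then T else 0) + s) / 2"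
    have x: "b < x" "x < s" "T < s \<Longrightarrow> T < x" using nb True by (auto simp: x_def)
    have "n = 0 \<longleftrightarrow> s \<le> T"
      using nb(3)[OF x(1,2)] below[of x] above[of x] x nb(1) by (cases "T < s") auto
    then show ?thesis using nb(4) True that by (auto simp: indicator_def power_0_left)
  qed simp
  have "path_integral 0 f g t = g T" if "T \<le> t" for t
    unfolding path_integral_def set_lebesgue_integral_def left[OF that]
    using measure_G(1)[of 0 T] T0 path_0 by simp
  then have "eventually (\<lambda>t. path_integral 0 f g t = g T) at_top"
    by (auto intro: eventually_mono[OF eventually_ge_at_top[of T]])
  then have "(path_integral 0 f g \<longlongrightarrow> g T) at_top" by (rule tendsto_eventually)
  then show ?thesis unfolding fj by (rule tendsto_Lim[rotated]) simp
qed

end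

section \<open>The compound Poisson process\<close>

text \<open>The set on which \<open>f\<close> and \<open>g\<close> disagree about membership in A is
  contained in a null set, hence measurable in the completion. This lets the pathwise functionals be
  replaced by honest random variables.\<close>

lemma measurable_completion_AE:
  fixes f g :: "'a \<Rightarrow> real"
  assumes g: "g \<in> borel_measurable M" and ae: "AE x in M. f x = g x"
  shows "f \<in> borel_measurable (completion M)"
proof (rule measurableI)
  fix A :: "real set" assume A: "A \<in> sets borel"
  have g': "g \<in> borel_measurable (completion M)" using g by (rule measurable_completion)
  have "AE x in M. \<not> ((f x \<in> A) \<noteq> (g x \<in> A))" using ae by eventually_elim simp
  from sets_completion_AE[OF this]
  have P: "{x \<in> space M. (f x \<in> A) \<noteq> (g x \<in> A)} \<in> sets (completion M)"
    by (simp add: pred_def)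
  have Q: "g -` A \<inter> space M \<in> sets (completion M)"
    using measurable_sets[OF g' A] by simp
  have "f -` A \<inter> space (completion M) =
    (g -` A \<inter> space M - {x \<in> space M. (f x \<in> A) \<noteq> (g x \<in> A)}) \<union> ({x \<in> space M. (f x \<in> A) \<noteq> (g x \<in> A)} - g -` A \<inter> space M)"
    by auto
  then show "f -` A \<inter> space (completion M) \<in> sets (completion M)"
    using P Q by auto
qed simp

lemma distr_completion_AE:
  fixes f g :: "'a \<Rightarrow> real"
  assumes g: "g \<in> borel_measurable M" and ae: "AE x in M. f x = g x"
  shows "distr (completion M) borel f = distr M borel g"
proof -
  have "distr (completion M) borel f = distr (completion M) borel g"
    using ae by (intro distr_cong_AE measurable_completion_AE[OF g ae] measurable_completion[OF g] AE_completion) auto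
  then show ?thesis using g by (simp add: distr_completion)
qed

section \<open>The pair (N, L) at a fixed time, modelled by three Poisson counts\<close>

text \<open>The components stand for the numbers of jumps (1, 0), (0, 1) and (1, \<alpha>). In this
  model N is the sum of the first and third, and L is the second plus \<alpha> times the
  third.\<close>

definition pois3 :: "real \<Rightarrow> real \<Rightarrow> real \<Rightarrow> (nat \<times> nat \<times> nat) measure" where
  "pois3 a b c = measure_pmf (pois a) \<Otimes>\<^sub>M (measure_pmf (pois b) \<Otimes>\<^sub>M measure_pmf (pois c))"

lemma prob_space_pois3: "prob_space (pois3 a b c)"
  unfolding pois3_def
  by (intro prob_space_pair prob_space_measure_pmf)

lemma measurable_pois3 [measurable]:
  "fst \<in> measurable (pois3 a b c) (count_space UNIV)"
  "(\<lambda>x. fst (snd x)) \<in> measurable (pois3 a b c) (count_space UNIV)"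
  "(\<lambda>x. snd (snd x)) \<in> measurable (pois3 a b c) (count_space UNIV)"
proof -
  have 1: "fst \<in> measurable (pois3 a b c) (measure_pmf (pois a))"
    "(\<lambda>x. fst (snd x)) \<in> measurable (pois3 a b c) (measure_pmf (pois b))"
    "(\<lambda>x. snd (snd x)) \<in> measurable (pois3 a b c) (measure_pmf (pois c))"
    unfolding pois3_def by measurable
  then show "fst \<in> measurable (pois3 a b c) (count_space UNIV)"
    "(\<lambda>x. fst (snd x)) \<in> measurable (pois3 a b c) (count_space UNIV)"
    "(\<lambda>x. snd (snd x)) \<in> measurable (pois3 a b c) (count_space UNIV)" by simp_all
qed

lemma pois3_prod:
  fixes f g h :: "nat \<Rightarrow> complex"
  assumes "\<And>x. cmod (f x) \<le> 1" "\<And>x. cmod (g x) \<le> 1" "\<And>x. cmod (h x) \<le> 1"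
  shows "(CLINT x|pois3 a b c. f (fst x) * (g (fst (snd x)) * h (snd (snd x)))) =
    (CLINT k|measure_pmf (pois a). f k) * ((CLINT k|measure_pmf (pois b). g k) * (CLINT k|measure_pmf (pois c). h k))"
proof -
  have "(CLINT x|pois3 a b c. f (fst x) * (g (fst (snd x)) * h (snd (snd x)))) =
    (CLINT k|measure_pmf (pois a). f k) * (CLINT x|measure_pmf (pois b) \<Otimes>\<^sub>M measure_pmf (pois c). g (fst x) * h (snd x))"
    unfolding pois3_def
    by (rule integral_pair_mult[where f = f and g = "\<lambda>x. g (fst x) * h (snd x)"])
      (use assms in \<open>auto intro!: prob_space_pair prob_space_measure_pmf mult_le_one simp: norm_mult\<close>)
  also have "(CLINT x|measure_pmf (pois b) \<Otimes>\<^sub>M measure_pmf (pois c). g (fst x) * h (snd x)) =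
    (CLINT k|measure_pmf (pois b). g k) * (CLINT k|measure_pmf (pois c). h k)"
    by (rule integral_pair_mult) (use assms in \<open>auto intro!: prob_space_measure_pmf\<close>)
  finally show ?thesis .
qed

lemma pois3_char:
  assumes "0 \<le> a" "0 \<le> b" "0 \<le> c"
  shows "(CLINT x|pois3 a b c. iexp (y * real (fst x + snd (snd x)) + z * (real (fst (snd x)) + \<alpha> * real (snd (snd x))))) =
    exp (of_real a * (iexp y - 1) + of_real b * (iexp z - 1) + of_real c * (iexp (y + \<alpha> * z) - 1))"
proof -
  have "(CLINT x|pois3 a b c. iexp (y * real (fst x + snd (snd x)) + z * (real (fst (snd x)) + \<alpha> * real (snd (snd x))))) =
    (CLINT x|pois3 a b c. iexp (y * real (fst x)) * (iexp (z * real (fst (snd x))) * iexp ((y + \<alpha> * z) * real (snd (snd x)))))"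
    by (rule Bochner_Integration.integral_cong) (simp_all add: exp_add[symmetric] algebra_simps)
  also have "\<dots> = exp (of_real a * (iexp y - 1)) * (exp (of_real b * (iexp z - 1)) * exp (of_real c * (iexp (y + \<alpha> * z) - 1)))"
    unfolding pois_char[OF assms(1), symmetric] pois_char[OF assms(2), symmetric] pois_char[OF assms(3), symmetric]
    by (rule pois3_prod) auto
  finally show ?thesis by (simp add: exp_add)
qed

text \<open>Averaging \<open>exp (2 \<pi> i j x / n)\<close> over \<open>j < n\<close> gives the indicator of \<open>n dvd x\<close>,
  which tends to the indicator of \<open>x = 0\<close>.\<close>

lemma sum_roots_of_unity:
  assumes n: "0 < n"
  shows "(\<Sum>j<n. iexp (2 * pi * real j / real n * real x)) / of_nat n = (if n dvd x then 1 else 0)"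
proof -
  define w where "w = iexp (2 * pi * real x / real n)"
  have *: "iexp (2 * pi * real j / real n * real x) = w ^ j" for j
    unfolding w_def by (simp add: exp_of_nat_mult[symmetric] ac_simps)
  have wn: "w ^ n = 1"
  proof -
    have "w ^ n = exp (\<i> * of_real (2 * pi * real x))"
      unfolding w_def using n by (simp add: exp_of_nat_mult[symmetric] ac_simps)
    also have "\<dots> = exp (of_nat x * (2 * of_real pi * \<i>))" by (simp add: ac_simps)
    also have "\<dots> = 1" by (simp only: exp_of_nat_mult exp_two_pi_i power_one)
    finally show ?thesis .
  qed
  have w1: "w = 1 \<longleftrightarrow> n dvd x"
  proof
    assume "w = 1"
    then obtain k :: int where "2 * pi * real x / real n = of_int (2 * k) * pi"
      unfolding w_def by (auto simp: exp_eq_1)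
    then have "real x = of_int k * real n" using n by (simp add: field_simps)
    then have "int x = k * int n" by (metis of_int_eq_iff of_int_mult of_int_of_nat_eq)
    then show "n dvd x" by (metis dvd_triv_right int_dvd_int_iff)
  next
    assume "n dvd x"
    then obtain k where "x = n * k" ..
    then have "w = exp (of_nat k * (2 * of_real pi * \<i>))"
      unfolding w_def using n by (simp add: ac_simps)
    then show "w = 1" by (simp only: exp_of_nat_mult exp_two_pi_i power_one)
  qed
  show ?thesis
  proof (cases "n dvd x")
    case True
    then show ?thesis unfolding * using w1 n by simp
  next
    case False
    then have "(\<Sum>j<n. w ^ j) = 0" using w1 wn by (simp add: geometric_sum)
    then show ?thesis unfolding * using False by simp
  qed
qed

text \<open>The left side involves the joint characteristic function only. Two pairs with the same
  joint characteristic function therefore have the same expectation on X = 0, which allows the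
  computation to be done in an explicit model.\<close>

lemma expectation_zero_tendsto:
  fixes X Y :: "'a \<Rightarrow> real"
  assumes "prob_space M" and [measurable]: "X \<in> borel_measurable M" "Y \<in> borel_measurable M"
    and nat: "AE \<omega> in M. X \<omega> \<in> \<nat>"
  shows "(\<lambda>n. (\<Sum>j<Suc n. CLINT \<omega>|M. iexp (2 * pi * real j / real (Suc n) * X \<omega> + z * Y \<omega>)) / of_nat (Suc n))
     \<longlonglongrightarrow> (CLINT \<omega>|M. iexp (z * Y \<omega>) * indicator {0} (X \<omega>))"
proof -
  interpret prob_space M by fact
  define D where "D n x = (\<Sum>j<Suc n. iexp (2 * pi * real j / real (Suc n) * x)) / of_nat (Suc n)" for n x
  have Dm[measurable]: "(\<lambda>\<omega>. D n (X \<omega>)) \<in> borel_measurable M" for n unfolding D_def by measurable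
  have int: "integrable M (\<lambda>\<omega>. iexp (2 * pi * real j / real (Suc n) * X \<omega> + z * Y \<omega>))" for j n
    by (rule integrable_const_bound[where B = 1]) auto
  have "(CLINT \<omega>|M. iexp (z * Y \<omega>) * D n (X \<omega>)) =
    (\<Sum>j<Suc n. CLINT \<omega>|M. iexp (2 * pi * real j / real (Suc n) * X \<omega> + z * Y \<omega>)) / of_nat (Suc n)" for n
  proof -
    have "(CLINT \<omega>|M. iexp (z * Y \<omega>) * D n (X \<omega>)) =
      (CLINT \<omega>|M. (\<Sum>j<Suc n. iexp (2 * pi * real j / real (Suc n) * X \<omega> + z * Y \<omega>)) / of_nat (Suc n))"
      unfolding D_def
      by (rule Bochner_Integration.integral_cong)
        (simp_all only: sum_distrib_left sum_distrib_right times_divide_eq_right exp_add of_real_add distrib_left mult.commute[of "iexp (z * _)"])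
    also have "\<dots> = (CLINT \<omega>|M. (\<Sum>j<Suc n. iexp (2 * pi * real j / real (Suc n) * X \<omega> + z * Y \<omega>))) / of_nat (Suc n)"
      by (rule integral_divide_zero)
    finally show ?thesis by (subst (asm) Bochner_Integration.integral_sum[OF int])
  qed
  moreover have "(\<lambda>n. CLINT \<omega>|M. iexp (z * Y \<omega>) * D n (X \<omega>)) \<longlonglongrightarrow> (CLINT \<omega>|M. iexp (z * Y \<omega>) * indicator {0} (X \<omega>))"
  proof (rule integral_dominated_convergence[where w = "\<lambda>_. 1"])
    have Dn: "D n (real k) = (if Suc n dvd k then 1 else 0)" for n k
      unfolding D_def using sum_roots_of_unity[of "Suc n" k] by simp
    show "AE \<omega> in M. (\<lambda>n. iexp (z * Y \<omega>) * D n (X \<omega>)) \<longlonglongrightarrow> iexp (z * Y \<omega>) * indicator {0} (X \<omega>)"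
      using nat
    proof eventually_elim
      case (elim \<omega>)
      then obtain k where k: "X \<omega> = real k" by (auto simp: Nats_def)
      \<comment> \<open>Every \<open>Suc n\<close> divides 0, and none with n \<ge> k divides a
        positive k.\<close>
      have "eventually (\<lambda>n. D n (real k) = indicator {0} (real k)) sequentially"
        using eventually_ge_at_top[of k]
        by eventually_elim (cases "k = 0"; auto simp: Dn Dn[of _ 0, simplified] indicator_def dest: dvd_imp_le)
      then show ?case unfolding k by (intro tendsto_mult tendsto_const tendsto_eventually)
    qed
    show "AE \<omega> in M. norm (iexp (z * Y \<omega>) * D n (X \<omega>)) \<le> 1" for n
      using nat by eventually_elim (auto simp: Nats_def Dn norm_mult)
  qed auto
  ultimately show ?thesis by simp
qed

text \<open>Rational times involve countably many null sets only. Right-continuity extends the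
  properties to all times, because the naturals are closed and weak inequalities survive
  limits.\<close>

lemma nice_pathI_rat:
  fixes f g :: "real \<Rightarrow> real"
  assumes "f 0 = 0" "g 0 = 0"
    and N: "\<And>s. s \<in> \<rat> \<Longrightarrow> 0 \<le> s \<Longrightarrow> f s \<in> \<nat>"
    and mono: "\<And>s t. s \<in> \<rat> \<Longrightarrow> t \<in> \<rat> \<Longrightarrow> 0 \<le> s \<Longrightarrow> s \<le> t \<Longrightarrow> f s \<le> f t \<and> g s \<le> g t"
    and cad: "cadlag (\<lambda>t. (f t, g t))"
  shows "nice_path f g"
proof -
  have rf: "(f \<longlongrightarrow> f t) (at_right t)" and rg: "(g \<longlongrightarrow> g t) (at_right t)" if "0 \<le> t" for t
    using cad that unfolding cadlag_def by (auto dest!: spec[of _ t] dest: tendsto_fst tendsto_snd)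
  have ll: "\<exists>l. (f \<longlongrightarrow> l) (at_left t)" if "0 < t" for t
  proof -
    obtain l where "((\<lambda>t. (f t, g t)) \<longlongrightarrow> l) (at_left t)" using cad \<open>0 < t\<close> unfolding cadlag_def by blast
    from tendsto_fst[OF this] show ?thesis by auto
  qed
  have ratR: "\<exists>q\<in>\<rat>. t < q \<and> q < b \<and> P q" if ev: "eventually P (at_right t)" and b: "t < b" for P and t b :: real
  proof -
    obtain b' where b': "t < b'" "\<And>x. t < x \<Longrightarrow> x < b' \<Longrightarrow> P x"
      using ev by (auto simp: eventually_at_right_field)
    have "t < min b b'" using b b' by simp
    from Rats_dense_in_real[OF this] show ?thesis using b'(2) by auto
  qed
  have fN: "f t \<in> \<nat>" if t: "0 \<le> t" for t
  proof (rule ccontr)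
    assume "f t \<notin> \<nat>"
    then have "f t \<in> - \<nat>" by simp
    then have "eventually (\<lambda>x. f x \<in> - \<nat>) (at_right t)"
      by (intro topological_tendstoD[OF rf[OF t]]) (auto simp: open_Compl)
    from ratR[OF this, of "t + 1"] t N show False by force
  qed
  have mono': "h s \<le> h t" if st: "0 \<le> s" "s \<le> t" 
    and rh: "\<And>t. 0 \<le> t \<Longrightarrow> (h \<longlongrightarrow> h t) (at_right t)"
    and mh: "\<And>s t. s \<in> \<rat> \<Longrightarrow> t \<in> \<rat> \<Longrightarrow> 0 \<le> s \<Longrightarrow> s \<le> t \<Longrightarrow> h s \<le> h t" for h :: "real \<Rightarrow> real" and s t
  proof (rule ccontr)
    assume "\<not> h s \<le> h t"
    then have lt: "h t < h s" and "s \<noteq> t" by auto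
    then have st': "s < t" using st by simp
    define y where "y = (h s + h t) / 2"
    have y: "h t < y" "y < h s" using lt by (auto simp: y_def)
    have "eventually (\<lambda>x. y < h x) (at_right s)" by (rule order_tendstoD(1)[OF rh[OF st(1)] y(2)])
    from ratR[OF this st'] obtain a where a: "a \<in> \<rat>" "s < a" "a < t" "y < h a" by blast
    have "eventually (\<lambda>x. h x < y) (at_right t)" by (rule order_tendstoD(2)[OF rh y(1)]) (use st in simp)
    from ratR[OF this, of "t + 1"] obtain b where b: "b \<in> \<rat>" "t < b" "h b < y" by auto
    have "h a \<le> h b" using a b st by (intro mh) auto
    then show False using a b by simp
  qed
  show ?thesis unfolding nice_path_def
    using assms(1,2) fN mono'[of _ _ f, OF _ _ rf] mono'[of _ _ g, OF _ _ rg] mono rf rg ll by auto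
qed

lemma borel_measurable_fst_real [measurable]: "(fst :: real \<times> real \<Rightarrow> real) \<in> borel_measurable borel"
  and borel_measurable_snd_real [measurable]: "(snd :: real \<times> real \<Rightarrow> real) \<in> borel_measurable borel"
  by (intro borel_measurable_continuous_onI continuous_intros)+

section \<open>Riemann sums as functions of increments\<close>

text \<open>The Horner form of the Riemann sum, where \<open>x i\<close> is the i-th increment of
  (N, L). It isolates the first increment, on which the conditioning takes place.\<close>

fun incr_sum :: "real \<Rightarrow> (nat \<Rightarrow> real \<times> real) \<Rightarrow> nat \<Rightarrow> nat \<Rightarrow> real" where
  "incr_sum \<theta> x i 0 = 0"
| "incr_sum \<theta> x i (Suc j) = snd (x i) + wgt \<theta> (fst (x i)) * incr_sum \<theta> x (Suc i) j"

lemma incr_sum_cong: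
  "(\<And>k. i \<le> k \<Longrightarrow> k < i + j \<Longrightarrow> x k = y k) \<Longrightarrow> incr_sum \<theta> x i j = incr_sum \<theta> y i j"
  by (induction j arbitrary: i) auto

lemma measurable_incr_sum:
  "{i..<i + j} \<subseteq> I \<Longrightarrow> (\<lambda>x. incr_sum \<theta> x i j) \<in> borel_measurable (Pi\<^sub>M I (\<lambda>_. borel))"
proof (induction j arbitrary: i)
  case (Suc j)
  have [measurable]: "(\<lambda>x. incr_sum \<theta> x (Suc i) j) \<in> borel_measurable (Pi\<^sub>M I (\<lambda>_. borel))"
    using Suc.prems by (intro Suc.IH) auto
  have [measurable]: "(\<lambda>x. x i) \<in> measurable (Pi\<^sub>M I (\<lambda>_. borel)) (borel :: (real \<times> real) measure)"
    using Suc.prems by (intro measurable_component_singleton) auto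
  show ?case by simp
qed simp

lemma incr_sum_eq_riemann_sum:
  assumes nice: "nice_path f g" and h: "0 \<le> h"
  shows "incr_sum \<theta> (\<lambda>k. (f (real (Suc k) * h) - f (real k * h), g (real (Suc k) * h) - g (real k * h))) 0 K =
    riemann_sum \<theta> f g h K"
proof -
  define x where "x k = (f (real (Suc k) * h) - f (real k * h), g (real (Suc k) * h) - g (real k * h))" for k
  \<comment> \<open>The weight accumulated since the earlier grid point i' is carried along to make
    the induction work. It is multiplicative because the increments of f are naturals.\<close>
  have *: "wgt \<theta> (f (real i * h) - f (real i' * h)) * incr_sum \<theta> x i j =
    (\<Sum>k<j. wgt \<theta> (f (real (i + k) * h) - f (real i' * h)) * snd (x (i + k)))" if "i' \<le> i" for i i' j
    using that
  proof (induction j arbitrary: i)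
    case (Suc j)
    have m: "f (real i' * h) \<le> f (real i * h)" "f (real i * h) \<le> f (real (Suc i) * h)"
      using Suc.prems h by (auto intro!: path_mono(1)[OF nice] mult_right_mono mult_nonneg_nonneg)
    obtain a b c where abc: "f (real i' * h) = real a" "f (real i * h) = real b" "f (real (Suc i) * h) = real c"
      using path_Nats[OF nice] h by (metis mult_nonneg_nonneg of_nat_0_le_iff)
    have d: "real b - real a = real (b - a)" "real c - real b = real (c - b)" "real c - real a = real (c - a)"
      using m unfolding abc by (auto simp: of_nat_diff)
    have "(b - a) + (c - b) = c - a" using m unfolding abc by simp
    then have w: "wgt \<theta> (f (real i * h) - f (real i' * h)) * wgt \<theta> (fst (x i)) = wgt \<theta> (f (real (Suc i) * h) - f (real i' * h))"
      unfolding x_def fst_conv abc d wgt_nat by (metis power_add)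
    have "wgt \<theta> (f (real i * h) - f (real i' * h)) * incr_sum \<theta> x i (Suc j) =
      wgt \<theta> (f (real i * h) - f (real i' * h)) * snd (x i) + wgt \<theta> (f (real (Suc i) * h) - f (real i' * h)) * incr_sum \<theta> x (Suc i) j"
      unfolding w[symmetric] by (simp add: distrib_left)
    also have "wgt \<theta> (f (real (Suc i) * h) - f (real i' * h)) * incr_sum \<theta> x (Suc i) j =
      (\<Sum>k<j. wgt \<theta> (f (real (Suc i + k) * h) - f (real i' * h)) * snd (x (Suc i + k)))"
      using Suc.prems by (intro Suc.IH) auto
    finally show ?case by (simp add: sum.lessThan_Suc_shift add_ac del: sum.lessThan_Suc)
  qed simp
  show ?thesis
    using *[of 0 0 K] path_0[OF nice] by (simp add: riemann_sum_def x_def[abs_def] wgt_def del: of_nat_Suc)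
qed

text \<open>All that is used about the process: the Levy property and the joint characteristic
  function, with \<alpha> standing for c^(-k).\<close>

locale biv = prob_space M for M :: "'a measure" +
  fixes N L :: "real \<Rightarrow> 'a \<Rightarrow> real" and u v w \<alpha> :: real
  assumes rate_pos: "0 < u" "0 < v" "0 < w" and alpha: "0 \<le> \<alpha>"
    and lp: "levy_process M (\<lambda>t \<omega>. (N t \<omega>, L t \<omega>))"
    and ch: "\<And>t y z. 0 \<le> t \<Longrightarrow> (CLINT \<omega>|M. iexp (y * N t \<omega> + z * L t \<omega>)) =
      exp (of_real t * (of_real u * (iexp y - 1) + of_real v * (iexp z - 1) + of_real w * (iexp (y + \<alpha> * z) - 1)))"
begin

lemma meas_pair: "0 \<le> t \<Longrightarrow> (\<lambda>\<omega>. (N t \<omega>, L t \<omega>)) \<in> borel_measurable M"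
  using lp unfolding levy_process_def by auto

lemma measN [measurable]: "0 \<le> t \<Longrightarrow> N t \<in> borel_measurable M"
  using measurable_compose[OF meas_pair borel_measurable_continuous_onI[OF continuous_on_fst[OF continuous_on_id]]] by simp

lemma measL [measurable]: "0 \<le> t \<Longrightarrow> L t \<in> borel_measurable M"
  using measurable_compose[OF meas_pair borel_measurable_continuous_onI[OF continuous_on_snd[OF continuous_on_id]]] by simp

lemma law_N: 
  assumes t: "0 \<le> t"
  shows "distr M borel (N t) = distr (measure_pmf (pois (t * (u + w)))) borel real"
proof (rule Levy_uniqueness)
  show "real_distribution (distr M borel (N t))" using t by (intro real_distribution_distr measN)
  show "real_distribution (distr (measure_pmf (pois (t * (u + w)))) borel real)"
    by (rule prob_space.real_distribution_distr) (auto simp: prob_space_measure_pmf)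
  show "char (distr M borel (N t)) = char (distr (measure_pmf (pois (t * (u + w)))) borel real)"
  proof
    fix y
    have "char (distr M borel (N t)) y = exp (of_real (t * (u + w)) * (iexp y - 1))"
      unfolding char_def using ch[OF t, of y 0] t
      by (subst integral_distr) (auto simp: algebra_simps)
    also have "\<dots> = (CLINT k|measure_pmf (pois (t * (u + w))). iexp (y * real k))"
      using t rate_pos by (intro pois_char[symmetric]) auto
    also have "\<dots> = char (distr (measure_pmf (pois (t * (u + w)))) borel real) y"
      unfolding char_def by (subst integral_distr) auto
    finally show "char (distr M borel (N t)) y = char (distr (measure_pmf (pois (t * (u + w)))) borel real) y" .
  qed
qed

lemma law_L:
  assumes t: "0 \<le> t"
  shows "distr M borel (L t) = distr (measure_pmf (pois (t * v)) \<Otimes>\<^sub>M measure_pmf (pois (t * w))) borel (\<lambda>p. real (fst p) + \<alpha> * real (snd p))"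
    (is "_ = distr ?P borel ?f")
proof (rule Levy_uniqueness)
  have m: "?f \<in> borel_measurable ?P" by measurable
  have "prob_space ?P" by (intro prob_space_pair prob_space_measure_pmf)
  then show "real_distribution (distr ?P borel ?f)"
    by (rule prob_space.real_distribution_distr) (rule m)
  show "real_distribution (distr M borel (L t))" using t by (intro real_distribution_distr measL)
  show "char (distr M borel (L t)) = char (distr ?P borel ?f)"
  proof
    fix z
    have "char (distr M borel (L t)) z = exp (of_real (t * v) * (iexp z - 1)) * exp (of_real (t * w) * (iexp (\<alpha> * z) - 1))"
      unfolding char_def using ch[OF t, of 0 z] t
      by (subst integral_distr) (auto simp: algebra_simps exp_add[symmetric])
    also have "\<dots> = (CLINT k|measure_pmf (pois (t * v)). iexp (z * real k)) * (CLINT k|measure_pmf (pois (t * w)). iexp ((\<alpha> * z) * real k))"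
      using t rate_pos by (intro arg_cong2[where f = "(*)"] pois_char[symmetric]) auto
    also have "\<dots> = (CLINT p|?P. iexp (z * real (fst p)) * iexp ((\<alpha> * z) * real (snd p)))"
      by (rule integral_pair_mult[symmetric]) (auto simp: prob_space_measure_pmf)
    also have "\<dots> = (CLINT p|?P. iexp (z * ?f p))"
      by (rule Bochner_Integration.integral_cong) (simp_all add: exp_add[symmetric] algebra_simps)
    also have "\<dots> = char (distr ?P borel ?f) z"
      unfolding char_def by (rule integral_distr[symmetric]) (rule m, measurable)
    finally show "char (distr M borel (L t)) z = char (distr ?P borel ?f) z" .
  qed
qed

lemma N_Nats: "0 \<le> t \<Longrightarrow> AE \<omega> in M. N t \<omega> \<in> \<nat>"
proof -
  assume t: "0 \<le> t"
  have "AE x in distr M borel (N t). x \<in> \<nat>"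
    unfolding law_N[OF t] by (subst AE_distr_iff) auto
  then show ?thesis using t by (subst (asm) AE_distr_iff) auto
qed

lemma L_nonneg: "0 \<le> t \<Longrightarrow> AE \<omega> in M. 0 \<le> L t \<omega>"
proof -
  assume t: "0 \<le> t"
  have "AE x in distr M borel (L t). 0 \<le> x"
    unfolding law_L[OF t] using alpha by (subst AE_distr_iff) auto
  then show ?thesis using t by (subst (asm) AE_distr_iff) auto
qed

lemma L_mean:
  assumes t: "0 \<le> t"
  shows "integrable M (L t)" "expectation (L t) = t * (v + \<alpha> * w)"
proof -
  let ?A = "measure_pmf (pois (t * v))" and ?B = "measure_pmf (pois (t * w))"
  have nn: "(\<integral>\<^sup>+k. ennreal (real k) \<partial>measure_pmf (pois l)) = ennreal l" if "0 \<le> l" for l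
    using pois_mean[OF that] that by (subst nn_integral_eq_integral) auto
  have "(\<integral>\<^sup>+\<omega>. ennreal (L t \<omega>) \<partial>M) = (\<integral>\<^sup>+x. ennreal x \<partial>distr M borel (L t))"
    using t by (subst nn_integral_distr) auto
  also have "\<dots> = (\<integral>\<^sup>+p. ennreal (real (fst p) + \<alpha> * real (snd p)) \<partial>(?A \<Otimes>\<^sub>M ?B))"
    unfolding law_L[OF t] by (subst nn_integral_distr) auto
  also have "\<dots> = (\<integral>\<^sup>+x. \<integral>\<^sup>+y. ennreal (real x + \<alpha> * real y) \<partial>?B \<partial>?A)"
    by (subst measure_pmf.nn_integral_fst[symmetric]) auto
  also have "\<dots> = (\<integral>\<^sup>+x. ennreal (real x) + ennreal (\<alpha> * (t * w)) \<partial>?A)"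
  proof (rule nn_integral_cong)
    fix x
    have "(\<integral>\<^sup>+y. ennreal (real x + \<alpha> * real y) \<partial>?B) = (\<integral>\<^sup>+y. ennreal (real x) + ennreal \<alpha> * ennreal (real y) \<partial>?B)"
      using alpha by (simp add: ennreal_mult)
    also have "\<dots> = ennreal (real x) + ennreal \<alpha> * ennreal (t * w)"
      using t rate_pos by (subst nn_integral_add) (auto simp: nn_integral_cmult nn measure_pmf.emeasure_space_1)
    finally show "(\<integral>\<^sup>+y. ennreal (real x + \<alpha> * real y) \<partial>?B) = ennreal (real x) + ennreal (\<alpha> * (t * w))"
      using alpha t rate_pos by (simp add: ennreal_mult)
  qed
  also have "\<dots> = ennreal (t * v) + ennreal (\<alpha> * (t * w))"
    using t rate_pos by (subst nn_integral_add) (auto simp: nn measure_pmf.emeasure_space_1)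
  also have "\<dots> = ennreal (t * (v + \<alpha> * w))"
    using t rate_pos alpha by (subst ennreal_plus[symmetric]) (auto simp: algebra_simps)
  finally have *: "(\<integral>\<^sup>+\<omega>. ennreal (L t \<omega>) \<partial>M) = ennreal (t * (v + \<alpha> * w))" .
  show "integrable M (L t)"
    by (rule integrableI_nn_integral_finite[OF _ L_nonneg[OF t] *]) (use t in simp)
  show "expectation (L t) = t * (v + \<alpha> * w)"
    using integral_eq_nn_integral[OF _ L_nonneg[OF t]] t * rate_pos alpha by simp
qed

lemma wgt_mean:
  assumes t: "0 \<le> t"
  shows "expectation (\<lambda>\<omega>. wgt \<theta> (N t \<omega>)) = exp (- (t * (u + w) * (1 - \<theta>)))"
proof -
  have "expectation (\<lambda>\<omega>. wgt \<theta> (N t \<omega>)) = (\<integral>x. wgt \<theta> x \<partial>distr M borel (N t))"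
    using t by (subst integral_distr) auto
  also have "\<dots> = (\<integral>k. \<theta> ^ k \<partial>measure_pmf (pois (t * (u + w))))"
    unfolding law_N[OF t] by (subst integral_distr) auto
  also have "\<dots> = exp (- (t * (u + w) * (1 - \<theta>)))"
    using pois_power[of "t * (u + w)" \<theta>] t rate_pos by (simp add: algebra_simps)
  finally show ?thesis .
qed

text \<open>Quadratic in \<open>t\<close>, so that it still vanishes after division by the
  mesh.\<close>

lemma prob_two_jumps:
  assumes t: "0 \<le> t"
  shows "prob {\<omega> \<in> space M. N t \<omega> \<notin> {0, 1}} \<le> (t * (u + w))\<^sup>2"
proof -
  define l where "l = t * (u + w)"
  have l: "0 \<le> l" using t rate_pos by (simp add: l_def)
  have "prob {\<omega> \<in> space M. N t \<omega> \<notin> {0, 1}} = measure (distr M borel (N t)) (- {0, 1})"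
    using t by (subst measure_distr) (auto intro!: arg_cong[where f = prob])
  also have "\<dots> = measure (measure_pmf (pois l)) (- {0, 1})"
    unfolding law_N[OF t] l_def by (subst measure_distr) (auto intro!: arg_cong[where f = "measure _"])
  also have "\<dots> = 1 - measure (measure_pmf (pois l)) {0, 1}"
    using measure_pmf.prob_compl[of "{0, 1}" "pois l"] by (simp add: Compl_eq_Diff_UNIV)
  also have "measure (measure_pmf (pois l)) {0, 1} = exp (- l) * (1 + l)"
    using l by (subst measure_measure_pmf_finite) (auto simp: pmf_pois algebra_simps)
  also have "1 - exp (- l) * (1 + l) \<le> 1 - (1 - l) * (1 + l)"
    using exp_ge_add_one_self[of "- l"] l by (intro diff_left_mono mult_right_mono) auto
  also have "\<dots> = l\<^sup>2" by (simp add: algebra_simps power2_eq_square)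
  finally show ?thesis unfolding l_def .
qed

text \<open>On N_t = 0 the jumps (1, 0) and (1, \<alpha>) are absent, which costs exp (- t (u + w)),
  and L is a Poisson variable of mean t v. The independence behind this is available in the Poisson
  model, to which \<open>expectation_zero_tendsto\<close> transfers the expectation.\<close>

lemma expectation_no_jump:
  assumes t: "0 \<le> t"
  shows "(CLINT \<omega>|M. iexp (z * L t \<omega>) * indicator {0} (N t \<omega>)) =
    exp (of_real t * (of_real v * (iexp z - 1) - of_real u - of_real w))"
proof -
  let ?Q = "pois3 (t * u) (t * v) (t * w)"
  let ?N = "\<lambda>x :: nat \<times> nat \<times> nat. real (fst x + snd (snd x))"
  let ?L = "\<lambda>x :: nat \<times> nat \<times> nat. real (fst (snd x)) + \<alpha> * real (snd (snd x))"
  have p: "0 \<le> t * u" "0 \<le> t * v" "0 \<le> t * w" using t rate_pos by auto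
  have eq: "(CLINT \<omega>|M. iexp (y * N t \<omega> + z * L t \<omega>)) = (CLINT x|?Q. iexp (y * ?N x + z * ?L x))" for y
    unfolding pois3_char[OF p] ch[OF t] by (simp add: algebra_simps)
  have "(CLINT \<omega>|M. iexp (z * L t \<omega>) * indicator {0} (N t \<omega>)) = (CLINT x|?Q. iexp (z * ?L x) * indicator {0} (?N x))"
  proof (rule LIMSEQ_unique)
    show "(\<lambda>n. (\<Sum>j<Suc n. CLINT \<omega>|M. iexp (2 * pi * real j / real (Suc n) * N t \<omega> + z * L t \<omega>)) / of_nat (Suc n))
     \<longlonglongrightarrow> (CLINT \<omega>|M. iexp (z * L t \<omega>) * indicator {0} (N t \<omega>))"
      by (rule expectation_zero_tendsto) (use t N_Nats prob_space_axioms in auto)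
    show "(\<lambda>n. (\<Sum>j<Suc n. CLINT \<omega>|M. iexp (2 * pi * real j / real (Suc n) * N t \<omega> + z * L t \<omega>)) / of_nat (Suc n))
     \<longlonglongrightarrow> (CLINT x|?Q. iexp (z * ?L x) * indicator {0} (?N x))"
      unfolding eq by (rule expectation_zero_tendsto) (auto intro: prob_space_pois3 simp del: of_nat_add)
  qed
  also have "\<dots> = (CLINT x|?Q. of_real (indicator {0} (fst x)) * (iexp (z * real (fst (snd x))) * of_real (indicator {0} (snd (snd x)))))"
    by (rule Bochner_Integration.integral_cong) (auto simp: indicator_def add_nonneg_eq_0_iff)
  also have "\<dots> = (CLINT k|measure_pmf (pois (t * u)). of_real (indicator {0} k)) *
    ((CLINT k|measure_pmf (pois (t * v)). iexp (z * real k)) * (CLINT k|measure_pmf (pois (t * w)). of_real (indicator {0} k)))"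
    by (rule pois3_prod) (auto simp: indicator_def)
  also have "\<dots> = of_real (exp (- (t * u))) * (exp (of_real (t * v) * (iexp z - 1)) * of_real (exp (- (t * w))))"
  proof -
    have "(CLINT k|measure_pmf (pois l). of_real (indicator {0} k)) = of_real (exp (- l))" if "0 \<le> l" for l
      using that by (simp add: integral_complex_of_real measure_pmf_single pmf_pois)
    then show ?thesis using p by (simp only: pois_char)
  qed
  also have "\<dots> = exp (of_real t * (of_real v * (iexp z - 1) - of_real u - of_real w))"
    by (simp add: exp_of_real[symmetric] exp_add[symmetric] algebra_simps)
  finally show ?thesis .
qed

end

section \<open>Increments, regular paths and conditioning on the first increment\<close>

context biv begin

lemma incr_law:
  assumes "0 \<le> s" "0 \<le> t"
  shows "distr M borel (\<lambda>\<omega>. (N (s + t) \<omega> - N s \<omega>, L (s + t) \<omega> - L s \<omega>)) = distr M borel (\<lambda>\<omega>. (N t \<omega>, L t \<omega>))"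
  using lp assms unfolding levy_process_def by simp

lemma incr_indep:
  assumes "0 \<le> t 0" "\<And>i. i < n \<Longrightarrow> t i \<le> t (Suc i)"
  shows "indep_vars (\<lambda>_. borel) (\<lambda>i \<omega>. (N (t (Suc i)) \<omega> - N (t i) \<omega>, L (t (Suc i)) \<omega> - L (t i) \<omega>)) {..<n :: nat}"
  using lp assms unfolding levy_process_def by auto

lemma AE_0: "AE \<omega> in M. N 0 \<omega> = 0 \<and> L 0 \<omega> = 0"
  using lp unfolding levy_process_def zero_prod_def by simp

lemma incr_AE:
  assumes st: "0 \<le> s" "0 \<le> t" and P: "AE \<omega> in M. P (N t \<omega>) (L t \<omega>)"
    and [measurable]: "{x. P (fst x) (snd x)} \<in> sets borel"
  shows "AE \<omega> in M. P (N (s + t) \<omega> - N s \<omega>) (L (s + t) \<omega> - L s \<omega>)"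
proof -
  have "AE x in distr M borel (\<lambda>\<omega>. (N t \<omega>, L t \<omega>)). P (fst x) (snd x)"
    using st P by (subst AE_distr_iff) (auto intro!: meas_pair)
  then have "AE x in distr M borel (\<lambda>\<omega>. (N (s + t) \<omega> - N s \<omega>, L (s + t) \<omega> - L s \<omega>)). P (fst x) (snd x)"
    unfolding incr_law[OF st] .
  then show ?thesis
    using st by (subst (asm) AE_distr_iff) (auto intro!: borel_measurable_Pair)
qed

lemma AE_nice: "AE \<omega> in M. nice_path (\<lambda>t. N t \<omega>) (\<lambda>t. L t \<omega>)"
proof -
  have 1: "AE \<omega> in M. \<forall>s\<in>\<rat>. 0 \<le> s \<longrightarrow> N s \<omega> \<in> \<nat>"
    using N_Nats by (subst AE_ball_countable) (auto simp: countable_rat)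
  have 2: "AE \<omega> in M. \<forall>s\<in>\<rat>. \<forall>t\<in>\<rat>. 0 \<le> s \<longrightarrow> s \<le> t \<longrightarrow> N s \<omega> \<le> N t \<omega> \<and> L s \<omega> \<le> L t \<omega>"
  proof -
    have "AE \<omega> in M. 0 \<le> s \<longrightarrow> s \<le> t \<longrightarrow> N s \<omega> \<le> N t \<omega> \<and> L s \<omega> \<le> L t \<omega>" for s t
    proof (cases "0 \<le> s \<and> s \<le> t")
      case True
      have n: "AE \<omega> in M. 0 \<le> N (t - s) \<omega> \<and> 0 \<le> L (t - s) \<omega>"
        using N_Nats[of "t - s"] L_nonneg[of "t - s"] True by (auto simp: Nats_def elim: eventually_elim2)
      have "{x :: real \<times> real. 0 \<le> fst x \<and> 0 \<le> snd x} \<in> sets borel" by measurable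
      from incr_AE[OF _ _ n this, of s] True have "AE \<omega> in M. 0 \<le> N t \<omega> - N s \<omega> \<and> 0 \<le> L t \<omega> - L s \<omega>"
        by simp
      then show ?thesis by eventually_elim auto
    qed auto
    then show ?thesis by (simp add: AE_ball_countable countable_rat)
  qed
  have 3: "AE \<omega> in M. cadlag (\<lambda>t. (N t \<omega>, L t \<omega>))"
    using lp unfolding levy_process_def by simp
  show ?thesis using 1 2 3 AE_0
    by eventually_elim (rule nice_pathI_rat, auto)
qed

definition xi :: "real \<Rightarrow> nat \<Rightarrow> 'a \<Rightarrow> real \<times> real" where
  "xi h k \<omega> = (N (real (Suc k) * h) \<omega> - N (real k * h) \<omega>, L (real (Suc k) * h) \<omega> - L (real k * h) \<omega>)"

context
  fixes \<theta> h :: real assumes th: "0 \<le> \<theta>" "\<theta> < 1" and h: "0 < h"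
begin

lemma meas_xi [measurable]: "xi h k \<in> borel_measurable M"
  unfolding xi_def[abs_def] using h by (intro borel_measurable_Pair borel_measurable_diff measN measL) auto

lemma indep_xi: "indep_vars (\<lambda>_. borel) (xi h) {..<n}"
  using incr_indep[of "\<lambda>i. real i * h" n] h by (simp add: xi_def[abs_def] mult_right_mono)

lemma law_xi: "distr M borel (xi h k) = distr M borel (\<lambda>\<omega>. (N h \<omega>, L h \<omega>))"
  using incr_law[of "real k * h" h] h by (simp add: xi_def[abs_def] algebra_simps)

definition isum :: "nat \<Rightarrow> nat \<Rightarrow> 'a \<Rightarrow> real" where
  "isum i j \<omega> = incr_sum \<theta> (\<lambda>k. xi h k \<omega>) i j"

lemma meas_isum [measurable]: "isum i j \<in> borel_measurable M"
proof (induction j arbitrary: i)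
  case (Suc j)
  then have [measurable]: "(\<lambda>\<omega>. incr_sum \<theta> (\<lambda>k. xi h k \<omega>) (Suc i) j) \<in> borel_measurable M"
    by (simp add: isum_def[abs_def])
  show ?case unfolding isum_def[abs_def] incr_sum.simps by measurable
qed (simp add: isum_def[abs_def])

text \<open>The increment i is independent of the block of later increments, so the rest of the sum
  can be integrated first.\<close>

lemma char_isum_Suc:
  "(CLINT \<omega>|M. iexp (z * isum i (Suc j) \<omega>)) =
     (CLINT \<omega>|M. iexp (z * L h \<omega>) * (CLINT \<omega>'|M. iexp ((wgt \<theta> (N h \<omega>) * z) * isum (Suc i) j \<omega>')))"
proof -
  let ?X = "distr M borel (xi h i)" and ?R = "distr M borel (isum (Suc i) j)"
  \<comment> \<open>\<open>indep_var\<close> requires both variables to have the same type, hence the dummy component 0\<close>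
  let ?R' = "distr M borel (\<lambda>\<omega>. (0 :: real, isum (Suc i) j \<omega>))"
  have "indep_var (Pi\<^sub>M {i} (\<lambda>_. borel)) (\<lambda>\<omega>. restrict (\<lambda>k. xi h k \<omega>) {i})
     (Pi\<^sub>M {Suc i..<Suc i + j} (\<lambda>_. borel)) (\<lambda>\<omega>. restrict (\<lambda>k. xi h k \<omega>) {Suc i..<Suc i + j})"
    by (rule indep_var_restrict[OF indep_xi[of "Suc i + j"]]) auto
  from indep_var_compose[OF this, where ?Y1.0 = "\<lambda>x. x i" and ?N1.0 = borel and ?Y2.0 = "\<lambda>x. (0, incr_sum \<theta> x (Suc i) j)" and ?N2.0 = borel]
  have "indep_var borel ((\<lambda>x. x i) \<circ> (\<lambda>\<omega>. restrict (\<lambda>k. xi h k \<omega>) {i})) borel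
     ((\<lambda>x. (0, incr_sum \<theta> x (Suc i) j)) \<circ> (\<lambda>\<omega>. restrict (\<lambda>k. xi h k \<omega>) {Suc i..<Suc i + j}))"
    using measurable_incr_sum[of "Suc i" j "{Suc i..<Suc i + j}" \<theta>] by (simp add: borel_measurable_Pair)
  also have "(\<lambda>x. x i) \<circ> (\<lambda>\<omega>. restrict (\<lambda>k. xi h k \<omega>) {i}) = xi h i" by auto
  also have "(\<lambda>x. (0, incr_sum \<theta> x (Suc i) j)) \<circ> (\<lambda>\<omega>. restrict (\<lambda>k. xi h k \<omega>) {Suc i..<Suc i + j}) = (\<lambda>\<omega>. (0, isum (Suc i) j \<omega>))"
    unfolding isum_def[abs_def] comp_def by (auto intro!: ext incr_sum_cong)
  finally have dist: "?X \<Otimes>\<^sub>M ?R' = distr M (borel \<Otimes>\<^sub>M borel) (\<lambda>\<omega>. (xi h i \<omega>, (0, isum (Suc i) j \<omega>)))"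
    by (simp add: indep_var_distribution_eq)
  have Rm[measurable]: "(\<lambda>\<omega>. (0 :: real, isum (Suc i) j \<omega>)) \<in> borel_measurable M"
    by (intro borel_measurable_Pair) auto
  interpret X: prob_space ?X by (rule prob_space_distr) measurable
  interpret R: real_distribution ?R by (rule real_distribution_distr) measurable
  interpret R': prob_space ?R' by (rule prob_space_distr) measurable
  interpret P: pair_prob_space ?X ?R' ..
  let ?g = "\<lambda>p :: (real \<times> real) \<times> (real \<times> real). iexp (z * (snd (fst p) + wgt \<theta> (fst (fst p)) * snd (snd p)))"
  have gm[measurable]: "?g \<in> borel_measurable (borel \<Otimes>\<^sub>M borel)" by measurable
  have int: "integrable (?X \<Otimes>\<^sub>M ?R') ?g"
    by (rule P.integrable_const_bound[where B = 1]) (auto simp: dist)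
  have inner: "(CLINT y|?R'. iexp (c * snd y)) = char ?R c" for c
    unfolding char_def by (subst (1 2) integral_distr) auto
  have "(CLINT \<omega>|M. iexp (z * isum i (Suc j) \<omega>)) =
    (CLINT p|distr M (borel \<Otimes>\<^sub>M borel) (\<lambda>\<omega>. (xi h i \<omega>, (0, isum (Suc i) j \<omega>))). ?g p)"
    by (subst integral_distr[OF _ gm]) (measurable, simp add: isum_def)
  also have "\<dots> = (CLINT x|?X. CLINT y|?R'. ?g (x, y))"
    unfolding dist[symmetric] by (rule P.integral_fst'[OF int, symmetric])
  also have "\<dots> = (CLINT x|?X. iexp (z * snd x) * char ?R (wgt \<theta> (fst x) * z))"
    unfolding inner[symmetric]
    by (rule Bochner_Integration.integral_cong[OF refl], subst integral_mult_right_zero[symmetric])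
      (simp add: exp_add[symmetric] algebra_simps)
  also have "\<dots> = (CLINT \<omega>|M. iexp (z * L h \<omega>) * char ?R (wgt \<theta> (N h \<omega>) * z))"
    unfolding law_xi using h by (subst integral_distr) (auto intro!: meas_pair)
  also have "\<dots> = (CLINT \<omega>|M. iexp (z * L h \<omega>) * (CLINT \<omega>'|M. iexp ((wgt \<theta> (N h \<omega>) * z) * isum (Suc i) j \<omega>')))"
    unfolding char_def by (subst integral_distr) auto
  finally show ?thesis .
qed

definition rchar :: "nat \<Rightarrow> real \<Rightarrow> complex" where
  "rchar j z = (CLINT \<omega>|M. iexp (z * isum 0 j \<omega>))"

text \<open>Stationarity of the sum is obtained by induction on its length: the right side of
  \<open>char_isum_Suc\<close> depends on i only through a shorter sum.\<close>

lemma char_isum_shift: "(CLINT \<omega>|M. iexp (z * isum i j \<omega>)) = rchar j z"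
proof (induction j arbitrary: i z)
  case 0
  show ?case by (simp add: rchar_def isum_def)
next
  case (Suc j)
  have "(CLINT \<omega>|M. iexp (z * isum i (Suc j) \<omega>)) = (CLINT \<omega>|M. iexp (z * L h \<omega>) * rchar j (wgt \<theta> (N h \<omega>) * z))" for i
    unfolding char_isum_Suc Suc ..
  then show ?case by (simp only: rchar_def[of "Suc j"])
qed

lemma rchar_Suc: "rchar (Suc j) z = (CLINT \<omega>|M. iexp (z * L h \<omega>) * rchar j (wgt \<theta> (N h \<omega>) * z))"
  unfolding rchar_def[of "Suc j"] char_isum_Suc char_isum_shift ..

lemma rchar_char: "rchar j = char (distr M borel (isum 0 j))"
  by (rule ext) (simp add: rchar_def char_def integral_distr)

lemma rchar_measurable [measurable]: "rchar j \<in> borel_measurable borel"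
  and rchar_le_1: "cmod (rchar j z) \<le> 1"
proof -
  interpret R: real_distribution "distr M borel (isum 0 j)" by (rule real_distribution_distr) measurable
  show "rchar j \<in> borel_measurable borel" "cmod (rchar j z) \<le> 1" unfolding rchar_char by (simp_all add: R.cmod_char_le_1)
qed

lemma isum_AE: "AE \<omega> in M. isum 0 K \<omega> = riemann_sum \<theta> (\<lambda>t. N t \<omega>) (\<lambda>t. L t \<omega>) h K"
  using AE_nice
proof eventually_elim
  case (elim \<omega>)
  from incr_sum_eq_riemann_sum[OF this, of h \<theta> K] h show ?case by (simp add: isum_def xi_def[abs_def])
qed

end

lemma wgt_incr_mean:
  assumes s: "0 \<le> s" and t: "0 \<le> t" and th: "0 \<le> \<theta>" "\<theta> < 1"
  shows "integrable M (\<lambda>\<omega>. wgt \<theta> (N s \<omega>) * (L (s + t) \<omega> - L s \<omega>))"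
    "expectation (\<lambda>\<omega>. wgt \<theta> (N s \<omega>) * (L (s + t) \<omega> - L s \<omega>)) = exp (- (s * (u + w) * (1 - \<theta>))) * (t * (v + \<alpha> * w))"
proof -
  \<comment> \<open>The partition 0, s, s + t exhibits N s, up to the null event N 0 \<noteq> 0, as
    an increment independent of the later one.\<close>
  define T where "T i = (if i = 0 then 0 else if i = Suc 0 then s else s + t)" for i :: nat
  define X where "X i \<omega> = (N (T (Suc i)) \<omega> - N (T i) \<omega>, L (T (Suc i)) \<omega> - L (T i) \<omega>)" for i \<omega>
  have "indep_vars (\<lambda>_. borel) X {..<2}"
    unfolding X_def[abs_def] by (rule incr_indep) (use s t in \<open>auto simp: T_def\<close>)
  then have "indep_var (Pi\<^sub>M {0} (\<lambda>_. borel)) (\<lambda>\<omega>. restrict (\<lambda>k. X k \<omega>) {0}) (Pi\<^sub>M {1} (\<lambda>_. borel)) (\<lambda>\<omega>. restrict (\<lambda>k. X k \<omega>) {1})"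
    by (rule indep_var_restrict) auto
  from indep_var_compose[OF this, where ?Y1.0 = "\<lambda>x. wgt \<theta> (fst (x 0))" and ?N1.0 = borel and ?Y2.0 = "\<lambda>x. snd (x 1)" and ?N2.0 = borel]
  have "indep_var borel ((\<lambda>x. wgt \<theta> (fst (x 0))) \<circ> (\<lambda>\<omega>. restrict (\<lambda>k. X k \<omega>) {0})) borel ((\<lambda>x. snd (x 1)) \<circ> (\<lambda>\<omega>. restrict (\<lambda>k. X k \<omega>) {1}))"
    by simp
  then have ind: "indep_var borel (\<lambda>\<omega>. wgt \<theta> (N s \<omega> - N 0 \<omega>)) borel (\<lambda>\<omega>. L (s + t) \<omega> - L s \<omega>)"
    by (simp add: comp_def X_def T_def)
  note m[measurable] = measN[OF s] measL[OF s]
  have m0[measurable]: "N 0 \<in> borel_measurable M" "L (s + t) \<in> borel_measurable M"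
    using measN[of 0] measL[of "s + t"] s t by simp_all
  have ae: "AE \<omega> in M. wgt \<theta> (N s \<omega> - N 0 \<omega>) = wgt \<theta> (N s \<omega>)" using AE_0 by eventually_elim simp
  have i1: "integrable M (\<lambda>\<omega>. wgt \<theta> (N s \<omega> - N 0 \<omega>))"
    by (rule integrable_const_bound[where B = 1]) (use wgt_bounds th in auto)
  have "distr M borel (\<lambda>\<omega>. L (s + t) \<omega> - L s \<omega>) = distr (distr M borel (\<lambda>\<omega>. (N (s + t) \<omega> - N s \<omega>, L (s + t) \<omega> - L s \<omega>))) borel snd"
    by (subst distr_distr) (auto simp: comp_def intro!: borel_measurable_Pair borel_measurable_diff measN measL add_nonneg_nonneg s t)
  also have "\<dots> = distr M borel (L t)"
    unfolding incr_law[OF s t] using t by (subst distr_distr) (auto simp: comp_def intro!: meas_pair)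
  finally have law: "distr M borel (\<lambda>\<omega>. L (s + t) \<omega> - L s \<omega>) = distr M borel (L t)" .
  have "integrable (distr M borel (L t)) (\<lambda>x. x)" "(\<integral>x. x \<partial>distr M borel (L t)) = t * (v + \<alpha> * w)"
    using t L_mean[OF t] by (simp_all add: integrable_distr_eq integral_distr)
  then have i2: "integrable M (\<lambda>\<omega>. L (s + t) \<omega> - L s \<omega>)" "expectation (\<lambda>\<omega>. L (s + t) \<omega> - L s \<omega>) = t * (v + \<alpha> * w)"
    unfolding law[symmetric] by (simp_all add: integrable_distr_eq integral_distr)
  have e1: "expectation (\<lambda>\<omega>. wgt \<theta> (N s \<omega> - N 0 \<omega>)) = exp (- (s * (u + w) * (1 - \<theta>)))"
    using wgt_mean[OF s, of \<theta>] integral_cong_AE[OF _ _ ae] by simp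
  have ae2: "AE \<omega> in M. wgt \<theta> (N s \<omega> - N 0 \<omega>) * (L (s + t) \<omega> - L s \<omega>) = wgt \<theta> (N s \<omega>) * (L (s + t) \<omega> - L s \<omega>)"
    using ae by eventually_elim simp
  show "integrable M (\<lambda>\<omega>. wgt \<theta> (N s \<omega>) * (L (s + t) \<omega> - L s \<omega>))"
    using integrable_cong_AE[OF _ _ ae2] indep_var_integrable[OF ind i1 i2(1)] by simp
  show "expectation (\<lambda>\<omega>. wgt \<theta> (N s \<omega>) * (L (s + t) \<omega> - L s \<omega>)) = exp (- (s * (u + w) * (1 - \<theta>))) * (t * (v + \<alpha> * w))"
    using integral_cong_AE[OF _ _ ae2] indep_var_lebesgue_integral[OF ind i1 i2(1)] e1 i2(2) by simp
qed

end

section \<open>Refining the grid and letting the time horizon tend to infinity\<close>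

lemma norm_iexp_diff_le: "cmod (iexp a - iexp b) \<le> \<bar>a - b\<bar>"
proof -
  have "iexp a - iexp b = iexp b * (iexp (a - b) - 1)"
    by (simp add: exp_add[symmetric] algebra_simps)
  then have "cmod (iexp a - iexp b) = cmod (iexp (a - b) - 1)" by (simp add: norm_mult)
  also have "\<dots> \<le> \<bar>a - b\<bar>" using iexp_approx1[of "a - b" 0] by simp
  finally show ?thesis .
qed

lemma exp_minus_one_over_tendsto:
  fixes \<beta> :: complex
  shows "(\<lambda>m. (exp (of_real (1 / 2 ^ m) * \<beta>) - 1) / of_real (1 / 2 ^ m)) \<longlonglongrightarrow> \<beta>"
proof -
  have "((\<lambda>x. exp (x * \<beta>)) has_field_derivative \<beta>) (at 0)"
    by (auto intro!: derivative_eq_intros)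
  then have lim: "((\<lambda>h. (exp (h * \<beta>) - 1) / h) \<longlongrightarrow> \<beta>) (at 0)"
    by (simp add: DERIV_def)
  have "(\<lambda>m. (1 / 2) ^ m :: real) \<longlonglongrightarrow> 0" by (rule LIMSEQ_power_zero) simp
  then have "(\<lambda>m. of_real (1 / 2 ^ m) :: complex) \<longlonglongrightarrow> of_real 0"
    by (intro tendsto_of_real) (simp add: power_one_over)
  then have "filterlim (\<lambda>m. of_real (1 / 2 ^ m) :: complex) (at 0) sequentially"
    by (simp add: filterlim_at)
  from filterlim_compose[OF lim this] show ?thesis .
qed

text \<open>Riemann sums of the integral of exp (- l s), bounded uniformly in the mesh and the
  number of cells; it rests on 1 - exp (- x) \<ge> x / (1 + x).\<close>

lemma geometric_sum_bound:
  fixes l h :: real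
  assumes l: "0 < l" and h: "0 < h" "h \<le> 1"
  shows "h * (\<Sum>k<K. exp (- (real k * h * l))) \<le> (1 + l) / l"
proof -
  define r where "r = exp (- (h * l))"
  have r: "0 < r" "r < 1" using l h by (auto simp: r_def)
  have "exp (- (real k * h * l)) = r ^ k" for k
    by (simp add: r_def exp_of_nat_mult[symmetric] ac_simps)
  then have "(\<Sum>k<K. exp (- (real k * h * l))) = (1 - r ^ K) / (1 - r)"
    using r by (simp add: sum_gp_strict)
  also have "\<dots> \<le> 1 / (1 - r)" using r by (intro divide_right_mono) auto
  also have "\<dots> \<le> (1 + h * l) / (h * l)"
  proof -
    have "1 + h * l > 0" using l h by (simp add: add_pos_pos)
    have "1 + h * l \<le> exp (h * l)" by simp
    then have "r \<le> 1 / (1 + h * l)"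
      using \<open>1 + h * l > 0\<close> by (simp add: r_def exp_minus inverse_eq_divide frac_le)
    then have "h * l / (1 + h * l) \<le> 1 - r" using \<open>1 + h * l > 0\<close> by (simp add: field_simps)
    then have "1 / (1 - r) \<le> 1 / (h * l / (1 + h * l))"
      using l h \<open>1 + h * l > 0\<close> by (intro divide_left_mono) (auto intro!: mult_pos_pos divide_pos_pos simp: r)
    then show ?thesis by simp
  qed
  finally have "h * (\<Sum>k<K. exp (- (real k * h * l))) \<le> h * ((1 + h * l) / (h * l))"
    using h by (intro mult_left_mono) auto
  also have "\<dots> = (1 + h * l) / l" using h by simp
  also have "\<dots> \<le> (1 + l) / l" using l h by (intro divide_right_mono) (auto simp: mult_left_le_one_le)
  finally show ?thesis .
qed

context biv begin

lemma measurable_riemann_sum: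
  assumes h: "0 < h"
  shows "(\<lambda>\<omega>. riemann_sum \<theta> (\<lambda>t. N t \<omega>) (\<lambda>t. L t \<omega>) h K) \<in> borel_measurable M"
proof -
  have [measurable]: "N (real k * h) \<in> borel_measurable M" "L (real k * h) \<in> borel_measurable M" for k
    using h by auto
  show ?thesis unfolding riemann_sum_def by measurable
qed

text \<open>E exp (i z L_t) restricted to N_t = 0 is exp (t \<open>stay_rate z\<close>), while
  \<open>jump_rate\<close> collects the jumps of N; their sum is the exponent of L.\<close>

definition stay_rate :: "real \<Rightarrow> complex" where "stay_rate z = of_real v * (iexp z - 1) - of_real u - of_real w"
definition jump_rate :: "real \<Rightarrow> complex" where "jump_rate z = of_real u + of_real w * iexp (\<alpha> * z)"

context
  fixes \<theta> :: real assumes th: "0 \<le> \<theta>" "\<theta> < 1"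
begin

lemma rchar_eq_riemann_sum:
  assumes h: "0 < h"
  shows "rchar \<theta> h K z = (CLINT \<omega>|M. iexp (z * riemann_sum \<theta> (\<lambda>t. N t \<omega>) (\<lambda>t. L t \<omega>) h K))"
proof -
  note [measurable] = measurable_riemann_sum[OF h] meas_isum[OF th h]
  show ?thesis unfolding rchar_def[OF th h]
    by (rule integral_cong_AE) (use isum_AE[OF th h, of K] in auto)
qed

text \<open>The last summand has expectation of order h times exp (- (u + w) (1 - \<theta>) j h).
  This bounds the effect of one more cell and becomes negligible at large times.\<close>

lemma rchar_diff:
  assumes h: "0 < h"
  shows "cmod (rchar \<theta> h (Suc j) z - rchar \<theta> h j z) \<le> \<bar>z\<bar> * (exp (- (real j * h * (u + w) * (1 - \<theta>))) * (h * (v + \<alpha> * w)))"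
proof -
  let ?R = "\<lambda>K \<omega>. riemann_sum \<theta> (\<lambda>t. N t \<omega>) (\<lambda>t. L t \<omega>) h K"
  let ?D = "\<lambda>\<omega>. wgt \<theta> (N (real j * h) \<omega>) * (L (real j * h + h) \<omega> - L (real j * h) \<omega>)"
  note [measurable] = measurable_riemann_sum[OF h]
  have int: "integrable M (\<lambda>\<omega>. iexp (z * ?R K \<omega>))" for K
    by (rule integrable_const_bound[where B = 1]) auto
  have D: "integrable M ?D" "expectation ?D = exp (- (real j * h * (u + w) * (1 - \<theta>))) * (h * (v + \<alpha> * w))"
    using wgt_incr_mean[of "real j * h" h \<theta>] h th by auto
  have RD: "?R (Suc j) \<omega> = ?R j \<omega> + ?D \<omega>" for \<omega>
    by (simp add: riemann_sum_def algebra_simps)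
  have ae: "AE \<omega> in M. cmod (iexp (z * ?R (Suc j) \<omega>) - iexp (z * ?R j \<omega>)) \<le> \<bar>z\<bar> * ?D \<omega>"
    using AE_nice
  proof eventually_elim
    case (elim \<omega>)
    have "0 \<le> ?D \<omega>" using path_mono(2)[OF elim, of "real j * h" "real j * h + h"] h wgt_bounds[of \<theta>] th by simp
    then have "\<bar>z * ?R (Suc j) \<omega> - z * ?R j \<omega>\<bar> = \<bar>z\<bar> * ?D \<omega>"
      by (simp only: RD right_diff_distrib[symmetric] add_diff_cancel_left' abs_mult[of z] abs_of_nonneg)
    then show ?case using norm_iexp_diff_le[of "z * ?R (Suc j) \<omega>" "z * ?R j \<omega>"] by (simp only:)
  qed
  have eq: "rchar \<theta> h (Suc j) z - rchar \<theta> h j z = (CLINT \<omega>|M. iexp (z * ?R (Suc j) \<omega>) - iexp (z * ?R j \<omega>))"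
    unfolding rchar_eq_riemann_sum[OF h] by (rule Bochner_Integration.integral_diff[OF int int, symmetric])
  have "cmod (CLINT \<omega>|M. iexp (z * ?R (Suc j) \<omega>) - iexp (z * ?R j \<omega>)) \<le> (\<integral>\<omega>. cmod (iexp (z * ?R (Suc j) \<omega>) - iexp (z * ?R j \<omega>)) \<partial>M)"
    by (rule integral_norm_bound)
  also have "\<dots> \<le> (\<integral>\<omega>. \<bar>z\<bar> * ?D \<omega> \<partial>M)"
    by (rule integral_mono_AE[OF _ _ ae]) (intro integrable_norm Bochner_Integration.integrable_diff int, intro integrable_mult_right D)
  also have "\<dots> = \<bar>z\<bar> * (exp (- (real j * h * (u + w) * (1 - \<theta>))) * (h * (v + \<alpha> * w)))"
    using D by simp
  finally show ?thesis unfolding eq .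
qed

text \<open>Conditioning on the first cell: N_h = 0 leaves the argument at z, and N_h = 1 contracts
  it to \<theta> z. Larger values are treated like N_h = 1, at a cost of at most 2 on an event of
  order h^2.\<close>

lemma rchar_step:
  assumes h: "0 < h"
  shows "cmod (rchar \<theta> h (Suc j) z - exp (of_real h * stay_rate z) * rchar \<theta> h j z -
    (exp (of_real h * (stay_rate z + jump_rate z)) - exp (of_real h * stay_rate z)) * rchar \<theta> h j (\<theta> * z)) \<le> 2 * (h * (u + w))\<^sup>2"
proof -
  note [measurable] = rchar_measurable[OF th h] 
  note rchar_le = rchar_le_1[OF th h]
  have [measurable]: "N h \<in> borel_measurable M" "L h \<in> borel_measurable M" using h by auto
  let ?e = "\<lambda>\<omega>. iexp (z * L h \<omega>)" and ?i = "\<lambda>\<omega>. indicator {0} (N h \<omega>) :: complex"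
  let ?G = "\<lambda>\<omega>. ?e \<omega> * rchar \<theta> h j (wgt \<theta> (N h \<omega>) * z) - ?e \<omega> * ?i \<omega> * rchar \<theta> h j z - (?e \<omega> - ?e \<omega> * ?i \<omega>) * rchar \<theta> h j (\<theta> * z)"
  have i1: "integrable M (\<lambda>\<omega>. ?e \<omega> * rchar \<theta> h j (wgt \<theta> (N h \<omega>) * z))" "integrable M (\<lambda>\<omega>. ?e \<omega> * ?i \<omega>)" "integrable M ?e"
    by (rule integrable_const_bound[where B = 1]; auto simp: norm_mult rchar_le indicator_def)+
  have E: "(CLINT \<omega>|M. ?e \<omega>) = exp (of_real h * (stay_rate z + jump_rate z))"
    using ch[of h 0 z] h by (simp add: stay_rate_def jump_rate_def algebra_simps)
  have E0: "(CLINT \<omega>|M. ?e \<omega> * ?i \<omega>) = exp (of_real h * stay_rate z)"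
    using expectation_no_jump[of h z] h by (simp add: stay_rate_def)
  have eq: "rchar \<theta> h (Suc j) z - exp (of_real h * stay_rate z) * rchar \<theta> h j z -
    (exp (of_real h * (stay_rate z + jump_rate z)) - exp (of_real h * stay_rate z)) * rchar \<theta> h j (\<theta> * z) = (CLINT \<omega>|M. ?G \<omega>)"
    unfolding rchar_Suc[OF th h] E[symmetric] E0[symmetric] using i1 by simp
  have "cmod (CLINT \<omega>|M. ?G \<omega>) \<le> (\<integral>\<omega>. cmod (?G \<omega>) \<partial>M)" by (rule integral_norm_bound)
  also have "\<dots> \<le> (\<integral>\<omega>. 2 * indicator {\<omega> \<in> space M. N h \<omega> \<notin> {0, 1}} \<omega> \<partial>M)"
  proof (rule integral_mono_AE)
    show "integrable M (\<lambda>\<omega>. cmod (?G \<omega>))" using i1 by simp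
    show "integrable M (\<lambda>\<omega>. 2 * indicator {\<omega> \<in> space M. N h \<omega> \<notin> {0, 1}} \<omega> :: real)"
      by (rule integrable_const_bound[where B = 2]) (auto simp: indicator_def)
    show "AE \<omega> in M. cmod (?G \<omega>) \<le> 2 * indicator {\<omega> \<in> space M. N h \<omega> \<notin> {0, 1}} \<omega>"
    proof (rule AE_I2)
      fix \<omega> assume \<omega>: "\<omega> \<in> space M"
      consider "N h \<omega> = 0" | "N h \<omega> = 1" | "N h \<omega> \<notin> {0, 1}" by auto
      then show "cmod (?G \<omega>) \<le> 2 * indicator {\<omega> \<in> space M. N h \<omega> \<notin> {0, 1}} \<omega>"
      proof cases
        case 3
        have "?G \<omega> = ?e \<omega> * (rchar \<theta> h j (wgt \<theta> (N h \<omega>) * z) - rchar \<theta> h j (\<theta> * z))"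
          using 3 by (simp add: algebra_simps)
        then have "cmod (?G \<omega>) = cmod (rchar \<theta> h j (wgt \<theta> (N h \<omega>) * z) - rchar \<theta> h j (\<theta> * z))"
          by (simp only: norm_mult norm_exp_i_times mult_1)
        also have "\<dots> \<le> 2" using norm_triangle_ineq4[of "rchar \<theta> h j (wgt \<theta> (N h \<omega>) * z)" "rchar \<theta> h j (\<theta> * z)"] rchar_le[of j "wgt \<theta> (N h \<omega>) * z"] rchar_le[of j "\<theta> * z"]
          by linarith
        finally show ?thesis using 3 \<omega> by simp
      qed (simp_all add: wgt_def)
    qed
  qed
  also have "\<dots> = 2 * prob {\<omega> \<in> space M. N h \<omega> \<notin> {0, 1}}" by simp
  also have "\<dots> \<le> 2 * (h * (u + w))\<^sup>2" using prob_two_jumps[of h] h by simp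
  finally show ?thesis unfolding eq .
qed

text \<open>The two estimates are combined to eliminate the sum with one more cell. After division
  by h the coefficients are difference quotients that converge to \<open>stay_rate\<close> and
  \<open>stay_rate + jump_rate\<close>.\<close>

lemma rchar_key:
  assumes h: "0 < h"
  shows "cmod (rchar \<theta> h j z * ((exp (of_real h * stay_rate z) - 1) / of_real h) +
     ((exp (of_real h * (stay_rate z + jump_rate z)) - 1) / of_real h - (exp (of_real h * stay_rate z) - 1) / of_real h) * rchar \<theta> h j (\<theta> * z))
     \<le> 2 * h * (u + w)\<^sup>2 + \<bar>z\<bar> * (exp (- (real j * h * (u + w) * (1 - \<theta>))) * (v + \<alpha> * w))"
proof -
  let ?a = "exp (of_real h * stay_rate z)" and ?b = "exp (of_real h * (stay_rate z + jump_rate z))"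
  let ?Q = "rchar \<theta> h j z * (?a - 1) + (?b - ?a) * rchar \<theta> h j (\<theta> * z)"
  have Q: "?Q = (rchar \<theta> h (Suc j) z - rchar \<theta> h j z) - (rchar \<theta> h (Suc j) z - ?a * rchar \<theta> h j z - (?b - ?a) * rchar \<theta> h j (\<theta> * z))"
    by (simp add: algebra_simps)
  have "cmod ?Q \<le> \<bar>z\<bar> * (exp (- (real j * h * (u + w) * (1 - \<theta>))) * (h * (v + \<alpha> * w))) + 2 * (h * (u + w))\<^sup>2"
    unfolding Q by (rule order_trans[OF norm_triangle_ineq4 add_mono[OF rchar_diff[OF h] rchar_step[OF h]]])
  also have "\<dots> = (2 * h * (u + w)\<^sup>2 + \<bar>z\<bar> * (exp (- (real j * h * (u + w) * (1 - \<theta>))) * (v + \<alpha> * w))) * h"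
    by (simp add: power2_eq_square algebra_simps)
  finally have "cmod ?Q / h \<le> 2 * h * (u + w)\<^sup>2 + \<bar>z\<bar> * (exp (- (real j * h * (u + w) * (1 - \<theta>))) * (v + \<alpha> * w))"
    by (simp only: pos_divide_le_eq[OF h])
  moreover have "cmod (?Q / of_real h) = cmod ?Q / h"
    using h by (simp only: norm_divide norm_of_real abs_of_pos)
  moreover have "rchar \<theta> h j z * ((?a - 1) / of_real h) + ((?b - 1) / of_real h - (?a - 1) / of_real h) * rchar \<theta> h j (\<theta> * z) = ?Q / of_real h"
    using h by (simp add: field_simps)
  ultimately show ?thesis by (simp only:)
qed

text \<open>A version of the path integral that is measurable by construction; on regular paths the
  dyadic sums converge to the integral.\<close>

definition pint :: "nat \<Rightarrow> 'a \<Rightarrow> real" where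
  "pint t \<omega> = lim (\<lambda>m. riemann_sum \<theta> (\<lambda>t. N t \<omega>) (\<lambda>t. L t \<omega>) (1 / 2 ^ m) (t * 2 ^ m))"

lemma pint_measurable [measurable]: "pint t \<in> borel_measurable M"
  unfolding pint_def[abs_def] by (intro borel_measurable_lim_metric measurable_riemann_sum) simp

lemma pint_tendsto:
  assumes "nice_path (\<lambda>t. N t \<omega>) (\<lambda>t. L t \<omega>)"
  shows "(\<lambda>m. riemann_sum \<theta> (\<lambda>t. N t \<omega>) (\<lambda>t. L t \<omega>) (1 / 2 ^ m) (t * 2 ^ m)) \<longlonglongrightarrow> pint t \<omega>"
    and "pint t \<omega> = path_integral \<theta> (\<lambda>t. N t \<omega>) (\<lambda>t. L t \<omega>) (real t)"
proof -
  have *: "(\<lambda>m. riemann_sum \<theta> (\<lambda>t. N t \<omega>) (\<lambda>t. L t \<omega>) (1 / 2 ^ m) (t * 2 ^ m)) \<longlonglongrightarrow>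
    path_integral \<theta> (\<lambda>t. N t \<omega>) (\<lambda>t. L t \<omega>) (real t)"
    by (rule riemann_sum_tendsto[OF assms]) (use th in auto)
  then show "pint t \<omega> = path_integral \<theta> (\<lambda>t. N t \<omega>) (\<lambda>t. L t \<omega>) (real t)"
    unfolding pint_def by (rule limI)
  with * show "(\<lambda>m. riemann_sum \<theta> (\<lambda>t. N t \<omega>) (\<lambda>t. L t \<omega>) (1 / 2 ^ m) (t * 2 ^ m)) \<longlonglongrightarrow> pint t \<omega>" by simp
qed

lemma rchar_tendsto: "(\<lambda>m. rchar \<theta> (1 / 2 ^ m) (t * 2 ^ m) z) \<longlonglongrightarrow> (CLINT \<omega>|M. iexp (z * pint t \<omega>))"
proof -
  have "(\<lambda>m. CLINT \<omega>|M. iexp (z * riemann_sum \<theta> (\<lambda>t. N t \<omega>) (\<lambda>t. L t \<omega>) (1 / 2 ^ m) (t * 2 ^ m)))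
     \<longlonglongrightarrow> (CLINT \<omega>|M. iexp (z * pint t \<omega>))"
  proof (rule integral_dominated_convergence[where w = "\<lambda>_. 1"])
    show "AE \<omega> in M. (\<lambda>m. iexp (z * riemann_sum \<theta> (\<lambda>t. N t \<omega>) (\<lambda>t. L t \<omega>) (1 / 2 ^ m) (t * 2 ^ m))) \<longlonglongrightarrow> iexp (z * pint t \<omega>)"
      using AE_nice by eventually_elim (intro tendsto_intros pint_tendsto)
    have [measurable]: "(\<lambda>\<omega>. riemann_sum \<theta> (\<lambda>t. N t \<omega>) (\<lambda>t. L t \<omega>) (1 / 2 ^ m) (t * 2 ^ m)) \<in> borel_measurable M" for m
      by (rule measurable_riemann_sum) simp
    show "(\<lambda>\<omega>. iexp (z * riemann_sum \<theta> (\<lambda>t. N t \<omega>) (\<lambda>t. L t \<omega>) (1 / 2 ^ m) (t * 2 ^ m))) \<in> borel_measurable M" for m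
      by measurable
  qed auto
  then show ?thesis by (simp add: rchar_eq_riemann_sum)
qed

text \<open>The mesh tends to 0 at fixed time t: with t 2^m cells of width 2^(-m) the remainder from
  the last cell does not depend on m, and the term from multiple jumps vanishes.\<close>

lemma pint_key:
  "cmod ((CLINT \<omega>|M. iexp (z * pint t \<omega>)) * stay_rate z + jump_rate z * (CLINT \<omega>|M. iexp ((\<theta> * z) * pint t \<omega>)))
    \<le> \<bar>z\<bar> * (exp (- (real t * (u + w) * (1 - \<theta>))) * (v + \<alpha> * w))"
proof -
  let ?h = "\<lambda>m. 1 / 2 ^ m :: real"
  have "cmod ((CLINT \<omega>|M. iexp (z * pint t \<omega>)) * stay_rate z + ((stay_rate z + jump_rate z) - stay_rate z) * (CLINT \<omega>|M. iexp ((\<theta> * z) * pint t \<omega>)))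
    \<le> 2 * 0 * (u + w)\<^sup>2 + \<bar>z\<bar> * (exp (- (real t * (u + w) * (1 - \<theta>))) * (v + \<alpha> * w))"
  proof (rule tendsto_le[OF sequentially_bot])
    have "(\<lambda>m. (1 / 2) ^ m :: real) \<longlonglongrightarrow> 0" by (rule LIMSEQ_power_zero) simp
    then have "?h \<longlonglongrightarrow> 0" by (simp add: power_one_over)
    then show "(\<lambda>m. 2 * ?h m * (u + w)\<^sup>2 + \<bar>z\<bar> * (exp (- (real t * (u + w) * (1 - \<theta>))) * (v + \<alpha> * w)))
      \<longlonglongrightarrow> 2 * 0 * (u + w)\<^sup>2 + \<bar>z\<bar> * (exp (- (real t * (u + w) * (1 - \<theta>))) * (v + \<alpha> * w))"
      by (intro tendsto_add tendsto_mult tendsto_const)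
    show "(\<lambda>m. cmod (rchar \<theta> (?h m) (t * 2 ^ m) z * ((exp (of_real (?h m) * stay_rate z) - 1) / of_real (?h m)) +
     ((exp (of_real (?h m) * (stay_rate z + jump_rate z)) - 1) / of_real (?h m) - (exp (of_real (?h m) * stay_rate z) - 1) / of_real (?h m)) * rchar \<theta> (?h m) (t * 2 ^ m) (\<theta> * z)))
     \<longlonglongrightarrow> cmod ((CLINT \<omega>|M. iexp (z * pint t \<omega>)) * stay_rate z + ((stay_rate z + jump_rate z) - stay_rate z) * (CLINT \<omega>|M. iexp ((\<theta> * z) * pint t \<omega>)))"
      by (intro tendsto_norm tendsto_add tendsto_mult tendsto_diff rchar_tendsto exp_minus_one_over_tendsto)
    have "real (t * 2 ^ m) * ?h m = real t" for m by simp
    then show "\<forall>\<^sub>F m in sequentially. cmod (rchar \<theta> (?h m) (t * 2 ^ m) z * ((exp (of_real (?h m) * stay_rate z) - 1) / of_real (?h m)) +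
     ((exp (of_real (?h m) * (stay_rate z + jump_rate z)) - 1) / of_real (?h m) - (exp (of_real (?h m) * stay_rate z) - 1) / of_real (?h m)) * rchar \<theta> (?h m) (t * 2 ^ m) (\<theta> * z))
     \<le> 2 * ?h m * (u + w)\<^sup>2 + \<bar>z\<bar> * (exp (- (real t * (u + w) * (1 - \<theta>))) * (v + \<alpha> * w))"
      using rchar_key[of "?h m" "t * 2 ^ m" z for m] by (intro always_eventually allI) (simp only: zero_less_divide_1_iff zero_less_power zero_less_numeral)
  qed
  then show ?thesis by simp
qed

text \<open>The bound is uniform in t because the expected weight decays like exp (- (u + w) (1 -
  \<theta>) s); Fatou passes from the Riemann sums to the integral.\<close>

lemma pint_nn_integral: "(\<integral>\<^sup>+\<omega>. ennreal (pint t \<omega>) \<partial>M) \<le> ennreal ((1 + (u + w) * (1 - \<theta>)) / ((u + w) * (1 - \<theta>)) * (v + \<alpha> * w))"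
    (is "_ \<le> ennreal ?C")
proof -
  define l where "l = (u + w) * (1 - \<theta>)"
  have l: "0 < l" using rate_pos th by (simp add: l_def)
  let ?R = "\<lambda>m \<omega>. riemann_sum \<theta> (\<lambda>t. N t \<omega>) (\<lambda>t. L t \<omega>) (1 / 2 ^ m) (t * 2 ^ m)"
  have [measurable]: "?R m \<in> borel_measurable M" for m by (rule measurable_riemann_sum) simp
  have nn: "AE \<omega> in M. 0 \<le> ?R m \<omega>" for m
    using AE_nice
  proof eventually_elim
    case (elim \<omega>)
    show ?case unfolding riemann_sum_def
      using path_mono(2)[OF elim] wgt_bounds[of \<theta>] th
      by (intro sum_nonneg mult_nonneg_nonneg) (auto intro!: path_mono(2)[OF elim] divide_right_mono)
  qed
  have bound: "(\<integral>\<^sup>+\<omega>. ennreal (?R m \<omega>) \<partial>M) \<le> ennreal ?C" for m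
  proof -
    let ?h = "1 / 2 ^ m :: real"
    have e: "real (Suc k) * ?h = real k * ?h + ?h" "real k * ?h * l = real k * ?h * (u + w) * (1 - \<theta>)" for k
      by (simp_all only: of_nat_Suc distrib_right mult_1 add.commute l_def mult.assoc)
    have D: "integrable M (\<lambda>\<omega>. wgt \<theta> (N (real k * ?h) \<omega>) * (L (real (Suc k) * ?h) \<omega> - L (real k * ?h) \<omega>))"
      "expectation (\<lambda>\<omega>. wgt \<theta> (N (real k * ?h) \<omega>) * (L (real (Suc k) * ?h) \<omega> - L (real k * ?h) \<omega>)) =
        exp (- (real k * ?h * l)) * (?h * (v + \<alpha> * w))" for k
      unfolding e by (rule wgt_incr_mean; use th in simp)+
    have int: "integrable M (?R m)" unfolding riemann_sum_def by (intro Bochner_Integration.integrable_sum D)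
    have "(\<integral>\<^sup>+\<omega>. ennreal (?R m \<omega>) \<partial>M) = ennreal (expectation (?R m))"
      by (rule nn_integral_eq_integral[OF int nn])
    also have "expectation (?R m) = (\<Sum>k<t * 2 ^ m. exp (- (real k * ?h * l)) * (?h * (v + \<alpha> * w)))"
      unfolding riemann_sum_def by (subst Bochner_Integration.integral_sum[OF D(1)]) (simp only: D(2))
    also have "\<dots> = ?h * (\<Sum>k<t * 2 ^ m. exp (- (real k * ?h * l))) * (v + \<alpha> * w)"
      by (simp add: sum_distrib_right sum_distrib_left ac_simps)
    also have "\<dots> \<le> (1 + l) / l * (v + \<alpha> * w)"
      using rate_pos alpha l by (intro mult_right_mono geometric_sum_bound) auto
    finally show ?thesis unfolding l_def by (simp add: ennreal_leI)
  qed
  have "(\<integral>\<^sup>+\<omega>. ennreal (pint t \<omega>) \<partial>M) = (\<integral>\<^sup>+\<omega>. liminf (\<lambda>m. ennreal (?R m \<omega>)) \<partial>M)"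
  proof (rule nn_integral_cong_AE)
    show "AE \<omega> in M. ennreal (pint t \<omega>) = liminf (\<lambda>m. ennreal (?R m \<omega>))"
      using AE_nice
    proof eventually_elim
      case (elim \<omega>)
      have "(\<lambda>m. ennreal (?R m \<omega>)) \<longlonglongrightarrow> ennreal (pint t \<omega>)" by (intro tendsto_ennrealI pint_tendsto elim)
      then show ?case by (simp add: lim_imp_Liminf)
    qed
  qed
  also have "\<dots> \<le> liminf (\<lambda>m. \<integral>\<^sup>+\<omega>. ennreal (?R m \<omega>) \<partial>M)"
    by (rule nn_integral_liminf) measurable
  also have "\<dots> \<le> limsup (\<lambda>m. \<integral>\<^sup>+\<omega>. ennreal (?R m \<omega>) \<partial>M)" by (rule Liminf_le_Limsup) simp
  also have "\<dots> \<le> ennreal ?C" by (intro Limsup_bounded always_eventually allI bound)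
  finally show ?thesis .
qed

text \<open>The integrals increase with t, and by Fatou their limit has finite expectation, so it is
  finite almost surely.\<close>

lemma pint_convergent: "AE \<omega> in M. convergent (\<lambda>t. pint t \<omega>)"
proof -
  let ?C = "(1 + (u + w) * (1 - \<theta>)) / ((u + w) * (1 - \<theta>)) * (v + \<alpha> * w)"
  have "(\<integral>\<^sup>+\<omega>. liminf (\<lambda>t. ennreal (pint t \<omega>)) \<partial>M) \<le> liminf (\<lambda>t. \<integral>\<^sup>+\<omega>. ennreal (pint t \<omega>) \<partial>M)"
    by (rule nn_integral_liminf) measurable
  also have "\<dots> \<le> limsup (\<lambda>t. \<integral>\<^sup>+\<omega>. ennreal (pint t \<omega>) \<partial>M)" by (rule Liminf_le_Limsup) simp
  also have "\<dots> \<le> ennreal ?C" by (intro Limsup_bounded always_eventually allI pint_nn_integral)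
  also have "\<dots> < \<infinity>" by simp
  finally have "AE \<omega> in M. liminf (\<lambda>t. ennreal (pint t \<omega>)) \<noteq> \<infinity>"
    by (intro nn_integral_noteq_infinite) auto
  then show ?thesis using AE_nice
  proof eventually_elim
    case (elim \<omega>)
    let ?B = "liminf (\<lambda>t. ennreal (pint t \<omega>))"
    have mono: "pint s \<omega> \<le> pint t \<omega>" if "s \<le> t" for s t
      unfolding pint_tendsto(2)[OF elim(2)] using th that by (intro path_integral_mono[OF elim(2)]) auto
    have "pint t \<omega> \<le> enn2real ?B" for t
    proof -
      have "ennreal (pint t \<omega>) \<le> ?B"
        using mono by (intro Liminf_bounded eventually_mono[OF eventually_ge_at_top[of t]]) (auto intro: ennreal_leI)
      then have "enn2real (ennreal (pint t \<omega>)) \<le> enn2real ?B" using elim(1) by (intro enn2real_mono) (auto simp: top.not_eq_extremum)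
      moreover have "0 \<le> pint t \<omega>"
        unfolding pint_tendsto(2)[OF elim(2)] using th by (intro path_integral_nonneg[OF elim(2)]) auto
      ultimately show ?thesis by simp
    qed
    moreover have "incseq (\<lambda>t. pint t \<omega>)" using mono by (auto simp: incseq_def)
    ultimately obtain l where "(\<lambda>t. pint t \<omega>) \<longlonglongrightarrow> l" using incseq_convergent by blast
    then show ?case by (auto simp: convergent_def)
  qed
qed

definition plim :: "'a \<Rightarrow> real" where "plim \<omega> = lim (\<lambda>t. pint t \<omega>)"

lemma plim_measurable [measurable]: "plim \<in> borel_measurable M"
  unfolding plim_def[abs_def] by measurable

lemma plim_AE: "AE \<omega> in M. Lim at_top (path_integral \<theta> (\<lambda>t. N t \<omega>) (\<lambda>t. L t \<omega>)) = plim \<omega> \<and> 0 \<le> plim \<omega> \<and> (\<lambda>t. pint t \<omega>) \<longlonglongrightarrow> plim \<omega>"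
  using pint_convergent AE_nice
proof eventually_elim
  case (elim \<omega>)
  have YZ: "(\<lambda>t. pint t \<omega>) \<longlonglongrightarrow> plim \<omega>" using elim(1) by (simp add: plim_def convergent_LIMSEQ_iff)
  then have "(\<lambda>t. path_integral \<theta> (\<lambda>t. N t \<omega>) (\<lambda>t. L t \<omega>) (real t)) \<longlonglongrightarrow> plim \<omega>"
    unfolding pint_tendsto(2)[OF elim(2)] .
  from Lim_path_integral[OF elim(2) _ _ this] th
  have "Lim at_top (path_integral \<theta> (\<lambda>t. N t \<omega>) (\<lambda>t. L t \<omega>)) = plim \<omega>" by simp
  moreover have "0 \<le> pint t \<omega>" for t
    unfolding pint_tendsto(2)[OF elim(2)] using th by (intro path_integral_nonneg[OF elim(2)]) auto
  then have "0 \<le> plim \<omega>" using YZ by (intro LIMSEQ_le_const) auto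
  ultimately show ?case using YZ by simp
qed

text \<open>The exponentially small remainder of \<open>pint_key\<close> disappears as t tends to
  infinity, which leaves the exact functional equation.\<close>

lemma plim_char_eq: "char (distr M borel plim) z * stay_rate z + jump_rate z * char (distr M borel plim) (\<theta> * z) = 0"
proof -
  have lim: "(\<lambda>t. CLINT \<omega>|M. iexp (z * pint t \<omega>)) \<longlonglongrightarrow> char (distr M borel plim) z" for z
  proof -
    have "(\<lambda>t. CLINT \<omega>|M. iexp (z * pint t \<omega>)) \<longlonglongrightarrow> (CLINT \<omega>|M. iexp (z * plim \<omega>))"
    proof (rule integral_dominated_convergence[where w = "\<lambda>_. 1"])
      show "AE \<omega> in M. (\<lambda>t. iexp (z * pint t \<omega>)) \<longlonglongrightarrow> iexp (z * plim \<omega>)"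
        using plim_AE by eventually_elim (intro tendsto_intros, simp)
    qed auto
    then show ?thesis unfolding char_def by (subst integral_distr) auto
  qed
  have "cmod (char (distr M borel plim) z * stay_rate z + jump_rate z * char (distr M borel plim) (\<theta> * z)) \<le> \<bar>z\<bar> * (0 * (v + \<alpha> * w))"
  proof (rule tendsto_le[OF sequentially_bot])
    show "(\<lambda>t. cmod ((CLINT \<omega>|M. iexp (z * pint t \<omega>)) * stay_rate z + jump_rate z * (CLINT \<omega>|M. iexp ((\<theta> * z) * pint t \<omega>)))) \<longlonglongrightarrow>
      cmod (char (distr M borel plim) z * stay_rate z + jump_rate z * char (distr M borel plim) (\<theta> * z))"
      by (intro tendsto_intros lim)
    have "(\<lambda>t. exp (- ((u + w) * (1 - \<theta>))) ^ t) \<longlonglongrightarrow> 0"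
      using rate_pos th by (intro LIMSEQ_power_zero) auto
    moreover have "exp (- (real t * (u + w) * (1 - \<theta>))) = exp (- ((u + w) * (1 - \<theta>))) ^ t" for t
      by (simp add: exp_of_nat_mult[symmetric] ac_simps)
    ultimately have "(\<lambda>t. exp (- (real t * (u + w) * (1 - \<theta>)))) \<longlonglongrightarrow> 0" by simp
    then show "(\<lambda>t. \<bar>z\<bar> * (exp (- (real t * (u + w) * (1 - \<theta>))) * (v + \<alpha> * w))) \<longlonglongrightarrow> \<bar>z\<bar> * (0 * (v + \<alpha> * w))"
      by (intro tendsto_mult tendsto_const)
    show "\<forall>\<^sub>F t in sequentially. cmod ((CLINT \<omega>|M. iexp (z * pint t \<omega>)) * stay_rate z + jump_rate z * (CLINT \<omega>|M. iexp ((\<theta> * z) * pint t \<omega>)))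
      \<le> \<bar>z\<bar> * (exp (- (real t * (u + w) * (1 - \<theta>))) * (v + \<alpha> * w))"
      by (intro always_eventually allI pint_key)
  qed
  then show ?thesis by simp
qed

end

section \<open>The two functionals of the process as limits of path integrals\<close>

lemma AE_first_jump: "AE \<omega> in M. \<exists>t\<ge>0. N t \<omega> \<noteq> 0"
proof -
  define A where "A = {\<omega> \<in> space M. \<forall>n::nat. N (real n) \<omega> = 0}"
  have [measurable]: "N (real n) \<in> borel_measurable M" for n by (rule measN) simp
  have A[measurable]: "A \<in> events" unfolding A_def by measurable
  have "prob A \<le> exp (- (u + w)) ^ n" for n
  proof -
    have "prob A = expectation (indicator A)" by simp
    \<comment> \<open>For \<theta> = 0 the weight dominates the indicator of N_n = 0, and its mean
      exp (- (u + w) n) is already known.\<close>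
    also have "\<dots> \<le> expectation (\<lambda>\<omega>. wgt 0 (N (real n) \<omega>))"
      by (rule integral_mono) (use wgt_bounds[of 0] in \<open>auto simp: A_def indicator_def wgt_def intro!: integrable_const_bound[where B = 1]\<close>)
    also have "\<dots> = exp (- (u + w)) ^ n"
      using wgt_mean[of "real n" 0] by (simp add: exp_of_nat_mult[symmetric] algebra_simps)
    finally show ?thesis .
  qed
  moreover have "(\<lambda>n. exp (- (u + w)) ^ n) \<longlonglongrightarrow> 0"
    using rate_pos by (intro LIMSEQ_power_zero) auto
  ultimately have "prob A \<le> 0" by (intro LIMSEQ_le_const) auto
  then have "AE \<omega> in M. \<omega> \<notin> A"
    using A by (intro AE_not_in) (simp add: null_sets_def emeasure_eq_measure measure_le_0_iff)
  then show ?thesis using AE_space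
  proof eventually_elim
    case (elim \<omega>)
    then obtain n :: nat where "N (real n) \<omega> \<noteq> 0" by (auto simp: A_def)
    then show ?case by (intro exI[of _ "real n"]) auto
  qed
qed

lemma rho_eq: "rho M N L = distr M borel (plim 0)"
  unfolding rho_def
proof (rule distr_completion_AE[OF plim_measurable])
  show "AE \<omega> in M. L (first_jump_time (\<lambda>t. N t \<omega>)) \<omega> = plim 0 \<omega>"
    using plim_AE[OF order_refl zero_less_one] AE_nice AE_first_jump
  proof eventually_elim
    case (elim \<omega>)
    then obtain t1 where "0 \<le> t1" "N t1 \<omega> \<noteq> 0" by auto
    from Lim_path_integral_0[OF elim(2), OF this] elim(1) show ?case by simp
  qed
qed auto

lemma mu_eq:
  assumes c: "1 < c"
  shows "mu c M N L = distr M borel (plim (1 / c))"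
  unfolding mu_def
proof (rule distr_completion_AE[OF plim_measurable])
  have th: "0 \<le> 1 / c" "1 / c < 1" using c by auto
  show "AE \<omega> in M. Lim at_top (stieltjes_integral c (\<lambda>t. N t \<omega>) (\<lambda>t. L t \<omega>)) = plim (1 / c) \<omega>"
    using plim_AE[OF th] AE_nice
  proof eventually_elim
    case (elim \<omega>)
    have "stieltjes_integral c (\<lambda>t. N t \<omega>) (\<lambda>t. L t \<omega>) = path_integral (1 / c) (\<lambda>t. N t \<omega>) (\<lambda>t. L t \<omega>)"
      using c by (intro ext stieltjes_integral_eq_path_integral[OF elim(2)]) auto
    then show ?case using elim(1) c by simp
  qed
qed (use c in auto)

end

section \<open>From the jump measure to the fixed point equation\<close>

lemma integral_jump_measure:
  fixes f :: "real \<times> real \<Rightarrow> complex"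
  assumes [measurable]: "f \<in> borel_measurable borel" and uvw: "0 \<le> u" "0 \<le> v" "0 \<le> w" and c: "0 < c"
  shows "(\<integral>x. f x \<partial>jump_measure k c u v w) = of_real u * f (1, 0) + of_real v * f (0, 1) + of_real w * f (1, c powi (- k))"
proof -
  let ?J = "jump_measure k c u v w" and ?\<alpha> = "c powi (- k)"
  \<comment> \<open>This keeps the atoms (1, 0) and (1, \<alpha>) distinct.\<close>
  have \<alpha>: "?\<alpha> \<noteq> 0" using c by simp
  have cl: "{x} \<in> sets borel" for x :: "real \<times> real" by simp
  note em = emeasure_jump_measure[where k = k and c = c and u = u and v = v and w = w]
  have e: "emeasure ?J {(1, 0)} = ennreal u" "emeasure ?J {(0, 1)} = ennreal v" "emeasure ?J {(1, ?\<alpha>)} = ennreal w"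
    unfolding em[OF cl] using \<alpha> by auto
  have "- {(1, 0), (0, 1), (1, ?\<alpha>)} \<in> sets (borel :: (real \<times> real) measure)" by (rule borel_comp, rule borel_closed, rule finite_imp_closed) simp
  then have "emeasure ?J (- {(1, 0), (0, 1), (1, ?\<alpha>)}) = 0"
    by (subst em) auto
  then have ae: "AE x in ?J. x \<in> {(1, 0), (0, 1), (1, ?\<alpha>)}"
    using \<open>- _ \<in> sets borel\<close> by (intro AE_I[of _ _ "- {(1, 0), (0, 1), (1, ?\<alpha>)}"]) auto
  let ?i = "\<lambda>a x. indicator {a} x *\<^sub>R f a"
  have int: "integrable ?J (?i a)" if "emeasure ?J {a} < \<infinity>" for a
    using that by (intro integrable_scaleR_left integrable_real_indicator) auto
  have m: "measurable ?J N = measurable borel N" for N :: "complex measure"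
    by (rule measurable_cong_sets) auto
  have "(\<integral>x. f x \<partial>?J) = (\<integral>x. ?i (1, 0) x + ?i (0, 1) x + ?i (1, ?\<alpha>) x \<partial>?J)"
    by (rule integral_cong_AE) (use ae \<alpha> in \<open>auto simp: m\<close>)
  also have "\<dots> = measure ?J {(1, 0)} *\<^sub>R f (1, 0) + measure ?J {(0, 1)} *\<^sub>R f (0, 1) + measure ?J {(1, ?\<alpha>)} *\<^sub>R f (1, ?\<alpha>)"
    using int e by (simp add: sets_eq_imp_space_eq[of ?J borel])
  finally show ?thesis using e uvw by (simp add: measure_def scaleR_conv_of_real)
qed

lemma biv_bivariate_process:
  assumes "bivariate_process k c u v w M N L" and pos: "0 < u" "0 < v" "0 < w" and c: "0 < c"
  shows "biv M N L u v w (c powi (- k))"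
proof -
  have lp: "levy_process M (\<lambda>t \<omega>. (N t \<omega>, L t \<omega>))"
    and ch: "\<And>t z. 0 \<le> t \<Longrightarrow> (CLINT \<omega>|M. iexp (z \<bullet> (N t \<omega>, L t \<omega>))) =
      exp (of_real t * (CLINT x|jump_measure k c u v w. iexp (z \<bullet> x) - 1))"
    using assms(1) unfolding bivariate_process_def compound_poisson_process_def by auto
  interpret prob_space M using lp unfolding levy_process_def by simp
  show ?thesis
  proof
    fix t y z :: real assume t: "0 \<le> t"
    have "(CLINT \<omega>|M. iexp (y * N t \<omega> + z * L t \<omega>)) = (CLINT \<omega>|M. iexp ((y, z) \<bullet> (N t \<omega>, L t \<omega>)))"
      by (simp only: inner_Pair inner_real_def)
    also have "\<dots> = exp (of_real t * (CLINT x|jump_measure k c u v w. iexp ((y, z) \<bullet> x) - 1))"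
      by (rule ch[OF t])
    also have "(CLINT x|jump_measure k c u v w. iexp ((y, z) \<bullet> x) - 1) =
      of_real u * (iexp ((y, z) \<bullet> (1, 0)) - 1) + of_real v * (iexp ((y, z) \<bullet> (0, 1)) - 1) +
      of_real w * (iexp ((y, z) \<bullet> (1, c powi (- k))) - 1)"
      by (rule integral_jump_measure) (use pos c in auto)
    finally show "(CLINT \<omega>|M. iexp (y * N t \<omega> + z * L t \<omega>)) =
      exp (of_real t * (of_real u * (iexp y - 1) + of_real v * (iexp z - 1) + of_real w * (iexp (y + c powi (- k) * z) - 1)))"
      by (simp add: inner_Pair mult.commute)
  qed (use pos c lp in auto)
qed

context biv begin

text \<open>With S = u + v + w, \<open>stay_rate\<close> equals - S (1 - q exp (i z)), and
  \<open>jump_rate\<close> equals w exp (i \<alpha> z) (1 + s exp (- i \<alpha> z)). The normalizing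
  constant is w / S = (1 - q) / (1 + s).\<close>

lemma plim_char_fixpoint:
  assumes th: "0 \<le> \<theta>" "\<theta> < 1"
    and q: "q = v / (u + v + w)" and s: "s = u / w"
  shows "char (distr M borel (plim \<theta>)) z = iexp (\<alpha> * z) * ((1 - of_real q) / (1 - of_real q * iexp z)) *
       ((1 + of_real s * iexp (- \<alpha> * z)) / (1 + of_real s)) * char (distr M borel (plim \<theta>)) (\<theta> * z)"
proof -
  define S where "S = u + v + w"
  have S: "S > 0" "q = v / S" using rate_pos q by (auto simp: S_def)
  have q1: "0 < q" "q < 1" using rate_pos S by (auto simp: S_def)
  let ?E = "iexp (\<alpha> * z)" and ?c = "char (distr M borel (plim \<theta>))"
  let ?d = "1 - of_real q * iexp z"
  have d0: "?d \<noteq> 0" using q1 by (intro one_minus_iexp_nonzero) auto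
  have "of_real S * of_real q = (of_real v :: complex)" using S by simp
  then have "of_real S * ?d = of_real S - of_real v * iexp z"
    by (simp only: right_diff_distrib mult_1_right mult.assoc[symmetric])
  then have stay_rate: "stay_rate z = - (of_real S * ?d)"
    by (simp only:) (simp add: stay_rate_def S_def algebra_simps)
  have "?E * iexp (- \<alpha> * z) = 1" by (simp add: exp_add[symmetric])
  moreover have "of_real w * of_real s = (of_real u :: complex)" using rate_pos s by simp
  moreover have "of_real w * (?E * (1 + of_real s * iexp (- \<alpha> * z))) =
    of_real w * ?E + (of_real w * of_real s) * (?E * iexp (- \<alpha> * z))"
    by (simp only: distrib_left mult_1_right mult_1_left ac_simps)
  ultimately have jump_rate: "jump_rate z = of_real w * (?E * (1 + of_real s * iexp (- \<alpha> * z)))"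
    by (simp only: jump_rate_def mult_1_right add.commute)
  have "?c z * (of_real S * ?d) = of_real w * (?E * (1 + of_real s * iexp (- \<alpha> * z))) * ?c (\<theta> * z)"
    using plim_char_eq[OF th, of z] unfolding stay_rate jump_rate by (simp add: algebra_simps)
  then have "?c z = of_real (w / S) / ?d * (?E * (1 + of_real s * iexp (- \<alpha> * z))) * ?c (\<theta> * z)"
  proof -
    have "x = of_real (w / S) / d * B * y" if "x * (of_real S * d) = of_real w * B * y" "d \<noteq> 0" for x d B y :: complex
      using that S(1) by (simp add: field_simps)
    from this[OF _ d0] \<open>?c z * _ = _\<close> show ?thesis by blast
  qed
  moreover have "w / S = (1 - q) / (1 + s)"
  proof -
    have "1 - q = (u + w) / S" using S by (simp add: S_def field_simps)
    moreover have "1 + s = (u + w) / w" using rate_pos s by (simp add: field_simps)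
    ultimately show ?thesis using rate_pos by simp
  qed
  then have "of_real (w / S) = (1 - of_real q) / (1 + of_real s :: complex)" by (simp only: of_real_divide of_real_diff of_real_add of_real_1)
  ultimately show ?thesis by (simp only:) (simp add: ac_simps)
qed

lemma plim_ID0:
  assumes th: "0 \<le> \<theta>" "\<theta> < 1" and \<alpha>: "0 < \<alpha>"
    and q: "q = v / (u + v + w)" and s: "s = u / w" "s < 1"
    and par: "\<And>n m n' m'. m > 0 \<Longrightarrow> \<theta> ^ n * real m \<noteq> 0 \<Longrightarrow> \<theta> ^ n * real m = \<theta> ^ n' * real m' \<Longrightarrow> even m = even m'"
    and inj: "inj_on h {i. even (snd i)}"
    and loc: "\<And>i. even (snd i) \<Longrightarrow> loc \<theta> (h i) = \<alpha> * loc \<theta> i"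
    and le: "\<And>i. even (snd i) \<Longrightarrow> wt s i \<le> wt q (h i)"
  shows "symmetrization (distr M borel (plim \<theta>)) \<in> ID \<and> distr M borel (plim \<theta>) \<in> ID0"
proof -
  let ?\<sigma> = "distr M borel (plim \<theta>)"
  have q1: "0 < q" "q < 1" using rate_pos by (auto simp: q)
  have s0: "0 < s" using rate_pos s by simp
  have \<sigma>: "real_distribution ?\<sigma>" by (rule real_distribution_distr) (rule plim_measurable[OF th])
  interpret R: real_distribution ?\<sigma> by (rule \<sigma>)
  note fp = plim_char_fixpoint[OF th q s(1)]
  have nn: "AE y in ?\<sigma>. 0 \<le> y"
    using plim_AE[OF th] plim_measurable[OF th] by (subst AE_distr_iff) auto
  have "?\<sigma> \<notin> ID" by (rule fixpoint_not_ID[OF th q1 s0 s(2) \<alpha> \<sigma> nn fp])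
  moreover have "?\<sigma> \<in> quasi_ID"
    by (rule fixpoint_quasi_ID[OF th q1 s0 s(2) R.char_zero R.isCont_char fp \<sigma> refl \<alpha> par])
  moreover have "symmetrization ?\<sigma> \<in> ID"
    by (rule fixpoint_symmetrization_ID[OF th q1 s0 s(2) R.char_zero R.isCont_char fp refl inj loc le])
  ultimately show ?thesis by (simp add: ID0_def)
qed

end

section \<open>Choice of the parameters\<close>

lemma parity_0:
  assumes "(0::real) ^ n * real m \<noteq> 0" "0 ^ n * real m = 0 ^ n' * real m'"
  shows "even m = even m'"
  using assms by (cases n; cases n') auto

text \<open>Clearing denominators multiplies m and m' by powers of the odd number 3, which preserves
  parity.\<close>

lemma parity_third:
  assumes "(1 / 3) ^ n * real m = (1 / 3) ^ n' * real m'"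
  shows "even m = even m'"
proof -
  have "real (m * 3 ^ n') = real (m' * 3 ^ n)" using assms by (simp add: power_one_over field_simps)
  then have "m * 3 ^ n' = m' * 3 ^ n" by (simp only: of_nat_eq_iff)
  then have "even (m * 3 ^ n') = even (m' * 3 ^ n)" by simp
  then show ?thesis by simp
qed

text \<open>The value of s. Its numerator turns s^m into q^(l m) for q = 1/2, and the division by l
  pays for the factor l in the denominator of the mass at l m.\<close>

definition spar :: "nat \<Rightarrow> real" where "spar l = (1 / 2) ^ l / real l"

lemma spar_bounds: "1 \<le> l \<Longrightarrow> 0 < spar l \<and> spar l \<le> 1 / 2"
proof -
  assume l: "1 \<le> l"
  have "(1 / 2) ^ l / real l \<le> (1 / 2) ^ 1 / 1"
    using l by (intro frac_le power_decreasing) auto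
  then show ?thesis using l by (simp add: spar_def)
qed

lemma wt_spar_scale:
  assumes l: "1 \<le> l" shows "wt (spar l) (n, m) \<le> wt (1 / 2) (n', l * m)"
proof (cases "m = 0")
  case False
  have "spar l ^ m = (1 / 2) ^ (l * m) / real l ^ m"
    by (simp add: spar_def power_divide power_mult power_mult_distrib)
  also have "\<dots> \<le> (1 / 2) ^ (l * m) / real l"
    \<comment> \<open>For m \<ge> 1 a single factor l is kept out of l^m.\<close>
    using l False self_le_power[of "real l" m] by (intro divide_left_mono) auto
  finally have "spar l ^ m / real m \<le> (1 / 2) ^ (l * m) / real l / real m"
    by (rule divide_right_mono) simp
  then show ?thesis by (simp add: wt_def)
qed (simp add: wt_def)

lemma wt_spar_same:
  assumes l: "1 \<le> l" shows "wt (spar l) (n, m) \<le> wt (1 / 2) (n', m)"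
  using spar_bounds[OF l] by (auto simp: wt_def intro!: divide_right_mono power_mono)

lemma wt_spar_half:
  assumes l: "1 \<le> l" and m: "even m" shows "wt (spar l) (n, m) \<le> wt (1 / 2) (n', m div 2)"
proof (cases "m = 0")
  case False
  then have m2: "0 < m div 2" using m by (auto elim: evenE)
  have "spar l ^ m \<le> (1 / 2) ^ m" using spar_bounds[OF l] by (intro power_mono) auto
  also have "\<dots> \<le> (1 / 2) ^ (m div 2)" by (intro power_decreasing) auto
  finally show ?thesis using m2 by (auto simp: wt_def intro!: frac_le)
qed (simp add: wt_def)

lemma rates_biv:
  assumes l: "1 \<le> l" and c: "1 < c"
    and "rates (spar l * (1 / (2 * (1 + spar l)))) (1 / 2) (1 / (2 * (1 + spar l))) u v w"
    and "bivariate_process k c u v w M N L"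
  shows "biv M N L u v w (c powi (- k))" "1 / 2 = v / (u + v + w)" "spar l = u / w"
proof -
  define r where "r = 1 / (2 * (1 + spar l))"
  define S where "S = u + v + w"
  have r: "0 < r" using spar_bounds[OF l] by (simp add: r_def)
  have R: "0 \<le> u" "0 \<le> v" "0 \<le> w" "spar l * r = u / S" "1 / 2 = v / S" "r = w / S"
    using assms(3) unfolding rates_def r_def[symmetric] S_def by auto
  \<comment> \<open>If S were 0, division by zero would give r = 0.\<close>
  have "S \<noteq> 0" using R r by auto
  then have S: "S > 0" using R by (simp add: S_def)
  have eq: "u = spar l * r * S" "v = 1 / 2 * S" "w = r * S" using R(4,5,6) unfolding nonzero_eq_divide_eq[OF \<open>S \<noteq> 0\<close>] by simp_all
  have pos: "0 < u" "0 < v" "0 < w" unfolding eq using r S spar_bounds[OF l] by auto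
  show "biv M N L u v w (c powi (- k))"
    by (rule biv_bivariate_process[OF assms(4) pos]) (use c in simp)
  show "1 / 2 = v / (u + v + w)" using R(5) by (simp add: S_def)
  show "spar l = u / w" using r S by (simp add: eq)
qed

lemma admissible_spar:
  assumes l: "1 \<le> l" and c: "1 < c"
  shows "admissible c (spar l * (1 / (2 * (1 + spar l)))) (1 / 2) (1 / (2 * (1 + spar l)))"
proof -
  have s: "0 < spar l" using spar_bounds[OF l] by simp
  have "(d - 1) * (1 / (2 * d)) + 1 / 2 + 1 / (2 * d) = 1" if "0 < d" for d :: real
    using that by (simp add: field_simps)
  from this[of "1 + spar l"] s have "spar l * (1 / (2 * (1 + spar l))) + 1 / 2 + 1 / (2 * (1 + spar l)) = 1"
    by simp
  then show ?thesis using c s by (simp add: admissible_def add_pos_pos)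
qed

theorem corollary7p7:
  fixes k :: int
  shows
    "(\<exists>c p q r. admissible c p q r \<and>
        (\<forall>u v w (M :: 'a measure) N L.
           rates p q r u v w \<and> bivariate_process k c u v w M N L \<longrightarrow>
           symmetrization (rho M N L) \<in> ID \<and> rho M N L \<in> ID0)) \<and>
     (\<exists>c p q r. admissible c p q r \<and>
        (\<forall>u v w (M :: 'a measure) N L.
           rates p q r u v w \<and> bivariate_process k c u v w M N L \<longrightarrow>
           symmetrization (mu c M N L) \<in> ID \<and> mu c M N L \<in> ID0))"
proof -
  \<comment> \<open>For \<open>k \<le> 0\<close> and c = 3 this is \<alpha>, so multiplication by
    \<alpha> maps positive integers to positive integers.\<close>
  define l :: nat where "l = 3 ^ nat \<bar>k\<bar>"
  have l: "1 \<le> l" by (simp add: l_def)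
  have s1: "spar l < 1" using spar_bounds[OF l] by simp
  define r where "r = 1 / (2 * (1 + spar l))"
  note adm = admissible_spar[OF l, folded r_def]
  note biv = rates_biv[OF l, folded r_def]
  \<comment> \<open>For \<rho> only the points with n = 0 survive, so \<alpha> m must itself be an
    integer for even m. If \<open>0 < k\<close>, the choice c^k = 2 gives \<alpha> = 1/2, which is
    exactly what even m allow.\<close>
  define c where "c = (if 0 < k then 2 powr (1 / of_int k) else 3 :: real)"
  have c: "1 < c" by (simp add: c_def)
  have pow3: "3 powi (- k) = real l" if "k \<le> 0"
    using that by (simp add: l_def power_int_def)
  have half: "c powi (- k) = 1 / 2" if k: "0 < k"
  proof -
    have "c ^ nat k = 2"
      using k by (simp add: c_def powr_realpow[symmetric] powr_powr)
    moreover have "c powi k = c ^ nat k" using k by (simp add: power_int_def)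
    ultimately show ?thesis by (simp add: power_int_minus)
  qed
  have rho: "symmetrization (rho M N L) \<in> ID \<and> rho M N L \<in> ID0"
    if "rates (spar l * r) (1 / 2) r u v w" "bivariate_process k c u v w M N L"
    for u v w and M :: "'a measure" and N L
  proof -
    note b = biv[OF c that]
    interpret biv M N L u v w "c powi (- k)" by (rule b(1))
    define h where "h i = (fst i, if 0 < k then snd i div 2 else l * snd i)" for i :: "nat \<times> nat"
    show ?thesis unfolding rho_eq
    proof (rule plim_ID0[where h = h, OF _ _ _ b(2,3) s1])
      show "0 < c powi (- k)" using c by simp
      show "inj_on h {i. even (snd i)}"
        \<comment> \<open>Halving is injective here because only even second components are
          compared.\<close>
        using l by (auto simp: inj_on_def h_def split: if_splits elim!: evenE)
      show "loc 0 (h i) = c powi (- k) * loc 0 i" if "even (snd i)" for i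
      proof (cases "0 < k")
        case True
        then show ?thesis using half that by (auto simp: loc_def h_def elim!: evenE)
      next
        case False
        then show ?thesis using pow3 by (simp add: loc_def h_def c_def)
      qed
      show "wt (spar l) i \<le> wt (1 / 2) (h i)" if "even (snd i)" for i
        using wt_spar_half[OF l, of "snd i" "fst i" "fst i"] wt_spar_scale[OF l, of "fst i" "snd i" "fst i"] that
        by (simp add: h_def)
      show "even m = even m'" if "0 ^ n * real m \<noteq> 0" "0 ^ n * real m = 0 ^ n' * real m'" for n m n' m'
        using that by (rule parity_0)
    qed simp_all
  qed
  have mu: "symmetrization (mu 3 M N L) \<in> ID \<and> mu 3 M N L \<in> ID0"
    if "rates (spar l * r) (1 / 2) r u v w" "bivariate_process k 3 u v w M N L"
    for u v w and M :: "'a measure" and N L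
  proof -
    have 3: "1 < (3 :: real)" by simp
    note b = biv[OF 3 that]
    interpret biv M N L u v w "3 powi (- k)" by (rule b(1))
    \<comment> \<open>With \<theta> = 1/3 and \<alpha> = 3^(-k), a positive k shifts the level,
      since \<alpha> \<theta>^n = \<theta>^(n + k); otherwise \<alpha> = l multiplies m.\<close>
    define h where "h i = (if 0 < k then (fst i + nat k, snd i) else (fst i, l * snd i))" for i :: "nat \<times> nat"
    show ?thesis unfolding mu_eq[OF 3]
    proof (rule plim_ID0[where h = h, OF _ _ _ b(2,3) s1])
      show "inj_on h {i. even (snd i)}"
        using l by (auto simp: inj_on_def h_def split: if_splits)
      show "loc (1 / 3) (h i) = 3 powi (- k) * loc (1 / 3) i" for i
      proof (cases "0 < k")
        case True
        then have "3 powi (- k) = (1 / 3 :: real) ^ nat k"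
          by (simp add: power_int_def power_one_over inverse_eq_divide)
        then show ?thesis using True by (simp add: loc_def h_def power_add)
      next
        case False
        then show ?thesis using pow3 by (simp add: loc_def h_def)
      qed
      show "wt (spar l) i \<le> wt (1 / 2) (h i)" for i
        using wt_spar_same[OF l, of "fst i" "snd i" "fst i + nat k"] wt_spar_scale[OF l, of "fst i" "snd i" "fst i"]
        by (simp add: h_def)
      show "even m = even m'" if "(1 / 3) ^ n * real m = (1 / 3) ^ n' * real m'" for n m n' m'
        using that by (rule parity_third)
    qed simp_all
  qed
  show ?thesis
  proof
    show "\<exists>c p q r. admissible c p q r \<and> (\<forall>u v w (M :: 'a measure) N L.
       rates p q r u v w \<and> bivariate_process k c u v w M N L \<longrightarrow>
       symmetrization (rho M N L) \<in> ID \<and> rho M N L \<in> ID0)"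
      using adm[OF c] rho by blast
    have "admissible 3 (spar l * r) (1 / 2) r" by (rule adm) simp
    then show "\<exists>c p q r. admissible c p q r \<and> (\<forall>u v w (M :: 'a measure) N L.
       rates p q r u v w \<and> bivariate_process k c u v w M N L \<longrightarrow>
       symmetrization (mu c M N L) \<in> ID \<and> mu c M N L \<in> ID0)"
      using mu by blast
  qed
qed

end
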